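(* Let $(\mathcal{A},-)$ be a finite-dimensional simple unital associative algebra with involution (i.e., there is no proper nonzero ideal closed under the involution) over an algebraically closed field $\mathbb{F}$ of characteristic $3$. Let $\mathcal{T}$ be a nonzero finite-dimensional left $\mathcal{A}$-module and let $h\colon\mathcal{T}\times\mathcal{T}\to\mathcal{A}$ be a nondegenerate skew-hermitian form. Then $\mathcal{T}$ is a $J$-ternary algebra with triple product $$(x,y,z)=h(x,y)z+h(z,x)y+h(z,y)x,\qquad x,y,z\in\mathcal{T}.$$ Let $\mathcal{L}^{\mathrm{ss}}(\mathcal{T})$ be the associated weak Lie superalgebra. Then $\mathcal{L}^{\mathrm{ss}}(\mathcal{T})$ is a Lie superalgebra and the following hold: (a) If the involution $-$ on $\mathcal{A}$ is of the first kind, then there are $n,m\in\mathbb{Z}_{>0}$, with $m$ even, such that $\mathcal{L}^{\mathrm{ss}}(\mathcal{T})$ is isomorphic to the orthosymplectic Lie superalgebra $\mathfrak{osp}(n\vert m)$. (b) If the involution $-$ on $\mathcal{A}$ is of the second kind, then there are $n,m\in\mathbb{Z}_{>0}$ such that $\mathcal{L}^{\mathrm{ss}}(\mathcal{T})$ is isomorphic to the projective special linear Lie superalgebra $\mathfrak{psl}(n\vert m)$.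
   Context: Involution of the first (second) kind: it acts trivially (nontrivially) on the center of $\mathcal{A}$. Skew-hermitian form: $h$ is $\mathbb{F}$-bilinear, $h(ax,y)=a\,h(x,y)$, $h(y,x)=-\overline{h(x,y)}$; nondegenerate: $h(x,\mathcal{T})=0$ implies $x=0$. Modules are unital. A $J$-ternary algebra is a vector space $\mathcal{T}$ with a trilinear product $xyz$ such that $xy(uvz)=(xyu)vz+u(yxv)z+uv(xyz)$ and $xyz-zyx=zxy-xzy$ for all $x,y,z,u,v$. For a $J$-ternary algebra $\mathcal{T}$ with product $(x,y,z)$ in characteristic $3$, let $S(x,y)\colon z\mapsto(x,y,z)+(y,x,z)$ and $S(\mathcal{T},\mathcal{T})=\mathrm{span}\{S(x,y)\}$. Its associated weak Lie superalgebra is $\mathcal{L}^{\mathrm{ss}}(\mathcal{T})=S(\mathcal{T},\mathcal{T})\oplus\mathcal{T}$, with even part $S(\mathcal{T},\mathcal{T})$, odd part $\mathcal{T}$, and bracket given by the commutator on $S(\mathcal{T},\mathcal{T})$, $[d,x]=d(x)$ for $d\in S(\mathcal{T},\mathcal{T})$, $x\in\mathcal{T}$, and $[x,y]=S(x,y)$ for $x,y\in\mathcal{T}$. A weak Lie superalgebra satisfies super-anticommutativity and the super Jacobi identity; a Lie superalgebra in characteristic $3$ satisfies in addition $[[x,x],x]=0$ for all odd $x$. $\mathfrak{osp}(n\vert m)$ is the orthosymplectic Lie superalgebra of a vector superspace with even part of dimension $n$ and odd part of dimension $m$, relative to a nondegenerate even supersymmetric bilinear form (symmetric on the even part, skew-symmetric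 on the odd part). $\mathfrak{psl}(n\vert m)$ is the quotient of $\mathfrak{sl}(n\vert m)=\{\varphi\in\mathfrak{gl}(n\vert m)\mid\mathrm{str}(\varphi)=0\}$ by $\mathfrak{sl}(n\vert m)\cap\mathbb{F}\,\mathrm{id}$. *)

theory Defs
  imports
    Jordan_Normal_Form.Matrix
    "HOL-Library.Function_Algebras"
    "HOL-Library.Product_Plus"
    "HOL-Computational_Algebra.Polynomial"
begin

section \<open>Algebras with involution, modules, skew-hermitian forms\<close>

text \<open>The ambient algebra is a whole type of class \<open>ring_1\<close>, so it is unital and nonzero.\<close>

locale assoc_algebra = vector_space scale
  for scale :: "'f::field \<Rightarrow> 'a::ring_1 \<Rightarrow> 'a" +
  assumes scale_mult_left: "scale c (a * b) = scale c a * b"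
    and scale_mult_right: "scale c (a * b) = a * scale c b"

locale algebra_with_involution = assoc_algebra scale
  for scale :: "'f::field \<Rightarrow> 'a::ring_1 \<Rightarrow> 'a" +
  fixes star :: "'a \<Rightarrow> 'a"
  assumes star_linear: "Vector_Spaces.linear scale scale star"
    and star_mult: "star (a * b) = star b * star a"
    and star_star: "star (star a) = a"

definition finite_dim :: "('f::field \<Rightarrow> 'v::ab_group_add \<Rightarrow> 'v) \<Rightarrow> bool" where
  "finite_dim scale \<longleftrightarrow> (\<exists>B. finite_dimensional_vector_space scale B)"

text \<open>Since the algebra is unital, two-sided ring ideals are automatically subspaces.\<close>

definition two_sided_ideal :: "'a::ring_1 set \<Rightarrow> bool" where
  "two_sided_ideal I \<longleftrightarrow> 0 \<in> I \<and> (\<forall>x\<in>I. \<forall>y\<in>I. x + y \<in> I) \<and>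
     (\<forall>x\<in>I. \<forall>a. a * x \<in> I \<and> x * a \<in> I)"

definition simple_with_involution :: "('a::ring_1 \<Rightarrow> 'a) \<Rightarrow> bool" where
  "simple_with_involution star \<longleftrightarrow>
     (\<forall>I. two_sided_ideal I \<and> star ` I \<subseteq> I \<longrightarrow> I = {0} \<or> I = UNIV)"

definition ring_center :: "'a::ring_1 set" where
  "ring_center = {z. \<forall>a. z * a = a * z}"

definition first_kind :: "('a::ring_1 \<Rightarrow> 'a) \<Rightarrow> bool" where
  "first_kind star \<longleftrightarrow> (\<forall>z\<in>ring_center. star z = z)"

definition second_kind :: "('a::ring_1 \<Rightarrow> 'a) \<Rightarrow> bool" where
  "second_kind star \<longleftrightarrow> (\<exists>z\<in>ring_center. star z \<noteq> z)"

locale left_module = assoc_algebra scaleA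
  for scaleA :: "'f::field \<Rightarrow> 'a::ring_1 \<Rightarrow> 'a" +
  fixes scaleT :: "'f \<Rightarrow> 't::ab_group_add \<Rightarrow> 't"
    and act :: "'a \<Rightarrow> 't \<Rightarrow> 't"
  assumes act_linear_left: "Vector_Spaces.linear scaleA scaleT (\<lambda>a. act a x)"
    and act_linear_right: "Vector_Spaces.linear scaleT scaleT (\<lambda>x. act a x)"
    and act_mult: "act (a * b) x = act a (act b x)"
    and act_one: "act 1 x = x"

definition skew_hermitian ::
  "('f::field \<Rightarrow> 'a::ring_1 \<Rightarrow> 'a) \<Rightarrow> ('f \<Rightarrow> 't::ab_group_add \<Rightarrow> 't) \<Rightarrow>
   ('a \<Rightarrow> 'a) \<Rightarrow> ('a \<Rightarrow> 't \<Rightarrow> 't) \<Rightarrow> ('t \<Rightarrow> 't \<Rightarrow> 'a) \<Rightarrow> bool" where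
  "skew_hermitian scaleA scaleT star act h \<longleftrightarrow>
     (\<forall>y. Vector_Spaces.linear scaleT scaleA (\<lambda>x. h x y)) \<and>
     (\<forall>x. Vector_Spaces.linear scaleT scaleA (\<lambda>y. h x y)) \<and>
     (\<forall>a x y. h (act a x) y = a * h x y) \<and>
     (\<forall>x y. h y x = - star (h x y))"

definition nondegenerate_form :: "('t::zero \<Rightarrow> 't \<Rightarrow> 'a::zero) \<Rightarrow> bool" where
  "nondegenerate_form h \<longleftrightarrow> (\<forall>x. (\<forall>y. h x y = 0) \<longrightarrow> x = 0)"


section \<open>J-ternary algebras\<close>

definition J_ternary_algebra ::
  "('f::field \<Rightarrow> 't::ab_group_add \<Rightarrow> 't) \<Rightarrow> ('t \<Rightarrow> 't \<Rightarrow> 't \<Rightarrow> 't) \<Rightarrow> bool" where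
  "J_ternary_algebra scale p \<longleftrightarrow>
     vector_space scale \<and>
     (\<forall>y z. Vector_Spaces.linear scale scale (\<lambda>x. p x y z)) \<and>
     (\<forall>x z. Vector_Spaces.linear scale scale (\<lambda>y. p x y z)) \<and>
     (\<forall>x y. Vector_Spaces.linear scale scale (\<lambda>z. p x y z)) \<and>
     (\<forall>x y u v z. p x y (p u v z) = p (p x y u) v z + p u (p y x v) z + p u v (p x y z)) \<and>
     (\<forall>x y z. p x y z - p z y x = p z x y - p x z y)"

definition hermitian_triple ::
  "('a \<Rightarrow> 't::ab_group_add \<Rightarrow> 't) \<Rightarrow> ('t \<Rightarrow> 't \<Rightarrow> 'a) \<Rightarrow> 't \<Rightarrow> 't \<Rightarrow> 't \<Rightarrow> 't" where
  "hermitian_triple act h x y z = act (h x y) z + act (h z x) y + act (h z y) x"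


section \<open>(Weak) Lie superalgebras\<close>

text \<open>
  A superalgebra is given by carrier sets for its two homogeneous parts together with explicit
  operations; the operations are only meaningful on \<open>sa_carrier\<close>. Explicit carriers
  are needed because quotients live on sets of cosets.
\<close>

record ('f, 'g) superalgebra =
  sa_even :: "'g set"
  sa_odd :: "'g set"
  sa_zero :: 'g
  sa_add :: "'g \<Rightarrow> 'g \<Rightarrow> 'g"
  sa_scale :: "'f \<Rightarrow> 'g \<Rightarrow> 'g"
  sa_bracket :: "'g \<Rightarrow> 'g \<Rightarrow> 'g"

definition sa_carrier :: "('f, 'g) superalgebra \<Rightarrow> 'g set" where
  "sa_carrier L = {sa_add L x y | x y. x \<in> sa_even L \<and> y \<in> sa_odd L}"

text \<open>Parities are natural numbers taken modulo 2.\<close>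

definition sa_part :: "('f, 'g) superalgebra \<Rightarrow> nat \<Rightarrow> 'g set" where
  "sa_part L p = (if even p then sa_even L else sa_odd L)"

definition superspace :: "('f::field, 'g) superalgebra \<Rightarrow> bool" where
  "superspace L \<longleftrightarrow>
     comm_group \<lparr>carrier = sa_carrier L, monoid.mult = sa_add L, one = sa_zero L\<rparr> \<and>
     (\<forall>c. \<forall>x\<in>sa_carrier L. sa_scale L c x \<in> sa_carrier L) \<and>
     (\<forall>c. \<forall>x\<in>sa_carrier L. \<forall>y\<in>sa_carrier L.
        sa_scale L c (sa_add L x y) = sa_add L (sa_scale L c x) (sa_scale L c y)) \<and>
     (\<forall>c d. \<forall>x\<in>sa_carrier L.
        sa_scale L (c + d) x = sa_add L (sa_scale L c x) (sa_scale L d x)) \<and>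
     (\<forall>c d. \<forall>x\<in>sa_carrier L. sa_scale L c (sa_scale L d x) = sa_scale L (c * d) x) \<and>
     (\<forall>x\<in>sa_carrier L. sa_scale L 1 x = x) \<and>
     (\<forall>p. sa_zero L \<in> sa_part L p \<and>
        (\<forall>x\<in>sa_part L p. \<forall>y\<in>sa_part L p. sa_add L x y \<in> sa_part L p) \<and>
        (\<forall>c. \<forall>x\<in>sa_part L p. sa_scale L c x \<in> sa_part L p)) \<and>
     sa_even L \<inter> sa_odd L = {sa_zero L}"

definition super_bilinear :: "('f::field, 'g) superalgebra \<Rightarrow> bool" where
  "super_bilinear L \<longleftrightarrow>
     (\<forall>x\<in>sa_carrier L. \<forall>y\<in>sa_carrier L. \<forall>z\<in>sa_carrier L.
        sa_bracket L (sa_add L x y) z = sa_add L (sa_bracket L x z) (sa_bracket L y z) \<and>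
        sa_bracket L z (sa_add L x y) = sa_add L (sa_bracket L z x) (sa_bracket L z y)) \<and>
     (\<forall>c. \<forall>x\<in>sa_carrier L. \<forall>y\<in>sa_carrier L.
        sa_bracket L (sa_scale L c x) y = sa_scale L c (sa_bracket L x y) \<and>
        sa_bracket L x (sa_scale L c y) = sa_scale L c (sa_bracket L x y)) \<and>
     (\<forall>p q. \<forall>x\<in>sa_part L p. \<forall>y\<in>sa_part L q. sa_bracket L x y \<in> sa_part L (p + q))"

definition weak_lie_superalgebra :: "('f::field, 'g) superalgebra \<Rightarrow> bool" where
  "weak_lie_superalgebra L \<longleftrightarrow>
     superspace L \<and> super_bilinear L \<and>
     (\<forall>p q. \<forall>x\<in>sa_part L p. \<forall>y\<in>sa_part L q.
        sa_bracket L x y = sa_scale L (- ((- 1) ^ (p * q))) (sa_bracket L y x)) \<and>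
     (\<forall>p q r. \<forall>x\<in>sa_part L p. \<forall>y\<in>sa_part L q. \<forall>z\<in>sa_part L r.
        sa_bracket L x (sa_bracket L y z) =
          sa_add L (sa_bracket L (sa_bracket L x y) z)
            (sa_scale L ((- 1) ^ (p * q)) (sa_bracket L y (sa_bracket L x z))))"

text \<open>
  The last condition follows from the super Jacobi identity unless the characteristic
  is 3. (In characteristic 2 one would also need a squaring map; that case is not covered here.)
\<close>

definition lie_superalgebra :: "('f::field, 'g) superalgebra \<Rightarrow> bool" where
  "lie_superalgebra L \<longleftrightarrow> weak_lie_superalgebra L \<and>
     (\<forall>x\<in>sa_odd L. sa_bracket L (sa_bracket L x x) x = sa_zero L)"

definition superalgebra_iso ::
  "('f, 'g) superalgebra \<Rightarrow> ('f, 'k) superalgebra \<Rightarrow> ('g \<Rightarrow> 'k) \<Rightarrow> bool" where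
  "superalgebra_iso L M f \<longleftrightarrow>
     bij_betw f (sa_carrier L) (sa_carrier M) \<and>
     f ` sa_even L = sa_even M \<and> f ` sa_odd L = sa_odd M \<and>
     (\<forall>x\<in>sa_carrier L. \<forall>y\<in>sa_carrier L. f (sa_add L x y) = sa_add M (f x) (f y)) \<and>
     (\<forall>c. \<forall>x\<in>sa_carrier L. f (sa_scale L c x) = sa_scale M c (f x)) \<and>
     (\<forall>x\<in>sa_carrier L. \<forall>y\<in>sa_carrier L. f (sa_bracket L x y) = sa_bracket M (f x) (f y))"

definition superalgebra_isomorphic ::
  "('f, 'g) superalgebra \<Rightarrow> ('f, 'k) superalgebra \<Rightarrow> bool" where
  "superalgebra_isomorphic L M \<longleftrightarrow> (\<exists>f. superalgebra_iso L M f)"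

definition sa_restrict :: "('f, 'g) superalgebra \<Rightarrow> 'g set \<Rightarrow> ('f, 'g) superalgebra" where
  "sa_restrict L U = L\<lparr>sa_even := sa_even L \<inter> U, sa_odd := sa_odd L \<inter> U\<rparr>"

text \<open>
  Elements of the quotient by a graded ideal \<open>I\<close> are the cosets \<open>x + I\<close>. Adding \<open>I\<close> in the
  scalar multiple and the bracket makes the result a full coset again.
\<close>

definition sa_quotient :: "('f, 'g) superalgebra \<Rightarrow> 'g set \<Rightarrow> ('f, 'g set) superalgebra" where
  "sa_quotient L I =
     \<lparr>sa_even = {{sa_add L x i | i. i \<in> I} | x. x \<in> sa_even L},
      sa_odd = {{sa_add L x i | i. i \<in> I} | x. x \<in> sa_odd L},
      sa_zero = I,
      sa_add = (\<lambda>X Y. {sa_add L x y | x y. x \<in> X \<and> y \<in> Y}),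
      sa_scale = (\<lambda>c X. {sa_add L (sa_scale L c x) i | x i. x \<in> X \<and> i \<in> I}),
      sa_bracket = (\<lambda>X Y. {sa_add L (sa_bracket L x y) i | x y i. x \<in> X \<and> y \<in> Y \<and> i \<in> I})\<rparr>"


section \<open>The superalgebra of a J-ternary algebra in characteristic 3\<close>

definition S_op :: "('t::ab_group_add \<Rightarrow> 't \<Rightarrow> 't \<Rightarrow> 't) \<Rightarrow> 't \<Rightarrow> 't \<Rightarrow> 't \<Rightarrow> 't" where
  "S_op p x y = (\<lambda>z. p x y z + p y x z)"

definition S_span ::
  "('f::field \<Rightarrow> 't::ab_group_add \<Rightarrow> 't) \<Rightarrow> ('t \<Rightarrow> 't \<Rightarrow> 't \<Rightarrow> 't) \<Rightarrow> ('t \<Rightarrow> 't) set" where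
  "S_span scale p = module.span (\<lambda>c d z. scale c (d z)) {S_op p x y | x y. True}"

text \<open>
  The pair \<open>(d, x)\<close> stands for \<open>d + x\<close> with \<open>d\<close> even and \<open>x\<close> odd. Addition of pairs and of maps
  is componentwise resp. pointwise.
\<close>

definition Lss ::
  "('f::field \<Rightarrow> 't::ab_group_add \<Rightarrow> 't) \<Rightarrow> ('t \<Rightarrow> 't \<Rightarrow> 't \<Rightarrow> 't) \<Rightarrow>
   ('f, ('t \<Rightarrow> 't) \<times> 't) superalgebra" where
  "Lss scale p =
     \<lparr>sa_even = S_span scale p \<times> {0},
      sa_odd = {0} \<times> UNIV,
      sa_zero = (0, 0),
      sa_add = (+),
      sa_scale = (\<lambda>c (d, x). (\<lambda>z. scale c (d z), scale c x)),
      sa_bracket = (\<lambda>(d, x) (e, y). ((d \<circ> e) - (e \<circ> d) + S_op p x y, d y - e x))\<rparr>"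


section \<open>General linear, special linear and orthosymplectic superalgebras\<close>

text \<open>
  In \<open>F^(n|m)\<close>, realised as vectors of dimension \<open>n + m\<close>, the first \<open>n\<close> coordinates are even
  and the remaining \<open>m\<close> are odd.
\<close>

definition vec_even :: "nat \<Rightarrow> nat \<Rightarrow> 'f::field vec set" where
  "vec_even n m = {v \<in> carrier_vec (n + m). \<forall>i. n \<le> i \<and> i < n + m \<longrightarrow> v $ i = 0}"

definition vec_odd :: "nat \<Rightarrow> nat \<Rightarrow> 'f::field vec set" where
  "vec_odd n m = {v \<in> carrier_vec (n + m). \<forall>i<n. v $ i = 0}"

definition even_block :: "nat \<Rightarrow> 'f::field mat \<Rightarrow> 'f mat" where
  "even_block n X = mat (dim_row X) (dim_col X)
     (\<lambda>(i, j). if (i < n) = (j < n) then X $$ (i, j) else 0)"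

definition odd_block :: "nat \<Rightarrow> 'f::field mat \<Rightarrow> 'f mat" where
  "odd_block n X = mat (dim_row X) (dim_col X)
     (\<lambda>(i, j). if (i < n) \<noteq> (j < n) then X $$ (i, j) else 0)"

text \<open>
  The bracket is the bilinear extension of \<open>X Y - (-1)^(|X| |Y|) Y X\<close> for homogeneous \<open>X\<close>, \<open>Y\<close>.
\<close>

definition gl_super :: "nat \<Rightarrow> nat \<Rightarrow> ('f::field, 'f mat) superalgebra" where
  "gl_super n m =
     \<lparr>sa_even = {X \<in> carrier_mat (n + m) (n + m). even_block n X = X},
      sa_odd = {X \<in> carrier_mat (n + m) (n + m). odd_block n X = X},
      sa_zero = 0\<^sub>m (n + m) (n + m),
      sa_add = (+),
      sa_scale = (\<lambda>c X. c \<cdot>\<^sub>m X),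
      sa_bracket = (\<lambda>X Y. X * Y - even_block n Y * X - odd_block n Y * even_block n X
                             + odd_block n Y * odd_block n X)\<rparr>"

definition supertrace :: "nat \<Rightarrow> nat \<Rightarrow> 'f::field mat \<Rightarrow> 'f" where
  "supertrace n m X = (\<Sum>i<n. X $$ (i, i)) - (\<Sum>i=n..<n + m. X $$ (i, i))"

definition sl_super :: "nat \<Rightarrow> nat \<Rightarrow> ('f::field, 'f mat) superalgebra" where
  "sl_super n m = sa_restrict (gl_super n m) {X. supertrace n m X = 0}"

definition psl_super :: "nat \<Rightarrow> nat \<Rightarrow> ('f::field, 'f mat set) superalgebra" where
  "psl_super n m = sa_quotient (sl_super n m)
     (sa_carrier (sl_super n m) \<inter> {c \<cdot>\<^sub>m 1\<^sub>m (n + m) | c. True})"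

definition supersymmetric_form :: "nat \<Rightarrow> nat \<Rightarrow> ('f::field vec \<Rightarrow> 'f vec \<Rightarrow> 'f) \<Rightarrow> bool" where
  "supersymmetric_form n m b \<longleftrightarrow>
     (\<forall>u\<in>carrier_vec (n + m). \<forall>v\<in>carrier_vec (n + m). \<forall>w\<in>carrier_vec (n + m).
        b (u + v) w = b u w + b v w \<and> b w (u + v) = b w u + b w v) \<and>
     (\<forall>c. \<forall>u\<in>carrier_vec (n + m). \<forall>v\<in>carrier_vec (n + m).
        b (c \<cdot>\<^sub>v u) v = c * b u v \<and> b u (c \<cdot>\<^sub>v v) = c * b u v) \<and>
     (\<forall>u\<in>vec_even n m. \<forall>v\<in>vec_odd n m. b u v = 0 \<and> b v u = 0) \<and>
     (\<forall>u\<in>vec_even n m. \<forall>v\<in>vec_even n m. b u v = b v u) \<and>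
     (\<forall>u\<in>vec_odd n m. \<forall>v\<in>vec_odd n m. b u v = - b v u)"

definition nondegenerate_super_form :: "nat \<Rightarrow> nat \<Rightarrow> ('f::field vec \<Rightarrow> 'f vec \<Rightarrow> 'f) \<Rightarrow> bool" where
  "nondegenerate_super_form n m b \<longleftrightarrow>
     (\<forall>u\<in>carrier_vec (n + m). (\<forall>v\<in>carrier_vec (n + m). b u v = 0) \<longrightarrow> u = 0\<^sub>v (n + m))"

text \<open>
  A homogeneous \<open>X\<close> belongs to \<open>osp\<close> iff \<open>b (X u) v + (-1)^(|X| |u|) b u (X v) = 0\<close> for all
  homogeneous \<open>u\<close> and all \<open>v\<close>.
\<close>

definition osp_super ::
  "nat \<Rightarrow> nat \<Rightarrow> ('f::field vec \<Rightarrow> 'f vec \<Rightarrow> 'f) \<Rightarrow> ('f, 'f mat) superalgebra" where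
  "osp_super n m b = (gl_super n m)
     \<lparr>sa_even := {X \<in> sa_even (gl_super n m).
        \<forall>u\<in>vec_even n m \<union> vec_odd n m. \<forall>v\<in>carrier_vec (n + m).
          b (X *\<^sub>v u) v + b u (X *\<^sub>v v) = 0},
      sa_odd := {X \<in> sa_odd (gl_super n m). \<forall>v\<in>carrier_vec (n + m).
        (\<forall>u\<in>vec_even n m. b (X *\<^sub>v u) v + b u (X *\<^sub>v v) = 0) \<and>
        (\<forall>u\<in>vec_odd n m. b (X *\<^sub>v u) v - b u (X *\<^sub>v v) = 0)}\<rparr>"

end

theory Submission
  imports Defs "Jordan_Normal_Form.Determinant"
begin

text \<open>
  The theorem says that \<open>L\<^sup>s\<^sup>s(T)\<close> is a superalgebra of operators on a vector superspace, and the
  proof writes these operators down. On \<open>A \<oplus> T\<close> put \<open>\<phi>\<^sub>t(a, x) = (-h(x,t), a t)\<close>. These odd operators commute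
  with the left multiplications by \<open>A\<close>, and since \<open>2 = -1\<close> in characteristic 3 one has
  \<open>S(x,y)z = (h(x,y) + h(y,x))z - h(z,x)y - h(z,y)x\<close>, which is exactly the triple supercommutator relation
  \<open>[[\<phi>\<^sub>x, \<phi>\<^sub>y], \<phi>\<^sub>z] = \<phi>\<^sub>t\<close> with \<open>t = S(x,y)z\<close>. So \<open>L\<^sup>s\<^sup>s(T)\<close> is the superalgebra generated by the
  \<open>\<phi>\<^sub>t\<close>, up to even operators that commute with all of them.

  \<open>A \<oplus> T\<close> is too large by a Morita factor. Choose an idempotent \<open>e\<close> with \<open>e A e = F e\<close> (Brauer's lemma
  on minimal left ideals, \<open>rank_one_idempotent\<close>) and restrict the action to the superspace
  \<open>e(A \<oplus> T) = eA \<oplus> eT\<close> (\<open>odd_action_VW\<close>). There the action is as large as it can be: every linear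
  map from \<open>eA\<close> to \<open>eT\<close> is of the form \<open>a \<mapsto> a t\<close> (\<open>action_full\<close>).

  A minimal two-sided ideal \<open>B\<close> of \<open>A\<close> is either \<open>A\<close>, or satisfies \<open>A = B \<oplus> B\<^sup>*\<close>. In the first case
  \<open>A\<close> is simple, its centre is \<open>F\<close>, and the involution is of the first kind; in the second case the unit \<open>u\<close> of
  \<open>B\<close> is central with \<open>u\<^sup>* = 1 - u\<close>, and the involution is of the second kind.

  If \<open>A\<close> is simple, then \<open>e A e\<^sup>*\<close> is one-dimensional, and \<open>(a,b) \<mapsto> a b\<^sup>*\<close> and \<open>h\<close> give
  nondegenerate scalar forms on \<open>eA\<close> and \<open>eT\<close>. The involution acts on \<open>e A e\<^sup>*\<close> by a sign, and \<open>h\<close> is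
  skew-hermitian, so one of the forms is symmetric and the other one is skew. For the right
  choice of a sign the \<open>\<phi>\<^sub>t\<close> are skew with respect to their sum, and they are the whole odd part of \<open>osp\<close> (\<open>simple_osp\<close>). In the other case
  \<open>T = uT \<oplus> u\<^sup>*T\<close>, the two halves of \<open>t\<close> control the two off-diagonal blocks of \<open>\<phi>\<^sub>t\<close> independently,
  and the \<open>\<phi>\<^sub>t\<close> are the whole odd part of \<open>sl\<close> (\<open>exchange_psl\<close>).

  It remains to see that \<open>osp\<close> and \<open>sl\<close> are determined by their odd parts: the even part is spanned by
  the anticommutators of odd matrices (lemmas \<open>E_spanned\<close>), and by Schur's lemma an even matrix that commutes with
  the odd part is scalar, hence zero in \<open>osp\<close>, and killed by the passage from \<open>sl\<close> to \<open>psl\<close>. The abstract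
  comparison is \<open>matrix_model\<close>: it maps a matrix to its adjoint action on the odd part.
\<close>

section \<open>The weak Lie superalgebra of a J-ternary algebra\<close>

lemma char3_triple_eq_0:
  fixes scale :: "'f::field \<Rightarrow> 'v::ab_group_add \<Rightarrow> 'v"
  assumes "vector_space scale" "CHAR('f) = 3"
  shows "x + x + x = (0::'v)"
proof -
  interpret vector_space scale by fact
  have "(of_nat 3 :: 'f) = 0"
    using of_nat_CHAR[where 'a = 'f] by (simp only: assms(2))
  then have "(1::'f) + 1 + 1 = 0" by simp
  then have "scale (1 + 1 + 1) x = 0" by simp
  then show ?thesis by (simp only: scale_left_distrib scale_one)
qed

lemma vector_space_fun:
  assumes "vector_space scale"
  shows "vector_space (\<lambda>c d z. scale c (d z))"
proof -
  interpret vector_space scale by fact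
  show ?thesis
    by unfold_locales (auto simp: fun_eq_iff scale_right_distrib scale_left_distrib)
qed

locale J_ternary =
  fixes scale :: "'f::field \<Rightarrow> 't::ab_group_add \<Rightarrow> 't" and p :: "'t \<Rightarrow> 't \<Rightarrow> 't \<Rightarrow> 't"
  assumes J: "J_ternary_algebra scale p"
begin

sublocale vector_space scale
  using J by (simp add: J_ternary_algebra_def)

sublocale ops: vector_space "\<lambda>c d z. scale c (d z)"
  by (rule vector_space_fun) unfold_locales

lemma p_linear:
  "Vector_Spaces.linear scale scale (\<lambda>x. p x y z)"
  "Vector_Spaces.linear scale scale (\<lambda>y. p x y z)"
  "Vector_Spaces.linear scale scale (\<lambda>z. p x y z)"
  using J by (simp_all only: J_ternary_algebra_def)

lemma p_add:
  "p (x + x') y z = p x y z + p x' y z" "p x (y + y') z = p x y z + p x y' z"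
  "p x y (z + z') = p x y z + p x y z'"
  using p_linear(1)[of y z] p_linear(2)[of x z] p_linear(3)[of x y]
  by (simp_all add: Vector_Spaces.linear_iff)

lemma p_scale:
  "p (scale c x) y z = scale c (p x y z)" "p x (scale c y) z = scale c (p x y z)"
  "p x y (scale c z) = scale c (p x y z)"
  using p_linear(1)[of y z] p_linear(2)[of x z] p_linear(3)[of x y]
  by (simp_all add: Vector_Spaces.linear_iff)

lemma J_derivation: "p x y (p u v z) = p (p x y u) v z + p u (p y x v) z + p u v (p x y z)"
  using J unfolding J_ternary_algebra_def by blast

lemma J_commutation: "p x y z - p z y x = p z x y - p x z y"
  using J unfolding J_ternary_algebra_def by blast

abbreviation "S \<equiv> S_op p"

lemma S_add: "S (x + x') y = S x y + S x' y" "S x (y + y') = S x y + S x y'"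
  "S x y (z + z') = S x y z + S x y z'"
  by (simp_all add: S_op_def p_add fun_eq_iff algebra_simps)

lemma S_scale: "S (scale c x) y = (\<lambda>z. scale c (S x y z))" "S x (scale c y) = (\<lambda>z. scale c (S x y z))"
  "S x y (scale c z) = scale c (S x y z)"
  by (simp_all add: S_op_def p_scale fun_eq_iff scale_right_distrib)

lemma S_commute: "S x y = S y x"
  by (simp add: S_op_def fun_eq_iff add.commute)

lemma S_0: "S 0 y = 0" "S x 0 = 0" "S x y 0 = 0"
  using S_scale(3)[of x y 0 0] S_scale(1)[of 0 0 y] S_scale(2)[of x 0 0] by (simp_all add: zero_fun_def)

lemma S_minus: "S (- x) y = - S x y" "S x (- y) = - S x y"
  using S_scale(1)[of "-1" x y] S_scale(2)[of x "-1" y] by (simp_all add: fun_Compl_def)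

abbreviation "SS \<equiv> S_span scale p"

lemma SS_subspace: "ops.subspace SS"
  unfolding S_span_def by (rule ops.subspace_span)

lemma S_in_SS: "S x y \<in> SS"
  unfolding S_span_def by (rule ops.span_base) auto

lemmas SS_closed =
  ops.subspace_0[OF SS_subspace] ops.subspace_add[OF SS_subspace] ops.subspace_diff[OF SS_subspace]
  ops.subspace_neg[OF SS_subspace] ops.subspace_scale[OF SS_subspace]

lemma zero_in_SS: "(\<lambda>z. 0) \<in> SS"
  using SS_closed(1) by (simp add: zero_fun_def)

text \<open>In the first identity \<open>x\<close> and \<open>y\<close> are exchanged in the middle term, so after symmetrisation
  each \<open>S(x,y)\<close> is a derivation of the triple product, and hence of the map \<open>S\<close>. The span inherits this.\<close>

lemma SS_derivation:
  assumes "d \<in> SS"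
  shows "d (x + y) = d x + d y" "d (scale c x) = scale c (d x)"
    "d (S x y z) = S (d x) y z + S x (d y) z + S x y (d z)"
proof -
  let ?D = "{d. (\<forall>x y. d (x + y) = d x + d y) \<and> (\<forall>c x. d (scale c x) = scale c (d x)) \<and>
    (\<forall>x y z. d (S x y z) = S (d x) y z + S x (d y) z + S x y (d z))}"
  have "ops.subspace ?D"
    by (rule ops.subspaceI)
      (auto simp: S_add S_0 S_scale scale_right_distrib scale_left_commute algebra_simps)
  moreover have "{S x y | x y. True} \<subseteq> ?D"
  proof clarsimp
    fix a b
    have "S a b (S x y z) = S (S a b x) y z + S x (S a b y) z + S x y (S a b z)" for x y z
    proof -
      note d = J_derivation[of a b x y z] J_derivation[of b a x y z]
        J_derivation[of a b y x z] J_derivation[of b a y x z]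
      show ?thesis by (simp add: S_op_def p_add d algebra_simps)
    qed
    then show "(\<forall>x y. S a b (x + y) = S a b x + S a b y) \<and>
      (\<forall>c x. S a b (scale c x) = scale c (S a b x)) \<and>
      (\<forall>x y z. S a b (S x y z) = S (S a b x) y z + S x (S a b y) z + S x y (S a b z))"
      by (simp add: S_add S_scale)
  qed
  ultimately have "SS \<subseteq> ?D"
    unfolding S_span_def by (rule ops.span_minimal[rotated])
  then show "d (x + y) = d x + d y" "d (scale c x) = scale c (d x)"
    "d (S x y z) = S (d x) y z + S x (d y) z + S x y (d z)" using assms by auto
qed

lemma SS_0: "d \<in> SS \<Longrightarrow> d 0 = 0"
  using SS_derivation(2)[of d 0 0] by simp

lemma SS_minus: "d \<in> SS \<Longrightarrow> d (- x) = - d x"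
  using SS_derivation(2)[of d "-1" x] by simp

lemma SS_diff: "d \<in> SS \<Longrightarrow> d (x - y) = d x - d y"
  using SS_derivation(1)[of d x "-y"] SS_minus[of d y] by simp

lemma commutator_S: 
  assumes "d \<in> SS"
  shows "(d \<circ> S x y) - (S x y \<circ> d) = S (d x) y + S x (d y)"
  by (simp add: fun_eq_iff SS_derivation[OF assms])

lemma SS_commutator:
  assumes "d \<in> SS" "e \<in> SS"
  shows "(d \<circ> e) - (e \<circ> d) \<in> SS"
proof -
  let ?D = "{e. (d \<circ> e) - (e \<circ> d) \<in> SS}"
  have "ops.subspace ?D"
  proof (rule ops.subspaceI)
    have "(d \<circ> 0) - (0 \<circ> d) = 0" using SS_0[OF assms(1)] by (simp add: fun_eq_iff)
    then show "0 \<in> ?D" using SS_closed(1) by (simp only: mem_Collect_eq)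
    fix u v assume "u \<in> ?D" "v \<in> ?D"
    moreover have "(d \<circ> (u + v)) - ((u + v) \<circ> d)
      = ((d \<circ> u) - (u \<circ> d)) + ((d \<circ> v) - (v \<circ> d))"
      by (auto simp: fun_eq_iff SS_derivation[OF assms(1)])
    ultimately show "u + v \<in> ?D" using SS_closed(2) by simp
  next
    fix c u assume "u \<in> ?D"
    moreover have "(d \<circ> (\<lambda>z. scale c (u z))) - ((\<lambda>z. scale c (u z)) \<circ> d)
      = (\<lambda>z. scale c (((d \<circ> u) - (u \<circ> d)) z))"
      by (auto simp: fun_eq_iff SS_derivation[OF assms(1)] scale_right_diff_distrib)
    ultimately show "(\<lambda>z. scale c (u z)) \<in> ?D"
      using SS_closed(5)[of "(d \<circ> u) - (u \<circ> d)" c] by (simp only: mem_Collect_eq)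
  qed
  moreover have "{S x y | x y. True} \<subseteq> ?D"
    using assms(1) by (clarsimp simp: commutator_S SS_closed S_in_SS)
  ultimately have "SS \<subseteq> ?D"
    unfolding S_span_def by (rule ops.span_minimal[rotated])
  then show ?thesis using assms by auto
qed

text \<open>The second identity makes \<open>xyz + xzy\<close> invariant under cyclic permutations, so the sum of the
  triple product over all six permutations is three times one and the same element. This is the super Jacobi
  identity on three odd elements.\<close>

lemma S_cyclic_sum:
  assumes "CHAR('f) = 3"
  shows "S x y z + S y z x + S z x y = 0"
proof -
  have *: "p x y z + p x z y = p z x y + p z y x" for x y z
    using J_commutation[of x y z] by (simp add: algebra_simps)
  have "S x y z + S y z x + S z x y
    = (p x y z + p x z y) + (p y z x + p y x z) + (p z x y + p z y x)"
    by (simp add: S_op_def algebra_simps)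
  also have "\<dots> = (p x y z + p x z y) + (p x y z + p x z y) + (p x y z + p x z y)"
    using *[of x y z] *[of z x y] *[of y z x] by (simp add: algebra_simps)
  also have "\<dots> = 0"
    by (rule char3_triple_eq_0[OF vector_space_axioms assms])
  finally show ?thesis .
qed

abbreviation "L \<equiv> Lss scale p"

lemma Lss_simps:
  "sa_even L = SS \<times> {0}" "sa_odd L = {0} \<times> UNIV" "sa_zero L = (0, 0)" "sa_add L = (+)"
  "sa_scale L c (d, x) = (\<lambda>z. scale c (d z), scale c x)"
  "sa_bracket L (d, x) (e, y) = ((d \<circ> e) - (e \<circ> d) + S x y, d y - e x)"
  by (auto simp: Lss_def)

lemma Lss_carrier: "sa_carrier L = SS \<times> UNIV"
proof -
  have "(d, x) \<in> sa_carrier L" if "d \<in> SS" for d x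
    unfolding sa_carrier_def using that
    by (auto simp: Lss_simps intro!: exI[of _ d] exI[of _ 0])
  moreover have "sa_carrier L \<subseteq> SS \<times> UNIV"
    by (auto simp: sa_carrier_def Lss_simps)
  ultimately show ?thesis by auto
qed

lemma superspace_Lss: "superspace L"
proof -
  have "comm_group \<lparr>carrier = sa_carrier L, monoid.mult = sa_add L, one = sa_zero L\<rparr>"
  proof (rule comm_groupI, goal_cases)
    case (6 x)
    then show ?case
      by (auto simp: Lss_carrier Lss_simps zero_prod_def SS_closed
          intro!: bexI[of _ "- fst x"] exI[of _ "- snd x"])
  qed (auto simp: Lss_carrier Lss_simps zero_prod_def SS_closed ac_simps)
  then show ?thesis
    unfolding superspace_def
    by (auto simp: Lss_carrier Lss_simps SS_closed zero_in_SS fun_eq_iff scale_right_distrib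
        scale_left_distrib sa_part_def zero_fun_def
        split: if_splits)
qed

lemma comp_zero: "0 \<circ> d = 0" "d \<in> SS \<Longrightarrow> d \<circ> 0 = 0"
  by (auto simp: fun_eq_iff SS_0)

lemma super_bilinear_Lss: "super_bilinear L"
  unfolding super_bilinear_def
proof (intro conjI ballI allI, goal_cases)
  case (1 x y z)
  then obtain dx tx dy ty dz tz where *: "x = (dx, tx)" "y = (dy, ty)" "z = (dz, tz)"
    "dx \<in> SS" "dy \<in> SS" "dz \<in> SS" by (auto simp: Lss_carrier)
  note d = SS_derivation[OF *(4)] SS_derivation[OF *(5)] SS_derivation[OF *(6)]
  show ?case
    unfolding *(1-3) by (simp add: Lss_simps fun_eq_iff d S_add algebra_simps)
next
  case (2 x y z)
  then obtain dx tx dy ty dz tz where *: "x = (dx, tx)" "y = (dy, ty)" "z = (dz, tz)"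
    "dx \<in> SS" "dy \<in> SS" "dz \<in> SS" by (auto simp: Lss_carrier)
  note d = SS_derivation[OF *(4)] SS_derivation[OF *(5)] SS_derivation[OF *(6)]
  show ?case
    unfolding *(1-3) by (simp add: Lss_simps fun_eq_iff d S_add algebra_simps)
next
  case (3 c x y)
  then obtain dx tx dy ty where *: "x = (dx, tx)" "y = (dy, ty)" "dx \<in> SS" "dy \<in> SS"
    by (auto simp: Lss_carrier)
  note d = SS_derivation[OF *(3)] SS_derivation[OF *(4)]
  show ?case
    unfolding *(1-2)
    by (simp add: Lss_simps fun_eq_iff d S_scale scale_right_distrib scale_right_diff_distrib)
next
  case (4 c x y)
  then obtain dx tx dy ty where *: "x = (dx, tx)" "y = (dy, ty)" "dx \<in> SS" "dy \<in> SS"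
    by (auto simp: Lss_carrier)
  note d = SS_derivation[OF *(3)] SS_derivation[OF *(4)]
  show ?case
    unfolding *(1-2)
    by (simp add: Lss_simps fun_eq_iff d S_scale scale_right_distrib scale_right_diff_distrib)
next
  case (5 p q x y)
  then show ?case
    by (auto simp: sa_part_def Lss_simps SS_commutator S_in_SS S_0 SS_0 comp_zero
        split: if_splits)
qed

theorem weak_lie_superalgebra_Lss:
  assumes "CHAR('f) = 3"
  shows "weak_lie_superalgebra L"
  unfolding weak_lie_superalgebra_def
proof (intro conjI ballI allI superspace_Lss super_bilinear_Lss, goal_cases)
  case (1 p q x y)
  then show ?case
    by (cases "even p"; cases "even q")
      (auto simp: sa_part_def Lss_simps comp_zero S_0 SS_0 fun_eq_iff S_commute)
next
  case (2 p q r x y z)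
  obtain dx tx dy ty dz tz where xyz: "x = (dx, tx)" "y = (dy, ty)" "z = (dz, tz)"
    by (metis surj_pair)
  have part: "(d, t) \<in> sa_part L i \<longleftrightarrow> (if even i then d \<in> SS \<and> t = 0 else d = 0)" for d t i
    by (auto simp: sa_part_def Lss_simps)
  have SS: "dx \<in> SS" "dy \<in> SS" "dz \<in> SS"
    using 2 SS_closed(1) by (auto simp: xyz part split: if_splits)
  have d0: "dx 0 = 0" "dy 0 = 0" "dz 0 = 0" using SS SS_0 by - blast+
  have cyc: "S a b c + S a c b = - S b c a" for a b c
    using S_cyclic_sum[OF assms, of a b c]
    by (simp add: S_commute[of c a] eq_neg_iff_add_eq_0 algebra_simps)
  note d = SS_derivation[OF SS(1)] SS_derivation[OF SS(2)] SS_derivation[OF SS(3)] d0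
    SS_diff[OF SS(1)] SS_diff[OF SS(2)] SS_diff[OF SS(3)]
    SS_minus[OF SS(1)] SS_minus[OF SS(2)] SS_minus[OF SS(3)]
  from 2 cyc[of tx ty tz] show ?case
    unfolding xyz part
    by (cases "even p"; cases "even q"; cases "even r")
      (simp_all add: Lss_simps fun_eq_iff d S_0 S_minus S_commute)
qed

end

section \<open>Skew-hermitian forms\<close>

context algebra_with_involution
begin

lemma star_add: "star (a + b) = star a + star b" and star_scale: "star (scale c a) = scale c (star a)"
  using star_linear by (simp_all add: Vector_Spaces.linear_iff)

lemma star_0: "star 0 = 0"
  using star_add[of 0 0] by simp

lemma star_minus: "star (- a) = - star a"
  using star_add[of a "- a"] by (simp add: star_0 minus_unique)

lemma star_diff: "star (a - b) = star a - star b"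
  using star_add[of a "- b"] by (simp add: star_minus)

lemma star_1: "star 1 = 1"
  by (metis mult_1_left mult_1_right star_mult star_star)

lemma star_eq_0_iff: "star a = 0 \<longleftrightarrow> a = 0"
  by (metis star_0 star_star)

end

locale skew_hermitian_module =
  algebra_with_involution scaleA star + left_module scaleA scaleT act
  for scaleA :: "'f::field \<Rightarrow> 'a::ring_1 \<Rightarrow> 'a" and star :: "'a \<Rightarrow> 'a"
    and scaleT :: "'f \<Rightarrow> 't::ab_group_add \<Rightarrow> 't" and act :: "'a \<Rightarrow> 't \<Rightarrow> 't" +
  fixes h :: "'t \<Rightarrow> 't \<Rightarrow> 'a"
  assumes skew: "skew_hermitian scaleA scaleT star act h"
    and nondegenerate: "nondegenerate_form h"
begin

sublocale T: vector_space scaleT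
  using act_linear_left by (simp add: Vector_Spaces.linear_iff)

lemma act_add: "act (a + b) x = act a x + act b x" "act a (x + y) = act a x + act a y"
  using act_linear_left act_linear_right by (simp_all add: Vector_Spaces.linear_iff)

lemma act_scale: "act (scaleA c a) x = scaleT c (act a x)" "act a (scaleT c x) = scaleT c (act a x)"
  using act_linear_left act_linear_right by (simp_all add: Vector_Spaces.linear_iff)

lemma act_0: "act 0 x = 0" "act a 0 = 0"
  using act_add(1)[of 0 0 x] act_add(2)[of a 0 0] by simp_all

lemma act_minus: "act (- a) x = - act a x" "act a (- x) = - act a x"
  by (rule minus_unique[symmetric], simp add: act_add[symmetric] act_0)+

lemma act_diff: "act (a - b) x = act a x - act b x" "act a (x - y) = act a x - act a y"
  using act_add(1)[of a "-b" x] act_add(2)[of a x "-y"] by (simp_all add: act_minus)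

lemma act_sum: "act (\<Sum>i\<in>I. f i) x = (\<Sum>i\<in>I. act (f i) x)" "act a (\<Sum>i\<in>I. g i) = (\<Sum>i\<in>I. act a (g i))"
  by (induction I rule: infinite_finite_induct; simp add: act_0 act_add)+

lemma h_linear: "Vector_Spaces.linear scaleT scaleA (\<lambda>x. h x y)"
  "Vector_Spaces.linear scaleT scaleA (\<lambda>y. h x y)"
  using skew unfolding skew_hermitian_def by - blast+

lemma h_add: "h (x + x') y = h x y + h x' y" "h x (y + y') = h x y + h x y'"
  using h_linear(1)[of y] h_linear(2)[of x] by (simp_all add: Vector_Spaces.linear_iff)

lemma h_scale: "h (scaleT c x) y = scaleA c (h x y)" "h x (scaleT c y) = scaleA c (h x y)"
  using h_linear(1)[of y] h_linear(2)[of x] by (simp_all add: Vector_Spaces.linear_iff)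

lemma h_0: "h 0 y = 0" "h x 0 = 0"
  using h_add(1)[of 0 0 y] h_add(2)[of x 0 0] by simp_all

lemma h_minus: "h (- x) y = - h x y" "h x (- y) = - h x y"
  by (rule minus_unique[symmetric], simp add: h_add[symmetric] h_0)+

lemma h_diff: "h (x - x') y = h x y - h x' y" "h x (y - y') = h x y - h x y'"
  using h_add(1)[of x "-x'" y] h_add(2)[of x y "-y'"] by (simp_all add: h_minus)

lemma h_sum: "h (\<Sum>i\<in>I. g i) y = (\<Sum>i\<in>I. h (g i) y)" "h y (\<Sum>i\<in>I. g i) = (\<Sum>i\<in>I. h y (g i))"
  by (induction I rule: infinite_finite_induct; simp add: h_0 h_add)+

lemma h_skew: "h y x = - star (h x y)"
  using skew unfolding skew_hermitian_def by blast

lemma star_h: "star (h x y) = - h y x"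
  using h_skew[of y x] by simp

lemma h_act: "h (act a x) y = a * h x y" "h x (act a y) = h x y * star a"
proof -
  show *: "h (act a x) y = a * h x y" for a x y
    using skew unfolding skew_hermitian_def by blast
  show "h x (act a y) = h x y * star a"
    using h_skew[of x "act a y"] h_skew[of x y] by (simp add: * star_mult)
qed

lemma h_nondegenerate: "(\<And>y. h x y = 0) \<Longrightarrow> x = 0" "(\<And>y. h y x = 0) \<Longrightarrow> x = 0"
  proof -
  show *: "(\<And>y. h x y = 0) \<Longrightarrow> x = 0"
    using nondegenerate unfolding nondegenerate_form_def by blast
  show "(\<And>y. h y x = 0) \<Longrightarrow> x = 0"
    by (rule *) (metis h_skew neg_equal_0_iff_equal star_0)
qed

abbreviation "p \<equiv> hermitian_triple act h"

text \<open>Write \<open>(x,y,z) = c z + M z\<close> with \<open>c = h(x,y)\<close> and \<open>M z = h(z,x) y + h(z,y) x\<close>. The map \<open>M\<close> is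
  \<open>A\<close>-linear, symmetric in \<open>x\<close> and \<open>y\<close>, and skew with respect to \<open>h\<close>, while \<open>(y,x,z) = -c\<^sup>* z + M z\<close>. Hence
  in the first identity the coefficients of \<open>u\<close>, \<open>v\<close> and \<open>z\<close> agree separately.\<close>

theorem J_ternary_hermitian: "J_ternary_algebra scaleT p"
proof -
  have linear: "Vector_Spaces.linear scaleT scaleT (\<lambda>x. p x y z)"
    "Vector_Spaces.linear scaleT scaleT (\<lambda>y. p x y z)"
    "Vector_Spaces.linear scaleT scaleT (\<lambda>z. p x y z)" for x y z
    unfolding Vector_Spaces.linear_iff using T.vector_space_axioms
    by (simp_all add: hermitian_triple_def h_add act_add h_scale act_scale T.scale_right_distrib
        algebra_simps)
  have derivation: "p x y (p u v z) = p (p x y u) v z + p u (p y x v) z + p u v (p x y z)"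
    for x y u v z
    by (simp add: hermitian_triple_def h_add h_act act_add star_h act_diff act_minus
        act_mult[symmetric] algebra_simps)
  have commutation: "p x y z - p z y x = p z x y - p x z y" for x y z
    by (simp add: hermitian_triple_def algebra_simps)
  show ?thesis
    unfolding J_ternary_algebra_def
    by (intro conjI allI T.vector_space_axioms linear derivation commutation)
qed

sublocale J: J_ternary scaleT p
  by unfold_locales (rule J_ternary_hermitian)

text \<open>The last two summands of the triple product are symmetric in \<open>x\<close> and \<open>y\<close>, so they are doubled, and
  \<open>2 = -1\<close>.\<close>

lemma S_hermitian:
  assumes "CHAR('f) = 3"
  shows "S_op p x y z = act (h x y + h y x) z - act (h z x) y - act (h z y) x"
proof -
  have "a + a = - a" for a :: 't
    using char3_triple_eq_0[OF T.vector_space_axioms assms, of a] by (simp add: eq_neg_iff_add_eq_0)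
  from this[of "act (h z x) y"] this[of "act (h z y) x"] show ?thesis
    by (simp add: S_op_def hermitian_triple_def act_add algebra_simps)
qed

text \<open>Here \<open>[[x,x],x]\<close> is twice \<open>(x,x,x) = 3 h(x,x) x\<close>.\<close>

theorem lie_superalgebra_Lss_hermitian:
  assumes "CHAR('f) = 3"
  shows "lie_superalgebra J.L"
proof -
  have "J.S x x x = 0" for x
  proof -
    have "p x x x = 0"
      using char3_triple_eq_0[OF T.vector_space_axioms assms] by (simp add: hermitian_triple_def)
    then show ?thesis by (simp add: S_op_def)
  qed
  then show ?thesis
    using J.weak_lie_superalgebra_Lss[OF assms]
    by (auto simp: lie_superalgebra_def J.Lss_simps J.S_0)
qed

end

section \<open>Surjective homomorphisms and quotients\<close>

text \<open>Both \<open>osp\<close> and \<open>psl\<close> are reached through a surjective homomorphism \<open>g\<close> out of a superalgebra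
  of matrices: its kernel \<open>I\<close> is \<open>0\<close> in the first case and consists of scalar matrices in the
  second.  The two assumptions on \<open>I\<close> say that the fibres of \<open>g\<close> are the cosets of \<open>I\<close>.\<close>

locale surjective_hom =
  fixes M :: "('f::field, 'g) superalgebra" and L :: "('f, 'k) superalgebra"
    and g :: "'g \<Rightarrow> 'k" and I :: "'g set"
  assumes even_odd_carrier: "sa_even M \<subseteq> sa_carrier M" "sa_odd M \<subseteq> sa_carrier M"
    and closed: "\<And>x y. x \<in> sa_carrier M \<Longrightarrow> y \<in> sa_carrier M \<Longrightarrow> sa_add M x y \<in> sa_carrier M"
      "\<And>c x. x \<in> sa_carrier M \<Longrightarrow> sa_scale M c x \<in> sa_carrier M"
      "\<And>x y. x \<in> sa_carrier M \<Longrightarrow> y \<in> sa_carrier M \<Longrightarrow> sa_bracket M x y \<in> sa_carrier M"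
    and hom: "\<And>x y. x \<in> sa_carrier M \<Longrightarrow> y \<in> sa_carrier M \<Longrightarrow>
        g (sa_add M x y) = sa_add L (g x) (g y)"
      "\<And>c x. x \<in> sa_carrier M \<Longrightarrow> g (sa_scale M c x) = sa_scale L c (g x)"
      "\<And>x y. x \<in> sa_carrier M \<Longrightarrow> y \<in> sa_carrier M \<Longrightarrow>
        g (sa_bracket M x y) = sa_bracket L (g x) (g y)"
    and onto: "g ` sa_even M = sa_even L" "g ` sa_odd M = sa_odd L"
    and coset_fibre: "\<And>x i. x \<in> sa_carrier M \<Longrightarrow> i \<in> I \<Longrightarrow>
        sa_add M x i \<in> sa_carrier M \<and> g (sa_add M x i) = g x"
    and fibre_coset: "\<And>x y. x \<in> sa_carrier M \<Longrightarrow> y \<in> sa_carrier M \<Longrightarrow> g y = g x \<Longrightarrow>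
        \<exists>i\<in>I. y = sa_add M x i"
    and assoc: "\<And>x y i. x \<in> sa_carrier M \<Longrightarrow> y \<in> sa_carrier M \<Longrightarrow> i \<in> I \<Longrightarrow>
        sa_add M (sa_add M x y) i = sa_add M x (sa_add M y i)"
begin

lemma onto_carrier: "g ` sa_carrier M = sa_carrier L"
proof (intro subset_antisym subsetI)
  fix y assume "y \<in> g ` sa_carrier M"
  then obtain a b where ab: "a \<in> sa_even M" "b \<in> sa_odd M" "y = g (sa_add M a b)"
    unfolding sa_carrier_def by blast
  then have "a \<in> sa_carrier M" "b \<in> sa_carrier M" using even_odd_carrier by blast+
  then have "y = sa_add L (g a) (g b)" using ab(3) hom(1) by simp
  moreover have "g a \<in> sa_even L" "g b \<in> sa_odd L" using ab onto by blast+
  ultimately show "y \<in> sa_carrier L" unfolding sa_carrier_def by blast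
next
  fix y assume "y \<in> sa_carrier L"
  then obtain a b where ab: "a \<in> sa_even M" "b \<in> sa_odd M" "y = sa_add L (g a) (g b)"
    unfolding sa_carrier_def onto[symmetric] by blast
  then have c: "a \<in> sa_carrier M" "b \<in> sa_carrier M" using even_odd_carrier by blast+
  then have "y = g (sa_add M a b)" using ab(3) hom(1) by simp
  then show "y \<in> g ` sa_carrier M" using closed(1)[OF c] by blast
qed

lemma isomorphic_if_injective:
  assumes "inj_on g (sa_carrier M)"
  shows "superalgebra_isomorphic L M"
proof -
  let ?f = "inv_into (sa_carrier M) g"
  have gf: "g (?f y) = y" "?f y \<in> sa_carrier M" if "y \<in> sa_carrier L" for y
    using that f_inv_into_f inv_into_into onto_carrier by metis+
  have fg: "?f (g x) = x" if "x \<in> sa_carrier M" for x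
    using assms that by (rule inv_into_f_f)
  have bij: "bij_betw ?f (sa_carrier L) (sa_carrier M)"
    using assms onto_carrier by (intro bij_betw_inv_into) (simp add: bij_betw_def)
  have "?f ` g ` A = A" if "A \<subseteq> sa_carrier M" for A
    using fg that by (force simp: image_image)
  from this[of "sa_even M"] this[of "sa_odd M"]
  have img: "?f ` sa_even L = sa_even M" "?f ` sa_odd L = sa_odd M"
    using even_odd_carrier onto by simp_all
  have "?f (sa_add L x y) = sa_add M (?f x) (?f y)" if "x \<in> sa_carrier L" "y \<in> sa_carrier L" for x y
    using fg[of "sa_add M (?f x) (?f y)"] hom(1) closed(1) gf that by metis
  moreover have "?f (sa_scale L c x) = sa_scale M c (?f x)" if "x \<in> sa_carrier L" for c x
    using fg[of "sa_scale M c (?f x)"] hom(2) closed(2) gf that by metis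
  moreover have "?f (sa_bracket L x y) = sa_bracket M (?f x) (?f y)"
    if "x \<in> sa_carrier L" "y \<in> sa_carrier L" for x y
    using fg[of "sa_bracket M (?f x) (?f y)"] hom(3) closed(3) gf that by metis
  ultimately have "superalgebra_iso L M ?f"
    using bij img unfolding superalgebra_iso_def by blast
  then show ?thesis unfolding superalgebra_isomorphic_def by blast
qed

text \<open>The isomorphism sends an element of \<open>L\<close> to its fibre under \<open>g\<close>, which is a coset of \<open>I\<close>.\<close>

lemma isomorphic_quotient: "superalgebra_isomorphic L (sa_quotient M I)"
proof -
  let ?C = "sa_carrier M"
  define F where "F y = {x \<in> ?C. g x = y}" for y
  have fibre: "F (g x) = {sa_add M x i | i. i \<in> I}" if "x \<in> ?C" for x
    unfolding F_def using coset_fibre[OF that] fibre_coset[OF that] by blast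
  have fibreI: "z \<in> F (g x)" if "z \<in> ?C" "g z = g x" for z x using that by (simp add: F_def)
  have fibreD: "z \<in> ?C" "g z = y" if "z \<in> F y" for z y using that by (auto simp: F_def)
  have split: "\<exists>i\<in>I. z = sa_add M x i" if "z \<in> F (g x)" "x \<in> ?C" for z x
    using that fibre by auto
  have F_add: "F (sa_add L (g x) (g y)) = sa_add (sa_quotient M I) (F (g x)) (F (g y))"
    if x: "x \<in> ?C" and y: "y \<in> ?C" for x y
  proof -
    have "F (g (sa_add M x y)) = {sa_add M u v | u v. u \<in> F (g x) \<and> v \<in> F (g y)}"
    proof (intro subset_antisym subsetI)
      fix z assume "z \<in> F (g (sa_add M x y))"
      then obtain i where i: "i \<in> I" "z = sa_add M x (sa_add M y i)"
        using split[OF _ closed(1)[OF x y]] assoc[OF x y] by auto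
      moreover have "x \<in> F (g x)" "sa_add M y i \<in> F (g y)"
        using x y coset_fibre[OF y i(1)] by (simp_all add: F_def)
      ultimately show "z \<in> {sa_add M u v | u v. u \<in> F (g x) \<and> v \<in> F (g y)}"
        by blast
    next
      fix z assume "z \<in> {sa_add M u v | u v. u \<in> F (g x) \<and> v \<in> F (g y)}"
      then show "z \<in> F (g (sa_add M x y))"
        by (auto simp: F_def hom x y closed)
    qed
    then show ?thesis by (simp add: hom x y sa_quotient_def)
  qed
  have F_scale: "F (sa_scale L c (g x)) = sa_scale (sa_quotient M I) c (F (g x))"
    if x: "x \<in> ?C" for c x
  proof -
    have "F (g (sa_scale M c x)) = {sa_add M (sa_scale M c u) i | u i. u \<in> F (g x) \<and> i \<in> I}"
    proof (intro subset_antisym subsetI)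
      fix z assume "z \<in> F (g (sa_scale M c x))"
      then obtain i where "i \<in> I" "z = sa_add M (sa_scale M c x) i"
        using split[OF _ closed(2)[OF x]] by auto
      then show "z \<in> {sa_add M (sa_scale M c u) i | u i. u \<in> F (g x) \<and> i \<in> I}"
        using fibreI[OF x refl] by blast
    next
      fix z assume "z \<in> {sa_add M (sa_scale M c u) i | u i. u \<in> F (g x) \<and> i \<in> I}"
      then show "z \<in> F (g (sa_scale M c x))"
        using coset_fibre closed(2) by (auto simp: F_def hom x)
    qed
    then show ?thesis by (simp add: hom x sa_quotient_def)
  qed
  have F_bracket: "F (sa_bracket L (g x) (g y)) = sa_bracket (sa_quotient M I) (F (g x)) (F (g y))"
    if x: "x \<in> ?C" and y: "y \<in> ?C" for x y
  proof -
    have "F (g (sa_bracket M x y))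
      = {sa_add M (sa_bracket M u v) i | u v i. u \<in> F (g x) \<and> v \<in> F (g y) \<and> i \<in> I}"
    proof (intro subset_antisym subsetI)
      fix z assume "z \<in> F (g (sa_bracket M x y))"
      then obtain i where "i \<in> I" "z = sa_add M (sa_bracket M x y) i"
        using split[OF _ closed(3)[OF x y]] by auto
      then show "z \<in> {sa_add M (sa_bracket M u v) i | u v i. u \<in> F (g x) \<and> v \<in> F (g y) \<and> i \<in> I}"
        using fibreI[OF x refl] fibreI[OF y refl] by blast
    next
      fix z assume "z \<in> {sa_add M (sa_bracket M u v) i | u v i. u \<in> F (g x) \<and> v \<in> F (g y) \<and> i \<in> I}"
      then show "z \<in> F (g (sa_bracket M x y))"
        using coset_fibre closed(3) by (auto simp: F_def hom x y)
    qed
    then show ?thesis by (simp add: hom x y sa_quotient_def)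
  qed
  have "F ` g ` A = {{sa_add M x i | i. i \<in> I} | x. x \<in> A}" if "A \<subseteq> ?C" for A
    unfolding Setcompr_eq_image[of _ A] image_image using fibre that
    by (intro image_cong) auto
  from this[OF even_odd_carrier(1)] this[OF even_odd_carrier(2)]
  have even: "F ` sa_even L = sa_even (sa_quotient M I)"
    and odd: "F ` sa_odd L = sa_odd (sa_quotient M I)"
    by (simp_all add: onto sa_quotient_def)
  have "sa_carrier (sa_quotient M I) = F ` sa_carrier L"
  proof (intro subset_antisym subsetI)
    fix X assume "X \<in> sa_carrier (sa_quotient M I)"
    then obtain a b where ab: "a \<in> sa_even M" "b \<in> sa_odd M"
      "X = sa_add (sa_quotient M I) (F (g a)) (F (g b))"
      unfolding sa_carrier_def even[symmetric] odd[symmetric] onto[symmetric] by auto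
    then have c: "a \<in> ?C" "b \<in> ?C" using even_odd_carrier by auto
    then have "X = F (g (sa_add M a b))" using ab F_add hom(1) by simp
    then show "X \<in> F ` sa_carrier L" using closed(1)[OF c] onto_carrier by blast
  next
    fix X assume "X \<in> F ` sa_carrier L"
    then obtain a b where ab: "a \<in> sa_even M" "b \<in> sa_odd M" "X = F (sa_add L (g a) (g b))"
      unfolding sa_carrier_def onto[symmetric] by auto
    then have c: "a \<in> ?C" "b \<in> ?C" using even_odd_carrier by auto
    then have "X = sa_add (sa_quotient M I) (F (g a)) (F (g b))" using ab F_add by simp
    then show "X \<in> sa_carrier (sa_quotient M I)"
      unfolding sa_carrier_def even[symmetric] odd[symmetric] onto[symmetric] using ab by blast
  qed
  moreover have "inj_on F (sa_carrier L)"
  proof (rule inj_onI)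
    fix y y' assume "y \<in> sa_carrier L" "y' \<in> sa_carrier L" "F y = F y'"
    moreover obtain x where "x \<in> ?C" "y = g x" using calculation onto_carrier by blast
    ultimately show "y = y'" by (auto simp: F_def)
  qed
  ultimately have "bij_betw F (sa_carrier L) (sa_carrier (sa_quotient M I))"
    by (simp add: bij_betw_def)
  moreover have "F (sa_add L x y) = sa_add (sa_quotient M I) (F x) (F y)"
    "F (sa_bracket L x y) = sa_bracket (sa_quotient M I) (F x) (F y)"
    "F (sa_scale L c x) = sa_scale (sa_quotient M I) c (F x)"
    if "x \<in> sa_carrier L" "y \<in> sa_carrier L" for x y c
    using that F_add F_bracket F_scale unfolding onto_carrier[symmetric] by auto
  ultimately have "superalgebra_iso L (sa_quotient M I) F"
    unfolding superalgebra_iso_def using even odd by blast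
  then show ?thesis unfolding superalgebra_isomorphic_def by blast
qed

end

section \<open>Matrix models\<close>

context
  fixes N :: nat and X Y a b :: "'f::field mat"
  assumes carrier: "X \<in> carrier_mat N N" "Y \<in> carrier_mat N N" "a \<in> carrier_mat N N" "b \<in> carrier_mat N N"
begin

lemmas mat_distribs =
  add_mult_distrib_mat[of _ N N _ _ N] mult_add_distrib_mat[of _ N N _ N]
  minus_mult_distrib_mat[of _ N N _ _ N] mult_minus_distrib_mat[of _ N N _ N]
  assoc_mult_mat[of _ N N _ N _ N] minus_carrier_mat

text \<open>With \<open>X\<close>, \<open>Y\<close> even and \<open>a\<close>, \<open>b\<close> odd this is the splitting of the superbracket of \<open>X + a\<close> and
  \<open>Y + b\<close> into its even and its odd part.\<close>

lemma super_bracket_decompose: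
  "(X + a) * (Y + b) - Y * (X + a) - b * X + b * a
    = (X * Y - Y * X + (a * b + b * a)) + ((X * b - b * X) - (Y * a - a * Y))"
  using carrier
  by (simp add: mat_distribs) (intro eq_matI; simp del: index_mult_mat(1))

lemma commutator_jacobi:
  "(X * (Y * a - a * Y) - (Y * a - a * Y) * X) - (Y * (X * a - a * X) - (X * a - a * X) * Y)
    = (X * Y - Y * X) * a - a * (X * Y - Y * X)"
  using carrier
  by (simp add: mat_distribs) (intro eq_matI; simp del: index_mult_mat(1))

lemma commutator_derivation:
  "X * (a * b + b * a) - (a * b + b * a) * X
    = ((X * a - a * X) * b + b * (X * a - a * X)) + (a * (X * b - b * X) + (X * b - b * X) * a)"
  using carrier
  by (simp add: mat_distribs) (intro eq_matI; simp del: index_mult_mat(1))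

lemma commutator_linear:
  "(X + Y) * a - a * (X + Y) = (X * a - a * X) + (Y * a - a * Y)"
  "X * (a + b) - (a + b) * X = (X * a - a * X) + (X * b - b * X)"
  "(c \<cdot>\<^sub>m X) * a - a * (c \<cdot>\<^sub>m X) = c \<cdot>\<^sub>m (X * a - a * X)"
  "X * (c \<cdot>\<^sub>m a) - (c \<cdot>\<^sub>m a) * X = c \<cdot>\<^sub>m (X * a - a * X)"
  using carrier
  by (simp_all add: mat_distribs mult_smult_assoc_mat[of _ N N _ N] mult_smult_distrib[of _ N N _ N])
    (intro eq_matI; simp add: algebra_simps del: index_mult_mat(1))+

end

lemma gl_even_iff: "X \<in> sa_even (gl_super n m) \<longleftrightarrow> X \<in> carrier_mat (n + m) (n + m) \<and>
    (\<forall>i<n+m. \<forall>j<n+m. (i < n) \<noteq> (j < n) \<longrightarrow> X $$ (i, j) = 0)"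
proof -
  have "even_block n X = X \<longleftrightarrow> (\<forall>i<n+m. \<forall>j<n+m. (i < n) \<noteq> (j < n) \<longrightarrow> X $$ (i, j) = 0)"
    if X: "X \<in> carrier_mat (n + m) (n + m)"
  proof
    assume *: "even_block n X = X"
    have "even_block n X $$ (i, j) = 0" if "i < n + m" "j < n + m" "(i < n) \<noteq> (j < n)" for i j
      using that X by (simp add: even_block_def)
    then show "\<forall>i<n+m. \<forall>j<n+m. (i < n) \<noteq> (j < n) \<longrightarrow> X $$ (i, j) = 0" by (simp add: *)
  qed (use X in \<open>auto intro!: eq_matI simp: even_block_def\<close>)
  then show ?thesis by (auto simp: gl_super_def)
qed

lemma gl_odd_iff: "X \<in> sa_odd (gl_super n m) \<longleftrightarrow> X \<in> carrier_mat (n + m) (n + m) \<and>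
    (\<forall>i<n+m. \<forall>j<n+m. (i < n) = (j < n) \<longrightarrow> X $$ (i, j) = 0)"
proof -
  have "odd_block n X = X \<longleftrightarrow> (\<forall>i<n+m. \<forall>j<n+m. (i < n) = (j < n) \<longrightarrow> X $$ (i, j) = 0)"
    if X: "X \<in> carrier_mat (n + m) (n + m)"
  proof
    assume *: "odd_block n X = X"
    have "odd_block n X $$ (i, j) = 0" if "i < n + m" "j < n + m" "(i < n) = (j < n)" for i j
      using that X by (simp add: odd_block_def)
    then show "\<forall>i<n+m. \<forall>j<n+m. (i < n) = (j < n) \<longrightarrow> X $$ (i, j) = 0" by (simp add: *)
  qed (use X in \<open>auto intro!: eq_matI simp: odd_block_def\<close>)
  then show ?thesis by (auto simp: gl_super_def)
qed

lemma blocks_of_sum: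
  assumes "X \<in> sa_even (gl_super n m)" "Y \<in> sa_odd (gl_super n m)"
  shows "even_block n (X + Y) = X" "odd_block n (X + Y) = Y"
  using assms by (auto intro!: eq_matI simp: even_block_def odd_block_def gl_even_iff gl_odd_iff)

text \<open>A superalgebra of matrices whose odd part is a copy \<open>\<phi>(T)\<close> of \<open>T\<close> with the right triple
  supercommutators, and whose even part \<open>E\<close> is spanned by the anticommutators of odd elements.  An even matrix
  \<open>X\<close> is sent to the operator \<open>\<theta> X\<close> on \<open>T\<close> that corresponds to \<open>[X, \<phi> t]\<close>; as
  \<open>\<theta>\<close> maps the anticommutator of \<open>\<phi> x\<close> and \<open>\<phi> y\<close> to \<open>S(x,y)\<close>, this yields a surjective homomorphism \<open>g\<close>
  onto \<open>L\<^sup>s\<^sup>s(T)\<close>. Its kernel \<open>I\<close> consists of the even matrices that commute with the odd part.\<close>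

locale matrix_model = J_ternary scale p
  for scale :: "'f::field \<Rightarrow> 't::ab_group_add \<Rightarrow> 't" and p :: "'t \<Rightarrow> 't \<Rightarrow> 't \<Rightarrow> 't" +
  fixes n m :: nat and \<phi> :: "'t \<Rightarrow> 'f mat" and E :: "'f mat set"
  assumes \<phi>_odd: "\<phi> t \<in> sa_odd (gl_super n m)"
    and \<phi>_add: "\<phi> (s + t) = \<phi> s + \<phi> t"
    and \<phi>_scale: "\<phi> (scale c t) = c \<cdot>\<^sub>m \<phi> t"
    and \<phi>_inj: "inj \<phi>"
    and E_even: "E \<subseteq> sa_even (gl_super n m)"
    and E_closed: "0\<^sub>m (n + m) (n + m) \<in> E" "X \<in> E \<Longrightarrow> Y \<in> E \<Longrightarrow> X + Y \<in> E" "X \<in> E \<Longrightarrow> c \<cdot>\<^sub>m X \<in> E"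
    and \<phi>_anticommutator: "\<phi> x * \<phi> y + \<phi> y * \<phi> x \<in> E"
    and E_spanned: "0\<^sub>m (n + m) (n + m) \<in> K \<Longrightarrow> (\<And>X Y. X \<in> K \<Longrightarrow> Y \<in> K \<Longrightarrow> X + Y \<in> K) \<Longrightarrow>
      (\<And>c X. X \<in> K \<Longrightarrow> c \<cdot>\<^sub>m X \<in> K) \<Longrightarrow> (\<And>x y. \<phi> x * \<phi> y + \<phi> y * \<phi> x \<in> K) \<Longrightarrow> E \<subseteq> K"
    and E_acts: "X \<in> E \<Longrightarrow> X * \<phi> t - \<phi> t * X \<in> range \<phi>"
    and \<phi>_S: "\<phi> (S_op p x y z) = (\<phi> x * \<phi> y + \<phi> y * \<phi> x) * \<phi> z - \<phi> z * (\<phi> x * \<phi> y + \<phi> y * \<phi> x)"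
begin

abbreviation "N \<equiv> n + m"

definition M :: "('f, 'f mat) superalgebra" where
  "M = (gl_super n m) \<lparr>sa_even := E, sa_odd := range \<phi>\<rparr>"

lemma M_simps: "sa_even M = E" "sa_odd M = range \<phi>" "sa_zero M = 0\<^sub>m N N" "sa_add M = (+)"
  "sa_scale M = (\<lambda>c X. c \<cdot>\<^sub>m X)"
  "sa_bracket M X Y = X * Y - even_block n Y * X - odd_block n Y * even_block n X
     + odd_block n Y * odd_block n X"
  by (simp_all add: M_def gl_super_def)

lemma carriers [simp]: "\<phi> t \<in> carrier_mat N N" "X \<in> E \<Longrightarrow> X \<in> carrier_mat N N"
  using \<phi>_odd E_even by (auto simp: gl_odd_iff gl_even_iff)

lemma dims [simp]: "dim_row (\<phi> t) = N" "dim_col (\<phi> t) = N"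
  "X \<in> E \<Longrightarrow> dim_row X = N" "X \<in> E \<Longrightarrow> dim_col X = N"
  using carriers(1)[THEN carrier_matD(1)] carriers(1)[THEN carrier_matD(2)]
    carriers(2)[THEN carrier_matD(1)] carriers(2)[THEN carrier_matD(2)] by simp_all

lemma M_carrier: "sa_carrier M = {X + \<phi> t | X t. X \<in> E}"
  by (auto simp: sa_carrier_def M_simps)

lemma blocks: "X \<in> E \<Longrightarrow> even_block n (X + \<phi> t) = X" "X \<in> E \<Longrightarrow> odd_block n (X + \<phi> t) = \<phi> t"
  using blocks_of_sum \<phi>_odd E_even by blast+

definition \<theta> :: "'f mat \<Rightarrow> 't \<Rightarrow> 't" where
  "\<theta> X t = the_inv \<phi> (X * \<phi> t - \<phi> t * X)"

lemma \<phi>_\<theta>: "X \<in> E \<Longrightarrow> \<phi> (\<theta> X t) = X * \<phi> t - \<phi> t * X"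
  unfolding \<theta>_def using f_the_inv_into_f[OF \<phi>_inj] E_acts by blast

lemma \<phi>_eqD: "\<phi> s = \<phi> t \<Longrightarrow> s = t"
  using \<phi>_inj by (simp add: inj_eq)

lemma \<phi>_diff: "\<phi> (s - t) = \<phi> s - \<phi> t"
proof -
  have "\<phi> (s - t) + \<phi> t = \<phi> s" by (simp flip: \<phi>_add)
  moreover have "\<phi> (s - t) = \<phi> (s - t) + \<phi> t - \<phi> t"
    by (intro eq_matI) auto
  ultimately show ?thesis by simp
qed

lemma \<theta>_add: "X \<in> E \<Longrightarrow> Y \<in> E \<Longrightarrow> \<theta> (X + Y) = \<theta> X + \<theta> Y"
  by (rule ext, rule \<phi>_eqD) (simp add: \<phi>_\<theta> \<phi>_add E_closed commutator_linear[of _ N _ _ "0\<^sub>m N N"])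

lemma \<theta>_scale: "X \<in> E \<Longrightarrow> \<theta> (c \<cdot>\<^sub>m X) = (\<lambda>t. scale c (\<theta> X t))"
  by (rule ext, rule \<phi>_eqD)
    (simp add: \<phi>_\<theta> \<phi>_scale E_closed commutator_linear[of _ N "0\<^sub>m N N" _ "0\<^sub>m N N"])

lemma \<theta>_0: "\<theta> (0\<^sub>m N N) = 0"
  using \<theta>_scale[of "0\<^sub>m N N" 0] E_closed(1) by (simp add: zero_fun_def)

lemma \<theta>_anticommutator: "\<theta> (\<phi> x * \<phi> y + \<phi> y * \<phi> x) = S x y"
  by (rule ext, rule \<phi>_eqD) (simp add: \<phi>_\<theta> \<phi>_anticommutator \<phi>_S)

text \<open>It suffices to bracket \<open>X\<close> with the spanning anticommutators, and the commutator with \<open>X\<close> is a derivation.\<close>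

lemma E_commutator:
  assumes X: "X \<in> E" and Y: "Y \<in> E"
  shows "X * Y - Y * X \<in> E"
proof -
  let ?K = "{Y \<in> E. X * Y - Y * X \<in> E}"
  have "E \<subseteq> ?K"
  proof (rule E_spanned)
    have "X * 0\<^sub>m N N - 0\<^sub>m N N * X = 0\<^sub>m N N"
      using carriers(2)[OF X] by simp
    then show "0\<^sub>m N N \<in> ?K" using E_closed(1) by simp
    show "A + B \<in> ?K" if "A \<in> ?K" "B \<in> ?K" for A B
      using that X E_closed(2) by (simp add: commutator_linear(2)[of _ N "0\<^sub>m N N"])
    show "c \<cdot>\<^sub>m A \<in> ?K" if "A \<in> ?K" for c A
      using that X E_closed(3) by (simp add: commutator_linear(4)[of _ N "0\<^sub>m N N" _ "0\<^sub>m N N"])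
    show "\<phi> x * \<phi> y + \<phi> y * \<phi> x \<in> ?K" for x y
      using X commutator_derivation[of X N "0\<^sub>m N N" "\<phi> x" "\<phi> y"] \<phi>_anticommutator[of x y]
        E_closed(2)[OF \<phi>_anticommutator[of "\<theta> X x" y] \<phi>_anticommutator[of x "\<theta> X y"]]
      by (simp add: \<phi>_\<theta>)
  qed
  then show ?thesis using Y by blast
qed

lemma \<theta>_commutator:
  assumes "X \<in> E" "Y \<in> E"
  shows "\<theta> (X * Y - Y * X) = (\<theta> X \<circ> \<theta> Y) - (\<theta> Y \<circ> \<theta> X)"
  by (rule ext, rule \<phi>_eqD)
    (use assms in \<open>simp add: \<phi>_\<theta> E_commutator \<phi>_diff commutator_jacobi[of X N Y _ "0\<^sub>m N N"]\<close>)

lemma \<theta>_image: "\<theta> ` E = SS"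
proof (intro subset_antisym)
  have "E \<subseteq> {X \<in> E. \<theta> X \<in> SS}"
    by (rule E_spanned)
      (auto simp: \<theta>_add \<theta>_scale \<theta>_0 \<theta>_anticommutator \<phi>_anticommutator E_closed SS_closed S_in_SS)
  then show "\<theta> ` E \<subseteq> SS" by blast
  have "ops.subspace (\<theta> ` E)"
  proof (rule ops.subspaceI)
    show "0 \<in> \<theta> ` E" using \<theta>_0 E_closed(1) by (metis image_eqI)
    show "u + v \<in> \<theta> ` E" if "u \<in> \<theta> ` E" "v \<in> \<theta> ` E" for u v
      using that E_closed(2) \<theta>_add by (auto simp: image_iff) metis
    show "(\<lambda>z. scale c (u z)) \<in> \<theta> ` E" if "u \<in> \<theta> ` E" for c u
      using that E_closed(3) \<theta>_scale by (auto simp: image_iff) metis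
  qed
  moreover have "{S x y | x y. True} \<subseteq> \<theta> ` E"
    using \<theta>_anticommutator \<phi>_anticommutator by (auto simp: image_iff) metis
  ultimately show "SS \<subseteq> \<theta> ` E"
    unfolding S_span_def by (rule ops.span_minimal[rotated])
qed

definition g :: "'f mat \<Rightarrow> ('t \<Rightarrow> 't) \<times> 't" where
  "g Z = (\<theta> (even_block n Z), the_inv \<phi> (odd_block n Z))"

lemma g_eq: "X \<in> E \<Longrightarrow> g (X + \<phi> t) = (\<theta> X, t)"
  by (simp add: g_def blocks the_inv_f_f[OF \<phi>_inj])

definition I :: "'f mat set" where
  "I = {X \<in> E. \<forall>t. X * \<phi> t = \<phi> t * X}"

lemma \<phi>_0: "\<phi> 0 = 0\<^sub>m N N"
  using \<phi>_diff[of 0 0] carriers(1)[of 0] by simp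

lemma mem_I_iff: "X \<in> I \<longleftrightarrow> X \<in> E \<and> \<theta> X = 0"
proof (cases "X \<in> E")
  case True
  have eq: "A - B = 0\<^sub>m N N \<longleftrightarrow> A = B" if "A \<in> carrier_mat N N" "B \<in> carrier_mat N N" for A B :: "'f mat"
    using that by (auto simp: mat_eq_iff)
  have "\<theta> X = 0 \<longleftrightarrow> (\<forall>t. \<phi> (\<theta> X t) = \<phi> 0)"
    using \<phi>_eqD by (auto simp: fun_eq_iff)
  also have "\<dots> \<longleftrightarrow> (\<forall>t. X * \<phi> t = \<phi> t * X)"
    using True by (simp add: \<phi>_\<theta> \<phi>_0 eq mult_carrier_mat[of _ N N _ N])
  finally show ?thesis using True by (simp add: I_def)
qed (simp add: I_def)

lemma M_bracket:
  assumes "X \<in> E" "Y \<in> E"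
  shows "sa_bracket M (X + \<phi> s) (Y + \<phi> t)
    = (X * Y - Y * X + (\<phi> s * \<phi> t + \<phi> t * \<phi> s)) + \<phi> (\<theta> X t - \<theta> Y s)"
  using assms super_bracket_decompose[of X N Y "\<phi> s" "\<phi> t"]
  by (simp add: M_simps blocks \<phi>_\<theta> \<phi>_diff)

sublocale surjective_hom M L g I
proof
  have add: "(X + \<phi> s) + (Y + \<phi> t) = (X + Y) + \<phi> (s + t)" if "X \<in> E" "Y \<in> E" for X Y s t
    using that by (intro eq_matI) (auto simp: \<phi>_add)
  have scale: "c \<cdot>\<^sub>m (X + \<phi> s) = c \<cdot>\<^sub>m X + \<phi> (scale c s)" if "X \<in> E" for X s c
    using that by (intro eq_matI) (auto simp: \<phi>_scale algebra_simps)
  have even: "X = X + \<phi> 0" if "X \<in> E" for X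
    using carriers(2)[OF that] by (simp add: \<phi>_0)
  have odd: "\<phi> t = 0\<^sub>m N N + \<phi> t" for t
    using carriers(1)[of t] by simp
  have even_bracket: "X * Y - Y * X + (\<phi> s * \<phi> t + \<phi> t * \<phi> s) \<in> E"
    if "X \<in> E" "Y \<in> E" for X Y s t
    using that by (simp add: E_closed E_commutator \<phi>_anticommutator)
  note elims = M_carrier[THEN equalityD1, THEN subsetD, THEN CollectD]
  have memI: "X + \<phi> t \<in> sa_carrier M" if "X \<in> E" for X t
    using that by (auto simp: M_carrier)
  show "sa_even M \<subseteq> sa_carrier M" using even memI[of _ 0] by (auto simp: M_simps)
  show "sa_odd M \<subseteq> sa_carrier M" using odd memI[OF E_closed(1)] by (auto simp: M_simps)
  show "sa_add M x y \<in> sa_carrier M" "g (sa_add M x y) = sa_add L (g x) (g y)"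
    "sa_bracket M x y \<in> sa_carrier M" "g (sa_bracket M x y) = sa_bracket L (g x) (g y)"
    if xy: "x \<in> sa_carrier M" "y \<in> sa_carrier M" for x y
  proof -
    obtain X s Y t where "x = X + \<phi> s" "y = Y + \<phi> t" and XY: "X \<in> E" "Y \<in> E"
      using elims[OF xy(1)] elims[OF xy(2)] by auto
    then show "sa_add M x y \<in> sa_carrier M" "g (sa_add M x y) = sa_add L (g x) (g y)"
      "sa_bracket M x y \<in> sa_carrier M" "g (sa_bracket M x y) = sa_bracket L (g x) (g y)"
      by (simp_all add: M_bracket even_bracket memI g_eq Lss_simps \<theta>_add \<theta>_commutator
          \<theta>_anticommutator E_closed E_commutator \<phi>_anticommutator)
        (simp_all add: M_simps add E_closed memI g_eq \<theta>_add)
  qed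
  show "sa_scale M c x \<in> sa_carrier M" "g (sa_scale M c x) = sa_scale L c (g x)"
    if x: "x \<in> sa_carrier M" for c x
  proof -
    obtain X s where "x = X + \<phi> s" "X \<in> E"
      using elims[OF x] by auto
    then show "sa_scale M c x \<in> sa_carrier M" "g (sa_scale M c x) = sa_scale L c (g x)"
      by (simp_all add: M_simps scale memI g_eq Lss_simps \<theta>_scale E_closed)
  qed
  have "g X = (\<theta> X, 0)" if "X \<in> E" for X
    using even[OF that] g_eq[OF that, of 0] by simp
  then have "g ` E = (\<theta> ` E) \<times> {0}" by (auto simp: image_iff)
  then show "g ` sa_even M = sa_even L"
    by (simp add: M_simps Lss_simps \<theta>_image)
  have "g (\<phi> t) = (0, t)" for t
    using odd[of t] g_eq[OF E_closed(1), of t] by (simp add: \<theta>_0)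
  then show "g ` sa_odd M = sa_odd L"
    by (auto simp: M_simps Lss_simps image_iff)
  show "sa_add M x i \<in> sa_carrier M \<and> g (sa_add M x i) = g x"
    if x: "x \<in> sa_carrier M" and i: "i \<in> I" for x i
  proof -
    obtain X s where Xs: "x = X + \<phi> s" "X \<in> E"
      using elims[OF x] by auto
    have i': "i \<in> E" "\<theta> i = 0" using i by (auto simp: mem_I_iff)
    have "sa_add M x i = (X + i) + \<phi> s"
      using add[OF Xs(2) i'(1), of s 0] even[OF i'(1)] Xs(1) by (simp add: M_simps)
    then show ?thesis
      using Xs i' by (simp add: memI g_eq E_closed \<theta>_add)
  qed
  show "\<exists>i\<in>I. y = sa_add M x i"
    if xy: "x \<in> sa_carrier M" "y \<in> sa_carrier M" and g: "g y = g x" for x y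
  proof -
    obtain X s Y t where *: "x = X + \<phi> s" "y = Y + \<phi> t" and XY: "X \<in> E" "Y \<in> E"
      using elims[OF xy(1)] elims[OF xy(2)] by auto
    have **: "\<theta> Y = \<theta> X" "t = s" using g by (simp_all add: * g_eq XY)
    let ?i = "Y + (- 1) \<cdot>\<^sub>m X"
    have "?i \<in> I"
      using XY ** by (simp add: mem_I_iff E_closed \<theta>_add \<theta>_scale) (simp add: fun_eq_iff)
    moreover have "y = sa_add M x ?i"
      unfolding * ** M_simps using XY by (intro eq_matI) auto
    ultimately show ?thesis by blast
  qed
  show "sa_add M (sa_add M x y) i = sa_add M x (sa_add M y i)"
    if "x \<in> sa_carrier M" "y \<in> sa_carrier M" "i \<in> I" for x y i
    using that by (auto simp: M_simps M_carrier I_def intro!: assoc_add_mat[of _ N N])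
qed

theorem Lss_isomorphic_if_faithful:
  assumes "\<And>X. X \<in> E \<Longrightarrow> (\<And>t. X * \<phi> t = \<phi> t * X) \<Longrightarrow> X = 0\<^sub>m N N"
  shows "superalgebra_isomorphic L M"
proof (rule isomorphic_if_injective, rule inj_onI)
  fix x y assume xy: "x \<in> sa_carrier M" "y \<in> sa_carrier M" "g x = g y"
  then obtain i where "i \<in> I" "y = sa_add M x i" using fibre_coset[of x y] by auto
  moreover have "i = 0\<^sub>m N N" using assms calculation(1) by (simp add: I_def)
  moreover have "x \<in> carrier_mat N N" using xy(1) by (auto simp: M_carrier)
  ultimately show "x = y" by (simp add: M_simps)
qed

end

section \<open>Block matrices\<close>

definition even_mat :: "nat \<Rightarrow> nat \<Rightarrow> 'f::field mat \<Rightarrow> 'f mat \<Rightarrow> 'f mat" where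
  "even_mat n m A B = four_block_mat A (0\<^sub>m n m) (0\<^sub>m m n) B"

definition odd_mat :: "nat \<Rightarrow> nat \<Rightarrow> 'f::field mat \<Rightarrow> 'f mat \<Rightarrow> 'f mat" where
  "odd_mat n m P Q = four_block_mat (0\<^sub>m n n) P Q (0\<^sub>m m m)"

lemma even_mat_in_gl:
  "A \<in> carrier_mat n n \<Longrightarrow> B \<in> carrier_mat m m \<Longrightarrow> even_mat n m A B \<in> sa_even (gl_super n m)"
  by (auto simp: gl_even_iff even_mat_def)

lemma odd_mat_in_gl:
  "P \<in> carrier_mat n m \<Longrightarrow> Q \<in> carrier_mat m n \<Longrightarrow> odd_mat n m P Q \<in> sa_odd (gl_super n m)"
  by (auto simp: gl_odd_iff odd_mat_def)

lemma gl_even_cases: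
  assumes "X \<in> sa_even (gl_super n m)"
  obtains A B where "A \<in> carrier_mat n n" "B \<in> carrier_mat m m" "X = even_mat n m A B"
proof
  let ?A = "mat n n (\<lambda>(i, j). X $$ (i, j))" and ?B = "mat m m (\<lambda>(i, j). X $$ (i + n, j + n))"
  show "X = even_mat n m ?A ?B"
    using assms by (intro eq_matI) (auto simp: gl_even_iff even_mat_def)
qed auto

lemma gl_odd_cases:
  assumes "X \<in> sa_odd (gl_super n m)"
  obtains P Q where "P \<in> carrier_mat n m" "Q \<in> carrier_mat m n" "X = odd_mat n m P Q"
proof
  let ?P = "mat n m (\<lambda>(i, j). X $$ (i, j + n))" and ?Q = "mat m n (\<lambda>(i, j). X $$ (i + n, j))"
  show "X = odd_mat n m ?P ?Q"
    using assms by (intro eq_matI) (auto simp: gl_odd_iff odd_mat_def)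
qed auto

lemma even_mat_eq_iff:
  assumes "A \<in> carrier_mat n n" "B \<in> carrier_mat m m" "A' \<in> carrier_mat n n" "B' \<in> carrier_mat m m"
  shows "even_mat n m A B = even_mat n m A' B' \<longleftrightarrow> A = A' \<and> B = B'"
proof
  assume eq: "even_mat n m A B = even_mat n m A' B'"
  have "A $$ (i, j) = A' $$ (i, j)" if "i < n" "j < n" for i j
    using arg_cong[OF eq, of "\<lambda>X. X $$ (i, j)"] that assms by (simp add: even_mat_def)
  moreover have "B $$ (i, j) = B' $$ (i, j)" if "i < m" "j < m" for i j
    using arg_cong[OF eq, of "\<lambda>X. X $$ (i + n, j + n)"] that assms by (simp add: even_mat_def)
  ultimately show "A = A' \<and> B = B'" using assms by auto
qed auto

lemma odd_mat_eq_iff: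
  assumes "P \<in> carrier_mat n m" "Q \<in> carrier_mat m n" "P' \<in> carrier_mat n m" "Q' \<in> carrier_mat m n"
  shows "odd_mat n m P Q = odd_mat n m P' Q' \<longleftrightarrow> P = P' \<and> Q = Q'"
proof
  assume eq: "odd_mat n m P Q = odd_mat n m P' Q'"
  have "P $$ (i, j) = P' $$ (i, j)" if "i < n" "j < m" for i j
    using arg_cong[OF eq, of "\<lambda>X. X $$ (i, j + n)"] that assms by (simp add: odd_mat_def)
  moreover have "Q $$ (i, j) = Q' $$ (i, j)" if "i < m" "j < n" for i j
    using arg_cong[OF eq, of "\<lambda>X. X $$ (i + n, j)"] that assms by (simp add: odd_mat_def)
  ultimately show "P = P' \<and> Q = Q'" using assms by auto
qed auto

lemma even_mat_add:
  assumes "A \<in> carrier_mat n n" "B \<in> carrier_mat m m" "A' \<in> carrier_mat n n" "B' \<in> carrier_mat m m"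
  shows "even_mat n m A B + even_mat n m A' B' = even_mat n m (A + A') (B + B')"
  using assms by (intro eq_matI) (auto simp: even_mat_def)

lemma even_mat_smult:
  assumes "A \<in> carrier_mat n n" "B \<in> carrier_mat m m"
  shows "c \<cdot>\<^sub>m even_mat n m A B = even_mat n m (c \<cdot>\<^sub>m A) (c \<cdot>\<^sub>m B)"
  using assms by (intro eq_matI) (auto simp: even_mat_def)

lemma odd_mat_add:
  assumes "P \<in> carrier_mat n m" "Q \<in> carrier_mat m n" "P' \<in> carrier_mat n m" "Q' \<in> carrier_mat m n"
  shows "odd_mat n m P Q + odd_mat n m P' Q' = odd_mat n m (P + P') (Q + Q')"
  using assms by (intro eq_matI) (auto simp: odd_mat_def)

lemma odd_mat_diff:
  assumes "P \<in> carrier_mat n m" "Q \<in> carrier_mat m n" "P' \<in> carrier_mat n m" "Q' \<in> carrier_mat m n"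
  shows "odd_mat n m P Q - odd_mat n m P' Q' = odd_mat n m (P - P') (Q - Q')"
  using assms by (intro eq_matI) (auto simp: odd_mat_def)

lemma odd_mat_smult:
  assumes "P \<in> carrier_mat n m" "Q \<in> carrier_mat m n"
  shows "c \<cdot>\<^sub>m odd_mat n m P Q = odd_mat n m (c \<cdot>\<^sub>m P) (c \<cdot>\<^sub>m Q)"
  using assms by (intro eq_matI) (auto simp: odd_mat_def)

lemma even_mat_0: "even_mat n m (0\<^sub>m n n) (0\<^sub>m m m) = 0\<^sub>m (n + m) (n + m)"
  by (intro eq_matI) (auto simp: even_mat_def)

lemma even_mat_scalar: "even_mat n m (c \<cdot>\<^sub>m 1\<^sub>m n) (c \<cdot>\<^sub>m 1\<^sub>m m) = c \<cdot>\<^sub>m 1\<^sub>m (n + m)"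
  by (intro eq_matI) (auto simp: even_mat_def)

lemma odd_mat_mult:
  assumes "P \<in> carrier_mat n m" "Q \<in> carrier_mat m n" "P' \<in> carrier_mat n m" "Q' \<in> carrier_mat m n"
  shows "odd_mat n m P Q * odd_mat n m P' Q' = even_mat n m (P * Q') (Q * P')"
  using assms unfolding odd_mat_def even_mat_def
  by (subst mult_four_block_mat[of _ n n _ m _ m _ _ n _ m]) auto

lemma even_odd_mat_mult:
  assumes "A \<in> carrier_mat n n" "B \<in> carrier_mat m m" "P \<in> carrier_mat n m" "Q \<in> carrier_mat m n"
  shows "even_mat n m A B * odd_mat n m P Q = odd_mat n m (A * P) (B * Q)"
    "odd_mat n m P Q * even_mat n m A B = odd_mat n m (P * B) (Q * A)"
  using assms unfolding odd_mat_def even_mat_def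
  by (subst mult_four_block_mat[of _ n n _ m _ m _ _ n _ m]; auto)+

lemma supertrace_even_mat:
  assumes "A \<in> carrier_mat n n" "B \<in> carrier_mat m m"
  shows "supertrace n m (even_mat n m A B) = (\<Sum>i<n. A $$ (i, i)) - (\<Sum>i<m. B $$ (i, i))"
proof -
  have "(\<Sum>i=n..<n + m. even_mat n m A B $$ (i, i)) = (\<Sum>i=0..<m. even_mat n m A B $$ (i + n, i + n))"
    using sum.shift_bounds_nat_ivl[of "\<lambda>i. even_mat n m A B $$ (i, i)" 0 n m] by (simp add: add.commute)
  then show ?thesis
    using assms by (simp add: supertrace_def even_mat_def atLeast0LessThan)
qed

lemma supertrace_odd:
  assumes "X \<in> sa_odd (gl_super n m)"
  shows "supertrace n m X = 0"
  using assms by (auto simp: supertrace_def gl_odd_iff)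

text \<open>Schur's lemma for the two diagonal blocks: compare the entries of \<open>A P\<close> and \<open>P B\<close> for the matrix units \<open>P\<close>.\<close>

lemma intertwiner_scalar:
  fixes A B :: "'f::field mat"
  assumes "n > 0" "m > 0" and A: "A \<in> carrier_mat n n" and B: "B \<in> carrier_mat m m"
    and comm: "\<And>P. P \<in> carrier_mat n m \<Longrightarrow> A * P = P * B"
  obtains c where "A = c \<cdot>\<^sub>m 1\<^sub>m n" "B = c \<cdot>\<^sub>m 1\<^sub>m m"
proof -
  have entry: "A $$ (a, i) * (if b = j then 1 else 0) = (if a = i then 1 else 0) * B $$ (j, b)"
    if "a < n" "i < n" "b < m" "j < m" for a b i j
  proof -
    let ?P = "mat n m (\<lambda>(k, l). if k = i \<and> l = j then 1 else 0) :: 'f mat"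
    have "(A * ?P) $$ (a, b) = (\<Sum>k<n. A $$ (a, k) * (if k = i \<and> b = j then 1 else 0))"
      using A that by (simp add: scalar_prod_def atLeast0LessThan)
    also have "\<dots> = (\<Sum>k<n. if k = i then A $$ (a, k) * (if b = j then 1 else 0) else 0)"
      by (intro sum.cong) auto
    finally have l: "(A * ?P) $$ (a, b) = A $$ (a, i) * (if b = j then 1 else 0)"
      using that by simp
    have "(?P * B) $$ (a, b) = (\<Sum>k<m. (if a = i \<and> k = j then 1 else 0) * B $$ (k, b))"
      using B that by (simp add: scalar_prod_def atLeast0LessThan)
    also have "\<dots> = (\<Sum>k<m. if k = j then (if a = i then 1 else 0) * B $$ (k, b) else 0)"
      by (intro sum.cong) auto
    finally have "(?P * B) $$ (a, b) = (if a = i then 1 else 0) * B $$ (j, b)"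
      using that by simp
    with l comm[of ?P] show ?thesis by simp
  qed
  have "A = A $$ (0, 0) \<cdot>\<^sub>m 1\<^sub>m n"
  proof (rule eq_matI)
    fix a i assume "a < dim_row (A $$ (0, 0) \<cdot>\<^sub>m 1\<^sub>m n)" "i < dim_col (A $$ (0, 0) \<cdot>\<^sub>m 1\<^sub>m n)"
    then show "A $$ (a, i) = (A $$ (0, 0) \<cdot>\<^sub>m 1\<^sub>m n) $$ (a, i)"
      using entry[of a i 0 0] entry[of 0 0 0 0] assms(1,2) by (cases "a = i") auto
  qed (use A in auto)
  moreover have "B = A $$ (0, 0) \<cdot>\<^sub>m 1\<^sub>m m"
  proof (rule eq_matI)
    fix j b assume "j < dim_row (A $$ (0, 0) \<cdot>\<^sub>m 1\<^sub>m m)" "b < dim_col (A $$ (0, 0) \<cdot>\<^sub>m 1\<^sub>m m)"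
    then show "B $$ (j, b) = (A $$ (0, 0) \<cdot>\<^sub>m 1\<^sub>m m) $$ (j, b)"
      using entry[of 0 0 b j] assms(1,2) by (cases "j = b") auto
  qed (use B in auto)
  ultimately show ?thesis using that by blast
qed

text \<open>The data of a matrix model in block form: the odd matrix attached to \<open>t\<close> has the
  off-diagonal blocks \<open>P t\<close> and \<open>Q t\<close>, and the two last assumptions say that triple
  supercommutators of these odd matrices reproduce the operators \<open>S(x,y)\<close>.\<close>

locale block_model = J_ternary scale p
  for scale :: "'f::field \<Rightarrow> 't::ab_group_add \<Rightarrow> 't" and p :: "'t \<Rightarrow> 't \<Rightarrow> 't \<Rightarrow> 't" +
  fixes n m :: nat and P Q :: "'t \<Rightarrow> 'f mat"
  assumes nm_pos: "n > 0" "m > 0"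
    and PQ_carrier [simp]: "P t \<in> carrier_mat n m" "Q t \<in> carrier_mat m n"
    and PQ_add: "P (s + t) = P s + P t" "Q (s + t) = Q s + Q t"
    and PQ_scale: "P (scale c t) = c \<cdot>\<^sub>m P t" "Q (scale c t) = c \<cdot>\<^sub>m Q t"
    and P_S: "P (S_op p x y z) = (P x * Q y + P y * Q x) * P z - P z * (Q x * P y + Q y * P x)"
    and Q_S: "Q (S_op p x y z) = (Q x * P y + Q y * P x) * Q z - Q z * (P x * Q y + P y * Q x)"
begin

definition \<phi> :: "'t \<Rightarrow> 'f mat" where "\<phi> t = odd_mat n m (P t) (Q t)"

lemma PQ_mult_carrier [simp]: "P s * Q t \<in> carrier_mat n n" "Q s * P t \<in> carrier_mat m m"
  by (rule mult_carrier_mat[of _ _ m], simp_all, rule mult_carrier_mat[of _ _ n], simp_all)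

lemma PQ_dims [simp]: "dim_row (P t) = n" "dim_col (P t) = m" "dim_row (Q t) = m" "dim_col (Q t) = n"
  using carrier_matD[OF PQ_carrier(1)[of t]] carrier_matD[OF PQ_carrier(2)[of t]] by simp_all

lemma \<phi>_anticommutator_eq:
  "\<phi> x * \<phi> y + \<phi> y * \<phi> x = even_mat n m (P x * Q y + P y * Q x) (Q x * P y + Q y * P x)"
  by (simp add: \<phi>_def odd_mat_mult even_mat_add)

lemma \<phi>_props:
  "\<phi> t \<in> sa_odd (gl_super n m)" "\<phi> (s + t) = \<phi> s + \<phi> t" "\<phi> (scale c t) = c \<cdot>\<^sub>m \<phi> t"
  "\<phi> (S_op p x y z) = (\<phi> x * \<phi> y + \<phi> y * \<phi> x) * \<phi> z - \<phi> z * (\<phi> x * \<phi> y + \<phi> y * \<phi> x)"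
proof -
  show "\<phi> (S_op p x y z) = (\<phi> x * \<phi> y + \<phi> y * \<phi> x) * \<phi> z - \<phi> z * (\<phi> x * \<phi> y + \<phi> y * \<phi> x)"
    unfolding \<phi>_anticommutator_eq
    by (simp add: \<phi>_def even_odd_mat_mult add_carrier_mat mult_carrier_mat[of _ n n _ m]
        mult_carrier_mat[of _ m m _ n] mult_carrier_mat[of _ n m _ m] mult_carrier_mat[of _ m n _ n]
        odd_mat_diff P_S Q_S)
qed (simp_all add: \<phi>_def odd_mat_in_gl PQ_add PQ_scale odd_mat_add odd_mat_smult)

lemma commutator_\<phi>:
  assumes "A \<in> carrier_mat n n" "B \<in> carrier_mat m m"
  shows "even_mat n m A B * \<phi> t - \<phi> t * even_mat n m A B
    = odd_mat n m (A * P t - P t * B) (B * Q t - Q t * A)"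
  using assms by (simp add: \<phi>_def even_odd_mat_mult odd_mat_diff mult_carrier_mat[of _ n n _ m]
        mult_carrier_mat[of _ m m _ n] mult_carrier_mat[of _ n m _ m] mult_carrier_mat[of _ m n _ n])

text \<open>Once \<open>P\<close> takes all values, Schur's lemma applies to even matrices that commute with
  the odd part.\<close>

lemma commuting_even_scalar:
  assumes X: "X \<in> sa_even (gl_super n m)" and comm: "\<And>t. X * \<phi> t = \<phi> t * X"
    and P_onto: "range P = carrier_mat n m"
  obtains c where "X = c \<cdot>\<^sub>m 1\<^sub>m (n + m)"
proof -
  obtain A B where AB: "A \<in> carrier_mat n n" "B \<in> carrier_mat m m" "X = even_mat n m A B"
    using X by (rule gl_even_cases)
  have "A * P t = P t * B" for t
    using comm[of t] AB
    by (simp add: \<phi>_def even_odd_mat_mult odd_mat_eq_iff mult_carrier_mat[of _ n n _ m]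
        mult_carrier_mat[of _ m m _ n] mult_carrier_mat[of _ n m _ m] mult_carrier_mat[of _ m n _ n])
  then have "A * R = R * B" if "R \<in> carrier_mat n m" for R
    using that P_onto by (metis rangeE)
  then obtain c where "A = c \<cdot>\<^sub>m 1\<^sub>m n" "B = c \<cdot>\<^sub>m 1\<^sub>m m"
    using intertwiner_scalar[OF nm_pos AB(1,2)] by blast
  then show ?thesis using that AB(3) even_mat_scalar by metis
qed

end

section \<open>The special linear model\<close>

locale sl_model = block_model scale p n m P Q
  for scale :: "'f::field \<Rightarrow> 't::ab_group_add \<Rightarrow> 't" and p :: "'t \<Rightarrow> 't \<Rightarrow> 't \<Rightarrow> 't"
    and n m P Q +
  assumes PQ_onto: "A \<in> carrier_mat n m \<Longrightarrow> B \<in> carrier_mat m n \<Longrightarrow> \<exists>t. P t = A \<and> Q t = B"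
    and PQ_inj: "P s = P t \<Longrightarrow> Q s = Q t \<Longrightarrow> s = t"
begin

lemma range_\<phi>: "range \<phi> = sa_odd (gl_super n m)"
proof (intro subset_antisym subsetI)
  fix X :: "'f mat" assume "X \<in> sa_odd (gl_super n m)"
  then obtain A B where AB: "A \<in> carrier_mat n m" "B \<in> carrier_mat m n" "X = odd_mat n m A B"
    by (rule gl_odd_cases)
  then obtain t where "P t = A" "Q t = B" using PQ_onto by blast
  then show "X \<in> range \<phi>" using AB(3) by (auto simp: \<phi>_def)
qed (use \<phi>_props(1) in blast)

lemma range_P: "range P = carrier_mat n m"
proof
  show "carrier_mat n m \<subseteq> range P"
  proof
    fix A :: "'f mat" assume "A \<in> carrier_mat n m"
    then show "A \<in> range P" using PQ_onto[of A "0\<^sub>m m n"] by auto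
  qed
qed auto

definition E :: "'f mat set" where "E = sa_even (sl_super n m)"

lemma E_iff: "X \<in> E \<longleftrightarrow> X \<in> sa_even (gl_super n m) \<and> supertrace n m X = 0"
  by (simp add: E_def sl_super_def sa_restrict_def)

definition corner :: "nat \<Rightarrow> 'f \<Rightarrow> 'f mat" where
  "corner k c = mat k k (\<lambda>(i, j). if i = 0 \<and> j = 0 then c else 0)"

lemma corner_carrier [simp]: "corner k c \<in> carrier_mat k k"
  by (simp add: corner_def)

lemma corner_add: "corner k c + corner k d = corner k (c + d)"
  by (intro eq_matI) (auto simp: corner_def)

lemma corner_0: "corner k 0 = 0\<^sub>m k k"
  by (intro eq_matI) (auto simp: corner_def)

lemma corner_trace: "k > 0 \<Longrightarrow> (\<Sum>i<k. corner k c $$ (i, i)) = c"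
proof -
  assume "k > 0"
  have "(\<Sum>i<k. corner k c $$ (i, i)) = (\<Sum>i<k. if i = 0 then c else 0)"
    by (intro sum.cong) (auto simp: corner_def)
  then show ?thesis using \<open>k > 0\<close> by simp
qed

text \<open>Let \<open>X\<close> have the \<open>r\<close>-th column of \<open>A\<close> as its first column and zeros elsewhere, and let \<open>Y\<close> be the
  matrix unit at \<open>(0, r)\<close>. Then \<open>X Y\<close> is the part of \<open>A\<close> in column \<open>r\<close>, and \<open>Y X\<close> is concentrated in the corner
  with entry \<open>A(r,r)\<close>. Summing over \<open>r\<close> pairs \<open>A\<close> with the corner matrix of the same trace.\<close>

lemma sum_of_columns:
  fixes A :: "'f mat" and K :: "('f mat \<times> 'f mat) set"
  assumes A: "A \<in> carrier_mat k k" and "k > 0" "l > 0"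
    and zero: "(0\<^sub>m k k, 0\<^sub>m l l) \<in> K"
    and add: "\<And>X Y X' Y'. (X, Y) \<in> K \<Longrightarrow> (X', Y') \<in> K \<Longrightarrow> (X + X', Y + Y') \<in> K"
    and prod: "\<And>X Y. X \<in> carrier_mat k l \<Longrightarrow> Y \<in> carrier_mat l k \<Longrightarrow> (X * Y, Y * X) \<in> K"
  shows "(A, corner l (\<Sum>i<k. A $$ (i, i))) \<in> K"
proof -
  let ?A = "\<lambda>r. mat k k (\<lambda>(i, j). if j < r then A $$ (i, j) else 0)"
  have "(?A r, corner l (\<Sum>i<r. A $$ (i, i))) \<in> K" if "r \<le> k" for r
    using that
  proof (induction r)
    case 0
    have "?A 0 = 0\<^sub>m k k" by (intro eq_matI) auto
    show ?case unfolding \<open>?A 0 = 0\<^sub>m k k\<close> using zero by (simp add: corner_0)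
  next
    case (Suc r)
    let ?X = "mat k l (\<lambda>(i, j). if j = 0 then A $$ (i, r) else 0)"
    let ?Y = "mat l k (\<lambda>(i, j). if i = 0 \<and> j = r then 1 else 0) :: 'f mat"
    have "?A r + ?X * ?Y = ?A (Suc r)"
    proof (rule eq_matI, goal_cases)
      case (1 i j)
      have "(?X * ?Y) $$ (i, j) = (\<Sum>s<l. (if s = 0 then A $$ (i, r) else 0) * (if s = 0 \<and> j = r then 1 else 0))"
        using 1 by (simp add: scalar_prod_def atLeast0LessThan)
      also have "\<dots> = (\<Sum>s<l. if s = 0 then (if j = r then A $$ (i, r) else 0) else 0)"
        by (intro sum.cong) auto
      finally have "(?X * ?Y) $$ (i, j) = (if j = r then A $$ (i, r) else 0)"
        using \<open>l > 0\<close> by simp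
      then show ?case using 1 by (auto simp del: index_mult_mat(1))
    qed auto
    moreover have "?Y * ?X = corner l (A $$ (r, r))"
    proof (rule eq_matI, goal_cases)
      case (1 i j)
      have "(?Y * ?X) $$ (i, j) = (\<Sum>s<k. (if i = 0 \<and> s = r then 1 else 0) * (if j = 0 then A $$ (s, r) else 0))"
        using 1 by (simp add: scalar_prod_def atLeast0LessThan corner_def)
      also have "\<dots> = (\<Sum>s<k. if s = r then (if i = 0 \<and> j = 0 then A $$ (r, r) else 0) else 0)"
        by (intro sum.cong) auto
      finally show ?case using 1 Suc.prems by (auto simp: corner_def simp del: index_mult_mat(1))
    qed (auto simp: corner_def)
    ultimately show ?case
      using add[OF Suc.IH prod[of ?X ?Y]] Suc.prems by (simp add: corner_add)
  qed
  from this[of k] have "(?A k, corner l (\<Sum>i<k. A $$ (i, i))) \<in> K" by simp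
  moreover have "?A k = A" using A by (intro eq_matI) auto
  ultimately show ?thesis by simp
qed

text \<open>By the preceding lemma, applied on both sides, every pair \<open>(A, B)\<close> of blocks of equal trace \<open>s\<close> is a
  combination of spanned pairs: \<open>(A, B) = (A, s) + (s, B) - (s, s)\<close>, where \<open>s\<close> stands for the corner matrix.\<close>

lemma E_spanned:
  assumes zero: "0\<^sub>m (n + m) (n + m) \<in> K"
    and add: "\<And>X Y. X \<in> K \<Longrightarrow> Y \<in> K \<Longrightarrow> X + Y \<in> K"
    and scale: "\<And>c X. X \<in> K \<Longrightarrow> c \<cdot>\<^sub>m X \<in> K"
    and anti: "\<And>x y. \<phi> x * \<phi> y + \<phi> y * \<phi> x \<in> K"
  shows "E \<subseteq> K"
proof
  fix X assume "X \<in> E"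
  then have X: "X \<in> sa_even (gl_super n m)" "supertrace n m X = 0" by (auto simp: E_iff)
  then obtain A B where AB: "A \<in> carrier_mat n n" "B \<in> carrier_mat m m" "X = even_mat n m A B"
    using gl_even_cases by blast
  define s where "s = (\<Sum>i<n. A $$ (i, i))"
  have s: "s = (\<Sum>i<m. B $$ (i, i))"
    using X(2) supertrace_even_mat[OF AB(1,2)] AB(3) by (simp add: s_def)
  have prod: "even_mat n m (R * R') (R' * R) \<in> K"
    if R: "R \<in> carrier_mat n m" "R' \<in> carrier_mat m n" for R R'
  proof -
    obtain x y where "P x = R" "Q x = 0\<^sub>m m n" "P y = 0\<^sub>m n m" "Q y = R'"
      using PQ_onto[OF R(1) zero_carrier_mat] PQ_onto[OF zero_carrier_mat R(2)] by blast
    then show ?thesis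
      using anti[of x y] R mult_carrier_mat[OF R] mult_carrier_mat[OF R(2,1)]
      by (simp add: \<phi>_anticommutator_eq)
  qed
  let ?K = "{(A, B). A \<in> carrier_mat n n \<and> B \<in> carrier_mat m m \<and> even_mat n m A B \<in> K}"
  have K_add: "(X + X', Y + Y') \<in> ?K" if "(X, Y) \<in> ?K" "(X', Y') \<in> ?K" for X Y X' Y'
    using that add[of "even_mat n m X Y" "even_mat n m X' Y'"] by (simp add: even_mat_add)
  have left: "even_mat n m A' (corner m (\<Sum>i<n. A' $$ (i, i))) \<in> K" if "A' \<in> carrier_mat n n" for A'
  proof -
    have "(A', corner m (\<Sum>i<n. A' $$ (i, i))) \<in> ?K"
      by (rule sum_of_columns[OF that nm_pos])
        (use zero prod K_add in \<open>auto simp: even_mat_0 intro!: mult_carrier_mat\<close>)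
    then show ?thesis by simp
  qed
  have right: "even_mat n m (corner n (\<Sum>i<m. B' $$ (i, i))) B' \<in> K" if "B' \<in> carrier_mat m m" for B'
  proof -
    have "(B', corner n (\<Sum>i<m. B' $$ (i, i))) \<in> {(B, A). (A, B) \<in> ?K}"
      by (rule sum_of_columns[OF that nm_pos(2,1)])
        (use zero prod K_add in \<open>auto simp: even_mat_0 intro!: mult_carrier_mat\<close>)
    then show ?thesis by simp
  qed
  have "even_mat n m A (corner m s) \<in> K" "even_mat n m (corner n s) B \<in> K"
    "even_mat n m (corner n s) (corner m s) \<in> K"
    using left[OF AB(1)] right[OF AB(2)] left[of "corner n s"] nm_pos
    by (simp_all add: s_def[symmetric] s[symmetric] corner_trace)
  then have "even_mat n m A (corner m s) + even_mat n m (corner n s) B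
      + (- 1) \<cdot>\<^sub>m even_mat n m (corner n s) (corner m s) \<in> K"
    using add scale by blast
  moreover have "even_mat n m A (corner m s) + even_mat n m (corner n s) B
      + (- 1) \<cdot>\<^sub>m even_mat n m (corner n s) (corner m s) = X"
    using AB by (intro eq_matI) (auto simp: even_mat_def corner_def)
  ultimately show "X \<in> K" by simp
qed

lemma trace_commute:
  fixes A B :: "'f mat"
  assumes "A \<in> carrier_mat k l" "B \<in> carrier_mat l k"
  shows "(\<Sum>i<k. (A * B) $$ (i, i)) = (\<Sum>i<l. (B * A) $$ (i, i))"
proof -
  have "(\<Sum>i<k. (A * B) $$ (i, i)) = (\<Sum>i<k. \<Sum>j<l. A $$ (i, j) * B $$ (j, i))"
    using assms by (intro sum.cong) (auto simp: scalar_prod_def atLeast0LessThan)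
  also have "\<dots> = (\<Sum>j<l. \<Sum>i<k. B $$ (j, i) * A $$ (i, j))"
    by (subst sum.swap) (simp add: mult.commute)
  also have "\<dots> = (\<Sum>i<l. (B * A) $$ (i, i))"
    using assms by (intro sum.cong) (auto simp: scalar_prod_def atLeast0LessThan)
  finally show ?thesis .
qed

sublocale matrix_model scale p n m \<phi> E
proof
  show "E \<subseteq> sa_even (gl_super n m)" by (auto simp: E_iff)
  have str: "supertrace n m (X + Y) = supertrace n m X + supertrace n m Y"
    "supertrace n m (c \<cdot>\<^sub>m X) = c * supertrace n m X"
    if "X \<in> carrier_mat (n + m) (n + m)" "Y \<in> carrier_mat (n + m) (n + m)" for c :: 'f and X Y
    using that by (simp_all add: supertrace_def sum.distrib sum_distrib_left right_diff_distrib)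
  show "0\<^sub>m (n + m) (n + m) \<in> E" by (simp add: E_iff gl_even_iff supertrace_def)
  show "X + Y \<in> E" if "X \<in> E" "Y \<in> E" for X Y
    using that str(1)[of X Y] by (auto simp: E_iff gl_even_iff)
  show "c \<cdot>\<^sub>m X \<in> E" if "X \<in> E" for c X
    using that str(2)[of X X] by (auto simp: E_iff gl_even_iff)
  show "inj \<phi>"
    by (rule injI, rule PQ_inj) (simp_all add: \<phi>_def odd_mat_eq_iff)
  show "\<phi> x * \<phi> y + \<phi> y * \<phi> x \<in> E" for x y
  proof -
    have "supertrace n m (\<phi> x * \<phi> y + \<phi> y * \<phi> x) = 0"
      unfolding \<phi>_anticommutator_eq
      using trace_commute[of "P x" n m "Q y"] trace_commute[of "P y" n m "Q x"] PQ_mult_carrier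
      by (simp add: supertrace_even_mat sum.distrib del: index_mult_mat(1))
    then show ?thesis
      unfolding E_iff by (simp add: \<phi>_anticommutator_eq even_mat_in_gl)
  qed
  show "X * \<phi> t - \<phi> t * X \<in> range \<phi>" if "X \<in> E" for X t
  proof -
    obtain A B where AB: "A \<in> carrier_mat n n" "B \<in> carrier_mat m m" "X = even_mat n m A B"
      using \<open>X \<in> E\<close> E_iff[of X] gl_even_cases[of X n m] by metis
    have "A * P t - P t * B \<in> carrier_mat n m" "B * Q t - Q t * A \<in> carrier_mat m n"
      using AB(1,2) by (simp_all add: minus_carrier_mat mult_carrier_mat[of _ n n _ m]
        mult_carrier_mat[of _ m m _ n] mult_carrier_mat[of _ n m _ m] mult_carrier_mat[of _ m n _ n])
    then show ?thesis
      unfolding range_\<phi> AB(3) commutator_\<phi>[OF AB(1,2)] by (rule odd_mat_in_gl)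
  qed
  show "\<phi> t \<in> sa_odd (gl_super n m)" for t by (rule \<phi>_props)
  show "\<phi> (s + t) = \<phi> s + \<phi> t" for s t by (rule \<phi>_props)
  show "\<phi> (scale c t) = c \<cdot>\<^sub>m \<phi> t" for c t by (rule \<phi>_props)
  show "\<phi> (S_op p x y z) = (\<phi> x * \<phi> y + \<phi> y * \<phi> x) * \<phi> z - \<phi> z * (\<phi> x * \<phi> y + \<phi> y * \<phi> x)" for x y z
    by (rule \<phi>_props)
qed (rule E_spanned)

text \<open>Scalar matrices commute with everything, and only they commute with the odd part, so the kernel \<open>I\<close> is the
  ideal that is divided out in \<open>psl\<close>.\<close>

theorem Lss_isomorphic_psl: "superalgebra_isomorphic L (psl_super n m)"
proof -
  have sl: "sl_super n m = M"
  proof -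
    have "sa_odd (gl_super n m) \<inter> {X. supertrace n m X = 0} = range \<phi>"
      using supertrace_odd[of _ n m] by (auto simp: range_\<phi>)
    moreover have "sa_even (gl_super n m) \<inter> {X. supertrace n m X = 0} = E"
      by (auto simp: E_iff)
    ultimately show ?thesis unfolding sl_super_def sa_restrict_def M_def by simp
  qed
  have "I = sa_carrier (sl_super n m) \<inter> {c \<cdot>\<^sub>m 1\<^sub>m (n + m) | c. True}"
  proof (intro subset_antisym subsetI)
    fix X assume "X \<in> I"
    then have X: "X \<in> E" "\<And>t. X * \<phi> t = \<phi> t * X" by (auto simp: I_def)
    then have "X \<in> sa_carrier (sl_super n m)" using even_odd_carrier(1) by (auto simp: sl M_simps)
    moreover obtain c where "X = c \<cdot>\<^sub>m 1\<^sub>m (n + m)"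
      using commuting_even_scalar[OF _ X(2) range_P] X(1) E_iff by blast
    ultimately show "X \<in> sa_carrier (sl_super n m) \<inter> {c \<cdot>\<^sub>m 1\<^sub>m (n + m) | c. True}" by blast
  next
    fix X :: "'f mat" assume *: "X \<in> sa_carrier (sl_super n m) \<inter> {c \<cdot>\<^sub>m 1\<^sub>m (n + m) | c. True}"
    then obtain c where c: "X = c \<cdot>\<^sub>m 1\<^sub>m (n + m)" by auto
    obtain Y t where Y: "Y \<in> E" "X = Y + \<phi> t" using * by (auto simp: sl M_carrier)
    have "X \<in> sa_even (gl_super n m)" by (auto simp: c gl_even_iff)
    then have "even_block n X = X" by (simp add: gl_super_def)
    then have "X \<in> E" using blocks(1)[OF Y(1), of t] Y by simp
    then show "X \<in> I"
      by (auto simp: I_def c mult_smult_assoc_mat[of _ "n + m" "n + m" _ "n + m"]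
          mult_smult_distrib[of _ "n + m" "n + m" _ "n + m"])
  qed
  then show ?thesis
    using isomorphic_quotient unfolding psl_super_def sl by simp
qed

end

section \<open>The orthosymplectic model\<close>

definition rank1 :: "nat \<Rightarrow> nat \<Rightarrow> (nat \<Rightarrow> 'f::field) \<Rightarrow> (nat \<Rightarrow> 'f) \<Rightarrow> 'f mat" where
  "rank1 k l p q = mat k l (\<lambda>(i, j). p i * q j)"

lemma rank1_carrier [simp]: "rank1 k l p q \<in> carrier_mat k l"
  by (simp add: rank1_def)

lemma rank1_transpose: "(rank1 k l p q)\<^sup>T = rank1 l k q p"
  by (intro eq_matI) (auto simp: rank1_def)

lemma rank1_mult_right:
  assumes "A \<in> carrier_mat l r"
  shows "rank1 k l p q * A = rank1 k r p (\<lambda>j. \<Sum>i<l. q i * A $$ (i, j))"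
  using assms by (intro eq_matI)
    (auto simp: rank1_def scalar_prod_def atLeast0LessThan sum_distrib_left mult.assoc)

lemma rank1_mult_rank1:
  "rank1 k l p q * rank1 l r p' q' = (\<Sum>i<l. q i * p' i) \<cdot>\<^sub>m rank1 k r p q'"
  by (intro eq_matI)
    (auto simp: rank1_def scalar_prod_def atLeast0LessThan sum_distrib_left sum_distrib_right ac_simps)

text \<open>The matrices \<open>p q\<^sup>T + \<eta> q p\<^sup>T\<close> span the symmetric (\<open>\<eta> = 1\<close>) or the
  skew-symmetric (\<open>\<eta> = -1\<close>) matrices: up to the factor \<open>2\<close>, take for \<open>p\<close> the columns
  of \<open>A\<close> and for \<open>q\<close> the unit vectors.\<close>

lemma sum_of_symmetrized_rank1:
  fixes A :: "'f::field mat"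
  assumes A: "A \<in> carrier_mat k k" and sym: "\<And>i j. i < k \<Longrightarrow> j < k \<Longrightarrow> A $$ (j, i) = \<eta> * A $$ (i, j)"
    and \<eta>: "\<eta> * \<eta> = 1"
    and zero: "0\<^sub>m k k \<in> K" and add: "\<And>X Y. X \<in> K \<Longrightarrow> Y \<in> K \<Longrightarrow> X + Y \<in> K"
    and rank1: "\<And>p q. rank1 k k p q + \<eta> \<cdot>\<^sub>m rank1 k k q p \<in> K"
  shows "2 \<cdot>\<^sub>m A \<in> K"
proof -
  let ?B = "\<lambda>r. mat k k (\<lambda>(i, j). (if j < r then A $$ (i, j) else 0) + (if i < r then A $$ (i, j) else 0))"
  have "?B r \<in> K" if "r \<le> k" for r
    using that
  proof (induction r)
    case 0
    have B0: "?B 0 = 0\<^sub>m k k" by (intro eq_matI) auto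
    show ?case unfolding B0 by (rule zero)
  next
    case (Suc r)
    let ?p = "\<lambda>i. A $$ (i, r)" and ?q = "\<lambda>i. if i = r then 1 else 0"
    have "?B r + (rank1 k k ?p ?q + \<eta> \<cdot>\<^sub>m rank1 k k ?q ?p) = ?B (Suc r)"
    proof (rule eq_matI, goal_cases)
      case (1 i j)
      then have "\<eta> * A $$ (j, r) = A $$ (r, j)" using sym[of j r] Suc.prems by simp
      then show ?case using 1 by (auto simp: rank1_def less_Suc_eq)
    qed (auto simp: rank1_def)
    then show ?case using add[OF Suc.IH rank1[of ?p ?q]] Suc.prems by simp
  qed
  from this[of k] have "?B k \<in> K" by simp
  moreover have "?B k = 2 \<cdot>\<^sub>m A" using A by (intro eq_matI) auto
  ultimately show ?thesis by simp
qed

text \<open>\<open>G0\<close> and \<open>G1\<close> are the Gram matrices of the symmetric and the skew form, with inverses \<open>H0\<close> and \<open>C\<close>. The formula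
  for \<open>Q\<close> says that the odd matrix with blocks \<open>P t\<close> and \<open>Q t\<close> is skew with respect to the sum of the forms.\<close>

locale osp_model = block_model scale p n m P Q
  for scale :: "'f::field \<Rightarrow> 't::ab_group_add \<Rightarrow> 't" and p :: "'t \<Rightarrow> 't \<Rightarrow> 't \<Rightarrow> 't"
    and n m P Q +
  fixes G0 H0 G1 C :: "'f mat"
  assumes char_not_2: "(2::'f) \<noteq> 0"
    and G0: "G0 \<in> carrier_mat n n" "G0\<^sup>T = G0" and H0: "H0 \<in> carrier_mat n n" "G0 * H0 = 1\<^sub>m n" "H0 * G0 = 1\<^sub>m n"
    and G1: "G1 \<in> carrier_mat m m" "G1\<^sup>T = - G1" and C: "C \<in> carrier_mat m m" "G1 * C = 1\<^sub>m m" "C * G1 = 1\<^sub>m m"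
    and Q_eq: "Q t = C * (P t)\<^sup>T * G0"
    and P_bij: "bij_betw P UNIV (carrier_mat n m)"
begin

text \<open>A skew-symmetric matrix of odd size has determinant \<open>0\<close>, as the characteristic is not \<open>2\<close>.\<close>

lemma even_m: "even m"
proof (rule ccontr)
  assume "odd m"
  have "det G1 * det C = 1" using det_mult[OF G1(1) C(1)] C(2) by simp
  moreover have "det G1 = (- 1) ^ m * det G1"
  proof -
    have "- G1 = (- 1) \<cdot>\<^sub>m G1" by (intro eq_matI) auto
    then have "det (- G1) = (- 1) ^ m * det G1" using det_smult[of "- 1" G1] G1(1) by simp
    then show ?thesis using det_transpose[OF G1(1)] G1(2) by simp
  qed
  ultimately show False using \<open>odd m\<close> char_not_2 by (auto simp: eq_neg_iff_add_eq_0)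
qed

lemma H0_sym: "H0\<^sup>T = H0"
proof -
  have "H0\<^sup>T = H0\<^sup>T * (G0 * H0)" using H0 by simp
  also have "\<dots> = (H0\<^sup>T * G0\<^sup>T) * H0" using H0 G0 by (simp add: assoc_mult_mat[of _ n n _ n _ n])
  also have "H0\<^sup>T * G0\<^sup>T = (G0 * H0)\<^sup>T" by (rule transpose_mult[OF G0(1) H0(1), symmetric])
  finally show ?thesis using H0 by simp
qed

lemma C_skew: "C\<^sup>T = - C"
proof -
  have "C\<^sup>T = C\<^sup>T * (G1 * C)" using C by simp
  also have "\<dots> = (C\<^sup>T * - G1\<^sup>T) * C" using C G1 by (simp add: assoc_mult_mat[of _ m m _ m _ m])
  also have "C\<^sup>T * - G1\<^sup>T = - (C\<^sup>T * G1\<^sup>T)" using C G1 by simp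
  also have "C\<^sup>T * G1\<^sup>T = (G1 * C)\<^sup>T" by (rule transpose_mult[OF G1(1) C(1), symmetric])
  finally show ?thesis using C by simp
qed

text \<open>For \<open>P x = u v\<^sup>T\<close> and \<open>P y = u' v'\<^sup>T\<close> the products \<open>P x Q y\<close> and \<open>Q x P y\<close> are again of rank one, with
  the scalar factors \<open>\<beta>(v,v')\<close> and \<open>\<alpha>(u,u')\<close>. One of these two forms is symmetric and the other one skew, so
  the two blocks of an anticommutator are symmetrised in opposite ways.\<close>

definition \<alpha> :: "(nat \<Rightarrow> 'f) \<Rightarrow> (nat \<Rightarrow> 'f) \<Rightarrow> 'f" where
  "\<alpha> u v = (\<Sum>j<n. (\<Sum>i<n. u i * G0 $$ (i, j)) * v j)"

definition \<beta> :: "(nat \<Rightarrow> 'f) \<Rightarrow> (nat \<Rightarrow> 'f) \<Rightarrow> 'f" where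
  "\<beta> u v = (\<Sum>j<m. (\<Sum>i<m. u i * C $$ (i, j)) * v j)"

lemma \<alpha>_sym: "\<alpha> v u = \<alpha> u v"
proof -
  have G: "G0 $$ (j, i) = G0 $$ (i, j)" if "i < n" "j < n" for i j
    using arg_cong[OF G0(2), of "\<lambda>X. X $$ (i, j)"] G0(1) that by simp
  have "\<alpha> v u = (\<Sum>j<n. \<Sum>i<n. v i * G0 $$ (i, j) * u j)"
    by (simp add: \<alpha>_def sum_distrib_right)
  also have "\<dots> = (\<Sum>i<n. \<Sum>j<n. v i * G0 $$ (i, j) * u j)" by (rule sum.swap)
  also have "\<dots> = (\<Sum>i<n. \<Sum>j<n. u j * G0 $$ (j, i) * v i)"
    by (intro sum.cong) (auto simp: G)
  finally show ?thesis by (simp add: \<alpha>_def sum_distrib_right)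
qed

lemma \<beta>_skew: "\<beta> v u = - \<beta> u v"
proof -
  have G: "v i * C $$ (i, j) * u j = - (u j * C $$ (j, i) * v i)" if "i < m" "j < m" for i j
  proof -
    have "C $$ (j, i) = - C $$ (i, j)"
      using arg_cong[OF C_skew, of "\<lambda>X. X $$ (i, j)"] C(1) that by simp
    then show ?thesis by simp
  qed
  have "\<beta> v u = (\<Sum>j<m. \<Sum>i<m. v i * C $$ (i, j) * u j)"
    by (simp add: \<beta>_def sum_distrib_right)
  also have "\<dots> = (\<Sum>i<m. \<Sum>j<m. v i * C $$ (i, j) * u j)" by (rule sum.swap)
  also have "\<dots> = (\<Sum>i<m. \<Sum>j<m. - (u j * C $$ (j, i) * v i))"
    by (intro sum.cong refl) (simp only: G lessThan_iff)
  finally show ?thesis by (simp add: \<beta>_def sum_distrib_right sum_negf)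
qed

lemma \<alpha>_eq_1: "\<exists>u v. \<alpha> u v = 1"
proof -
  have "\<exists>i<n. \<exists>j<n. G0 $$ (i, j) \<noteq> 0"
  proof (rule ccontr)
    assume "\<not> ?thesis"
    then have "G0 = 0\<^sub>m n n" using G0(1) by (intro eq_matI) auto
    then have "(1\<^sub>m n :: 'f mat) = 0\<^sub>m n n" using H0(1,2) by simp
    from arg_cong[OF this, of "\<lambda>X. X $$ (0, 0)"] show False using nm_pos by simp
  qed
  then obtain i j where ij: "i < n" "j < n" "G0 $$ (i, j) \<noteq> 0" by blast
  have row: "(\<Sum>k<n. (if k = i then 1 else 0) * G0 $$ (k, l)) = G0 $$ (i, l)" for l
  proof -
    have "(\<Sum>k<n. (if k = i then 1 else 0) * G0 $$ (k, l)) = (\<Sum>k<n. if k = i then G0 $$ (k, l) else 0)"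
      by (intro sum.cong) auto
    then show ?thesis using ij by simp
  qed
  have "\<alpha> (\<lambda>k. if k = i then 1 else 0) (\<lambda>k. if k = j then inverse (G0 $$ (i, j)) else 0)
    = (\<Sum>l<n. if l = j then G0 $$ (i, l) * inverse (G0 $$ (i, j)) else 0)"
    unfolding \<alpha>_def row by (intro sum.cong) auto
  then show ?thesis using ij by (intro exI) auto
qed

lemma \<beta>_eq_1: "\<exists>u v. \<beta> u v = 1"
proof -
  have "\<exists>i<m. \<exists>j<m. C $$ (i, j) \<noteq> 0"
  proof (rule ccontr)
    assume "\<not> ?thesis"
    then have "C = 0\<^sub>m m m" using C(1) by (intro eq_matI) auto
    then have "(1\<^sub>m m :: 'f mat) = 0\<^sub>m m m" using G1(1) C(2) by simp
    from arg_cong[OF this, of "\<lambda>X. X $$ (0, 0)"] show False using nm_pos by simp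
  qed
  then obtain i j where ij: "i < m" "j < m" "C $$ (i, j) \<noteq> 0" by blast
  have row: "(\<Sum>k<m. (if k = i then 1 else 0) * C $$ (k, l)) = C $$ (i, l)" for l
  proof -
    have "(\<Sum>k<m. (if k = i then 1 else 0) * C $$ (k, l)) = (\<Sum>k<m. if k = i then C $$ (k, l) else 0)"
      by (intro sum.cong) auto
    then show ?thesis using ij by simp
  qed
  have "\<beta> (\<lambda>k. if k = i then 1 else 0) (\<lambda>k. if k = j then inverse (C $$ (i, j)) else 0)
    = (\<Sum>l<m. if l = j then C $$ (i, l) * inverse (C $$ (i, j)) else 0)"
    unfolding \<beta>_def row by (intro sum.cong) auto
  then show ?thesis using ij by (intro exI) auto
qed

lemma rank1_products:
  assumes "P x = rank1 n m u v" "P y = rank1 n m u' v'"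
  shows "P x * Q y = (\<beta> v v' \<cdot>\<^sub>m rank1 n n u u') * G0"
    "Q x * P y = C * (\<alpha> u u' \<cdot>\<^sub>m rank1 m m v v')"
proof -
  have "P x * Q y = P x * C * (P y)\<^sup>T * G0"
    using C G0 by (simp add: Q_eq assoc_mult_mat[of _ n m _ m _ n] assoc_mult_mat[of _ n m _ n _ n]
        assoc_mult_mat[of _ m m _ n _ n] mult_carrier_mat[of _ m m _ n] mult_carrier_mat[of _ m n _ n])
  also have "P x * C * (P y)\<^sup>T = \<beta> v v' \<cdot>\<^sub>m rank1 n n u u'"
    by (simp add: assms rank1_mult_right[OF C(1)] rank1_transpose rank1_mult_rank1 \<beta>_def)
  finally show "P x * Q y = (\<beta> v v' \<cdot>\<^sub>m rank1 n n u u') * G0" .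
  have "Q x * P y = C * ((P x)\<^sup>T * G0 * P y)"
    using C G0 by (simp add: Q_eq assoc_mult_mat[of _ m m _ n _ n] assoc_mult_mat[of _ m m _ n _ m]
        mult_carrier_mat[of _ m n _ n])
  also have "(P x)\<^sup>T * G0 * P y = \<alpha> u u' \<cdot>\<^sub>m rank1 m m v v'"
    by (simp add: assms rank1_mult_right[OF G0(1)] rank1_transpose rank1_mult_rank1 \<alpha>_def)
  finally show "Q x * P y = C * (\<alpha> u u' \<cdot>\<^sub>m rank1 m m v v')" .
qed

lemma rank1_anticommutator:
  assumes K: "\<And>x y. \<phi> x * \<phi> y + \<phi> y * \<phi> x \<in> K"
  shows "even_mat n m ((\<beta> v v' \<cdot>\<^sub>m (rank1 n n u u' + (- 1) \<cdot>\<^sub>m rank1 n n u' u)) * G0)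
    (C * (\<alpha> u u' \<cdot>\<^sub>m (rank1 m m v v' + 1 \<cdot>\<^sub>m rank1 m m v' v))) \<in> K"
proof -
  have "range P = carrier_mat n m" using P_bij by (simp add: bij_betw_def)
  then obtain x y where xy: "P x = rank1 n m u v" "P y = rank1 n m u' v'"
    by (metis rank1_carrier rangeE)
  have "P x * Q y + P y * Q x = (\<beta> v v' \<cdot>\<^sub>m (rank1 n n u u' + (- 1) \<cdot>\<^sub>m rank1 n n u' u)) * G0"
    unfolding rank1_products[OF xy] rank1_products[OF xy(2,1)] \<beta>_skew[of v' v]
    using G0(1) by (subst add_mult_distrib_mat[symmetric, of _ n n _ _ n])
      (auto intro!: arg_cong[of _ _ "\<lambda>X. X * G0"] eq_matI simp: rank1_def algebra_simps)
  moreover have "Q x * P y + Q y * P x = C * (\<alpha> u u' \<cdot>\<^sub>m (rank1 m m v v' + 1 \<cdot>\<^sub>m rank1 m m v' v))"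
    unfolding rank1_products[OF xy] rank1_products[OF xy(2,1)] \<alpha>_sym[of u' u]
    using C(1) by (subst mult_add_distrib_mat[symmetric, of _ m m _ m])
      (auto intro!: arg_cong[of _ _ "\<lambda>X. C * X"] eq_matI simp: rank1_def algebra_simps)
  ultimately show ?thesis using K[of x y] by (simp add: \<phi>_anticommutator_eq)
qed

end

context osp_model
begin

text \<open>Taking the same \<open>v\<close> in both factors kills the first block, because \<open>\<beta>\<close> is alternating.  Polarisation
  then gives every symmetric matrix in the second block alone, and subtracting these leaves
  the skew-symmetric ones in the first block alone.\<close>

lemma blocks_in_span:
  assumes zero: "0\<^sub>m (n + m) (n + m) \<in> K"
    and add: "\<And>X Y. X \<in> K \<Longrightarrow> Y \<in> K \<Longrightarrow> X + Y \<in> K"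
    and scale: "\<And>c X. X \<in> K \<Longrightarrow> c \<cdot>\<^sub>m X \<in> K"
    and anti: "\<And>x y. \<phi> x * \<phi> y + \<phi> y * \<phi> x \<in> K"
  shows "even_mat n m (0\<^sub>m n n) (C * (rank1 m m v v' + 1 \<cdot>\<^sub>m rank1 m m v' v)) \<in> K"
    "even_mat n m ((rank1 n n u u' + (- 1) \<cdot>\<^sub>m rank1 n n u' u) * G0) (0\<^sub>m m m) \<in> K"
proof -
  let ?R = "\<lambda>v v'. rank1 m m v v' + 1 \<cdot>\<^sub>m rank1 m m v' v"
  let ?T = "\<lambda>v v'. even_mat n m (0\<^sub>m n n) (C * ?R v v')"
  obtain u0 u0' where u0: "\<alpha> u0 u0' = 1" using \<alpha>_eq_1 by blast
  obtain v0 v0' where v0: "\<beta> v0 v0' = 1" using \<beta>_eq_1 by blast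
  have CR [simp]: "C * ?R v v' \<in> carrier_mat m m" for v v'
    using C(1) by (intro mult_carrier_mat[of _ m m]) auto
  have diag: "?T v v \<in> K" for v
  proof -
    have "\<beta> v v + \<beta> v v = 0" using \<beta>_skew[of v v] by (simp add: eq_neg_iff_add_eq_0)
    then have "2 * \<beta> v v = 0" by simp
    then have "\<beta> v v = 0" using char_not_2 by simp
    moreover have "(0 \<cdot>\<^sub>m (rank1 n n u0 u0' + (- 1) \<cdot>\<^sub>m rank1 n n u0' u0)) * G0 = 0\<^sub>m n n"
    proof -
      have "0 \<cdot>\<^sub>m (rank1 n n u0 u0' + (- 1) \<cdot>\<^sub>m rank1 n n u0' u0) = 0\<^sub>m n n"
        by (intro eq_matI) (auto simp: rank1_def)
      then show ?thesis using G0(1) by simp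
    qed
    moreover have "1 \<cdot>\<^sub>m ?R v v = ?R v v" by (intro eq_matI) auto
    ultimately show ?thesis
      using rank1_anticommutator[OF anti, of v v u0 u0'] u0 by simp
  qed
  show *: "?T v v' \<in> K" for v v'
  proof -
    let ?w = "\<lambda>i. v i + v' i"
    have "(1 / 2) \<cdot>\<^sub>m (?T ?w ?w + (- 1) \<cdot>\<^sub>m (?T v v + ?T v' v')) \<in> K"
      using diag add scale by blast
    also have "?T ?w ?w + (- 1) \<cdot>\<^sub>m (?T v v + ?T v' v')
      = even_mat n m (0\<^sub>m n n) (C * (?R ?w ?w + (- 1) \<cdot>\<^sub>m (?R v v + ?R v' v')))"
      using C(1) by (simp add: even_mat_add even_mat_smult mult_add_distrib_mat[of _ m m _ m]
          mult_smult_distrib[of _ m m _ m])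
    also have "?R ?w ?w + (- 1) \<cdot>\<^sub>m (?R v v + ?R v' v') = 2 \<cdot>\<^sub>m ?R v v'"
      by (intro eq_matI) (auto simp: rank1_def algebra_simps)
    also have "(1 / 2) \<cdot>\<^sub>m even_mat n m (0\<^sub>m n n) (C * (2 \<cdot>\<^sub>m ?R v v')) = ?T v v'"
    proof -
      have "(1 / 2) \<cdot>\<^sub>m (2 \<cdot>\<^sub>m (C * ?R v v')) = C * ?R v v'"
        by (rule eq_matI) (use char_not_2 in \<open>auto simp del: index_mult_mat(1)\<close>)
      then show ?thesis
        using C(1) CR[of v v'] by (simp add: even_mat_smult mult_smult_distrib[of _ m m _ m])
    qed
    finally show ?thesis .
  qed
  let ?Z = "rank1 n n u u' + (- 1) \<cdot>\<^sub>m rank1 n n u' u"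
  have Z: "?Z * G0 \<in> carrier_mat n n"
    using G0(1) by (intro mult_carrier_mat[of _ n n]) auto
  have "even_mat n m ((1 \<cdot>\<^sub>m ?Z) * G0) (C * (\<alpha> u u' \<cdot>\<^sub>m ?R v0 v0')) + (- \<alpha> u u') \<cdot>\<^sub>m ?T v0 v0' \<in> K"
    using rank1_anticommutator[OF anti, of v0 v0' u u'] v0 *[of v0 v0'] by (metis add scale)
  also have "1 \<cdot>\<^sub>m ?Z = ?Z" by (intro eq_matI) auto
  also have "even_mat n m (?Z * G0) (C * (\<alpha> u u' \<cdot>\<^sub>m ?R v0 v0')) + (- \<alpha> u u') \<cdot>\<^sub>m ?T v0 v0'
    = even_mat n m (?Z * G0) (0\<^sub>m m m)"
  proof -
    have "C * (\<alpha> u u' \<cdot>\<^sub>m ?R v0 v0') = \<alpha> u u' \<cdot>\<^sub>m (C * ?R v0 v0')"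
      using C(1) by (simp add: mult_smult_distrib[of _ m m _ m])
    moreover have "\<alpha> u u' \<cdot>\<^sub>m Y + (- \<alpha> u u') \<cdot>\<^sub>m Y = 0\<^sub>m m m" if "Y \<in> carrier_mat m m" for Y
      using that by (intro eq_matI) auto
    ultimately show ?thesis
      using Z CR[of v0 v0'] by (simp add: even_mat_smult even_mat_add)
  qed
  finally show "even_mat n m (?Z * G0) (0\<^sub>m m m) \<in> K" .
qed

definition G :: "'f mat" where "G = even_mat n m G0 G1"

definition b :: "'f vec \<Rightarrow> 'f vec \<Rightarrow> 'f" where "b u v = u \<bullet> (G *\<^sub>v v)"

definition E :: "'f mat set" where "E = sa_even (osp_super n m b)"

lemma G_carrier: "G \<in> carrier_mat (n + m) (n + m)"
  using even_mat_in_gl[OF G0(1) G1(1)] by (simp add: G_def gl_even_iff)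

lemma b_adjoint:
  assumes "X \<in> carrier_mat (n + m) (n + m)" "u \<in> carrier_vec (n + m)" "v \<in> carrier_vec (n + m)"
  shows "b (X *\<^sub>v u) v = u \<bullet> ((X\<^sup>T * G) *\<^sub>v v)" "b u (X *\<^sub>v v) = u \<bullet> ((G * X) *\<^sub>v v)"
proof -
  have Gv: "G *\<^sub>v v \<in> carrier_vec (n + m)" using G_carrier assms by simp
  have "(X *\<^sub>v u) \<bullet> (G *\<^sub>v v) = (G *\<^sub>v v) \<bullet> (X *\<^sub>v u)"
    using assms G_carrier by (intro comm_scalar_prod[of _ "n + m"]) auto
  also have "\<dots> = (X\<^sup>T *\<^sub>v (G *\<^sub>v v)) \<bullet> u"
    by (rule transpose_vec_mult_scalar[OF assms(1,2) Gv, symmetric])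
  also have "\<dots> = u \<bullet> (X\<^sup>T *\<^sub>v (G *\<^sub>v v))"
    using assms G_carrier by (intro comm_scalar_prod[of _ "n + m"]) auto
  also have "X\<^sup>T *\<^sub>v (G *\<^sub>v v) = (X\<^sup>T * G) *\<^sub>v v"
    using assms G_carrier by (simp add: assoc_mult_mat_vec[of _ "n + m" "n + m" _ "n + m"])
  finally show "b (X *\<^sub>v u) v = u \<bullet> ((X\<^sup>T * G) *\<^sub>v v)" by (simp add: b_def)
  show "b u (X *\<^sub>v v) = u \<bullet> ((G * X) *\<^sub>v v)"
    using assms G_carrier by (simp add: b_def assoc_mult_mat_vec[of _ "n + m" "n + m" _ "n + m"])
qed

lemma unit_vec_parity:
  "i < n \<Longrightarrow> unit_vec (n + m) i \<in> vec_even n m" "n \<le> i \<Longrightarrow> i < n + m \<Longrightarrow> unit_vec (n + m) i \<in> vec_odd n m"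
  by (auto simp: vec_even_def vec_odd_def)

lemma homogeneous_vec: "vec_even n m \<subseteq> carrier_vec (n + m)" "vec_odd n m \<subseteq> carrier_vec (n + m)"
  by (auto simp: vec_even_def vec_odd_def)

text \<open>Even vectors test the upper rows of a matrix and odd vectors the lower ones. In this way the defining
  conditions of \<open>osp\<close>, which are stated for homogeneous vectors, become equations between blocks.\<close>

lemma rows_zero_iff:
  fixes Z :: "'f mat"
  assumes Z: "Z \<in> carrier_mat (n + m) (n + m)"
  shows "(\<forall>u\<in>vec_even n m. \<forall>v\<in>carrier_vec (n + m). u \<bullet> (Z *\<^sub>v v) = 0) \<longleftrightarrow>
      (\<forall>i<n. \<forall>j<n + m. Z $$ (i, j) = 0)" (is ?even)
    and "(\<forall>u\<in>vec_odd n m. \<forall>v\<in>carrier_vec (n + m). u \<bullet> (Z *\<^sub>v v) = 0) \<longleftrightarrow>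
      (\<forall>i. n \<le> i \<and> i < n + m \<longrightarrow> (\<forall>j<n + m. Z $$ (i, j) = 0))" (is ?odd)
proof -
  have entry: "unit_vec (n + m) i \<bullet> (Z *\<^sub>v unit_vec (n + m) j) = Z $$ (i, j)"
    if "i < n + m" "j < n + m" for i j
  proof -
    have "Z *\<^sub>v unit_vec (n + m) j \<in> carrier_vec (n + m)" using Z by auto
    then have "unit_vec (n + m) i \<bullet> (Z *\<^sub>v unit_vec (n + m) j) = (Z *\<^sub>v unit_vec (n + m) j) $ i"
      using that by simp
    also have "\<dots> = Z $$ (i, j)" using Z that by simp
    finally show ?thesis .
  qed
  have vanish: "u \<bullet> (Z *\<^sub>v v) = 0"
    if u: "u \<in> carrier_vec (n + m)" and v: "v \<in> carrier_vec (n + m)"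
      and row: "\<And>i. i < n + m \<Longrightarrow> u $ i = 0 \<or> (\<forall>j<n + m. Z $$ (i, j) = 0)" for u v :: "'f vec"
  proof -
    have "u $ i * (Z *\<^sub>v v) $ i = 0" if "i < n + m" for i
    proof (cases "u $ i = 0")
      case False
      then have "row Z i = 0\<^sub>v (n + m)" using row[OF that] Z that by (intro eq_vecI) auto
      then show ?thesis using Z that v by simp
    qed simp
    moreover have "dim_vec (Z *\<^sub>v v) = n + m" using Z by simp
    ultimately show ?thesis unfolding scalar_prod_def by (intro sum.neutral) auto
  qed
  show ?even
  proof
    assume "\<forall>u\<in>vec_even n m. \<forall>v\<in>carrier_vec (n + m). u \<bullet> (Z *\<^sub>v v) = 0"
    then show "\<forall>i<n. \<forall>j<n + m. Z $$ (i, j) = 0"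
      using entry unit_vec_parity(1) by (metis trans_less_add1 unit_vec_carrier)
  next
    assume *: "\<forall>i<n. \<forall>j<n + m. Z $$ (i, j) = 0"
    show "\<forall>u\<in>vec_even n m. \<forall>v\<in>carrier_vec (n + m). u \<bullet> (Z *\<^sub>v v) = 0"
    proof (intro ballI vanish)
      fix u :: "'f vec" and i assume "u \<in> vec_even n m" "i < n + m"
      then show "u $ i = 0 \<or> (\<forall>j<n + m. Z $$ (i, j) = 0)"
        using * by (cases "i < n") (auto simp: vec_even_def)
    qed (auto simp: vec_even_def)
  qed
  show ?odd
  proof
    assume "\<forall>u\<in>vec_odd n m. \<forall>v\<in>carrier_vec (n + m). u \<bullet> (Z *\<^sub>v v) = 0"
    then show "\<forall>i. n \<le> i \<and> i < n + m \<longrightarrow> (\<forall>j<n + m. Z $$ (i, j) = 0)"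
      using entry unit_vec_parity(2) by (metis unit_vec_carrier)
  next
    assume *: "\<forall>i. n \<le> i \<and> i < n + m \<longrightarrow> (\<forall>j<n + m. Z $$ (i, j) = 0)"
    show "\<forall>u\<in>vec_odd n m. \<forall>v\<in>carrier_vec (n + m). u \<bullet> (Z *\<^sub>v v) = 0"
    proof (intro ballI vanish)
      fix u :: "'f vec" and i assume "u \<in> vec_odd n m" "i < n + m"
      then show "u $ i = 0 \<or> (\<forall>j<n + m. Z $$ (i, j) = 0)"
        using * by (cases "i < n") (auto simp: vec_odd_def)
    qed (auto simp: vec_odd_def)
  qed
qed

lemma even_transpose: "A \<in> carrier_mat n n \<Longrightarrow> B \<in> carrier_mat m m \<Longrightarrow>
    (even_mat n m A B)\<^sup>T = even_mat n m A\<^sup>T B\<^sup>T"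
  by (intro eq_matI) (auto simp: even_mat_def)

lemma odd_transpose: "R \<in> carrier_mat n m \<Longrightarrow> R' \<in> carrier_mat m n \<Longrightarrow>
    (odd_mat n m R R')\<^sup>T = odd_mat n m R'\<^sup>T R\<^sup>T"
  by (intro eq_matI) (auto simp: odd_mat_def)

lemma even_mat_mult:
  "A \<in> carrier_mat n n \<Longrightarrow> B \<in> carrier_mat m m \<Longrightarrow> A' \<in> carrier_mat n n \<Longrightarrow> B' \<in> carrier_mat m m \<Longrightarrow>
    even_mat n m A B * even_mat n m A' B' = even_mat n m (A * A') (B * B')"
  unfolding even_mat_def by (subst mult_four_block_mat[of _ n n _ m _ m _ _ n _ m]) auto

lemma E_iff_transpose: "X \<in> E \<longleftrightarrow>
    X \<in> sa_even (gl_super n m) \<and> X\<^sup>T * G + G * X = 0\<^sub>m (n + m) (n + m)" (is "_ \<longleftrightarrow> _ \<and> ?Z = _")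
proof (cases "X \<in> sa_even (gl_super n m)")
  case True
  then have X: "X \<in> carrier_mat (n + m) (n + m)" by (simp add: gl_even_iff)
  have Z: "?Z \<in> carrier_mat (n + m) (n + m)" using X G_carrier by auto
  have b: "b (X *\<^sub>v u) v + b u (X *\<^sub>v v) = u \<bullet> (?Z *\<^sub>v v)"
    if "u \<in> carrier_vec (n + m)" "v \<in> carrier_vec (n + m)" for u v
    using X G_carrier that
    by (simp add: b_adjoint add_mult_distrib_mat_vec[of _ "n + m" "n + m"]
        mult_carrier_mat[of _ "n + m" "n + m"] scalar_prod_add_distrib[of _ "n + m"])
  have "X \<in> E \<longleftrightarrow> (\<forall>u\<in>vec_even n m \<union> vec_odd n m. \<forall>v\<in>carrier_vec (n + m). b (X *\<^sub>v u) v + b u (X *\<^sub>v v) = 0)"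
    using True by (simp add: E_def osp_super_def)
  also have "\<dots> \<longleftrightarrow> (\<forall>u\<in>vec_even n m \<union> vec_odd n m. \<forall>v\<in>carrier_vec (n + m). u \<bullet> (?Z *\<^sub>v v) = 0)"
    by (intro ball_cong refl, subst b) (use homogeneous_vec in auto)
  also have "\<dots> \<longleftrightarrow> (\<forall>i<n + m. \<forall>j<n + m. ?Z $$ (i, j) = 0)"
    unfolding ball_Un rows_zero_iff[OF Z] by (metis linorder_not_le trans_less_add1)
  also have "\<dots> \<longleftrightarrow> ?Z = 0\<^sub>m (n + m) (n + m)"
    using Z by (auto intro!: eq_matI)
  finally show ?thesis using True by simp
qed (simp add: E_def osp_super_def)

lemma even_mat_in_E_iff:
  assumes "A \<in> carrier_mat n n" "B \<in> carrier_mat m m"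
  shows "even_mat n m A B \<in> E \<longleftrightarrow> A\<^sup>T * G0 + G0 * A = 0\<^sub>m n n \<and> B\<^sup>T * G1 + G1 * B = 0\<^sub>m m m"
  using assms G0(1) G1(1)
  by (simp add: E_iff_transpose even_mat_in_gl G_def even_transpose even_mat_mult even_mat_add
      mult_carrier_mat[of _ n n _ n] mult_carrier_mat[of _ m m _ m] even_mat_eq_iff
      flip: even_mat_0)

lemma adjoint_iff:
  assumes R: "R \<in> carrier_mat n m" "R' \<in> carrier_mat m n"
  shows "R' = C * R\<^sup>T * G0 \<longleftrightarrow> G1 * R' = R\<^sup>T * G0"
proof
  assume *: "G1 * R' = R\<^sup>T * G0"
  have "C * R\<^sup>T * G0 = C * (G1 * R')"
    unfolding * using C(1) R G0(1) by (simp add: assoc_mult_mat[of _ m m _ n _ n])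
  also have "\<dots> = (C * G1) * R'"
    using C(1) R G1(1) by (simp add: assoc_mult_mat[of _ m m _ m _ n])
  finally show "R' = C * R\<^sup>T * G0" using C(3) R by simp
next
  note mults = mult_carrier_mat[of _ n n _ m] mult_carrier_mat[of _ m m _ n]
    mult_carrier_mat[of _ n m _ m] mult_carrier_mat[of _ m n _ n]
  assume R': "R' = C * R\<^sup>T * G0"
  have "G1 * R' = (G1 * C) * (R\<^sup>T * G0)"
    unfolding R' using C(1) R G0(1) G1(1)
    by (simp add: assoc_mult_mat[of _ m m _ n _ n] assoc_mult_mat[of _ m m _ m _ n] mults)
  also have "\<dots> = R\<^sup>T * G0" using C(2) R G0(1) by (simp add: mults)
  finally show "G1 * R' = R\<^sup>T * G0" .
qed

lemma adjoint_transpose: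
  assumes R: "R \<in> carrier_mat n m" "R' \<in> carrier_mat m n" and *: "G1 * R' = R\<^sup>T * G0"
  shows "R'\<^sup>T * G1 = - (G0 * R)"
proof -
  have "(G1 * R')\<^sup>T = R'\<^sup>T * - G1"
    using transpose_mult[OF G1(1) R(2)] G1(2) by simp
  also have "R'\<^sup>T * - G1 = - (R'\<^sup>T * G1)" using R G1(1) by simp
  moreover have "(R\<^sup>T * G0)\<^sup>T = G0 * R"
    using transpose_mult[of "R\<^sup>T" m n G0 n] R G0 by simp
  ultimately have "G0 * R = - (R'\<^sup>T * G1)" using * by simp
  then show ?thesis using R G1(1) by simp
qed

lemma PQ_adjoint: "(P t)\<^sup>T * G0 = G1 * Q t" "(Q t)\<^sup>T * G1 = - (G0 * P t)"
proof -
  have *: "G1 * Q t = (P t)\<^sup>T * G0"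
    using adjoint_iff[OF PQ_carrier(1)[of t] PQ_carrier(2)[of t]] Q_eq[of t] by blast
  then show "(P t)\<^sup>T * G0 = G1 * Q t" by simp
  show "(Q t)\<^sup>T * G1 = - (G0 * P t)" by (rule adjoint_transpose[OF PQ_carrier *])
qed

lemma odd_mat_in_osp_iff:
  assumes R: "R \<in> carrier_mat n m" "R' \<in> carrier_mat m n"
  shows "odd_mat n m R R' \<in> sa_odd (osp_super n m b) \<longleftrightarrow> R' = C * R\<^sup>T * G0"
proof -
  let ?X = "odd_mat n m R R'"
  let ?S = "?X\<^sup>T * G + G * ?X" and ?D = "?X\<^sup>T * G - G * ?X"
  have X: "?X \<in> sa_odd (gl_super n m)" "?X \<in> carrier_mat (n + m) (n + m)"
    using odd_mat_in_gl[OF R] by (simp_all add: gl_odd_iff)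
  note mults = mult_carrier_mat[of _ n n _ m] mult_carrier_mat[of _ m m _ n]
    mult_carrier_mat[of _ n m _ m] mult_carrier_mat[of _ m n _ n]
  have S: "?S = odd_mat n m (R'\<^sup>T * G1 + G0 * R) (R\<^sup>T * G0 + G1 * R')"
    and D: "?D = odd_mat n m (R'\<^sup>T * G1 - G0 * R) (R\<^sup>T * G0 - G1 * R')"
    using R G0(1) G1(1)
    by (simp_all add: G_def odd_transpose even_odd_mat_mult odd_mat_add odd_mat_diff mults)
  have SD: "?S \<in> carrier_mat (n + m) (n + m)" "?D \<in> carrier_mat (n + m) (n + m)"
    using X G_carrier by (auto intro!: minus_carrier_mat add_carrier_mat mult_carrier_mat[of _ "n + m" "n + m"])
  have bs: "b (?X *\<^sub>v u) v + b u (?X *\<^sub>v v) = u \<bullet> (?S *\<^sub>v v)"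
    "b (?X *\<^sub>v u) v - b u (?X *\<^sub>v v) = u \<bullet> (?D *\<^sub>v v)"
    if "u \<in> carrier_vec (n + m)" "v \<in> carrier_vec (n + m)" for u v
    using X(2) G_carrier that
    by (simp_all add: b_adjoint add_mult_distrib_mat_vec[of _ "n + m" "n + m"]
        minus_mult_distrib_mat_vec[of _ "n + m" "n + m"]
        mult_carrier_mat[of _ "n + m" "n + m"] scalar_prod_add_distrib[of _ "n + m"]
        scalar_prod_minus_distrib[of _ "n + m"])
  have "?X \<in> sa_odd (osp_super n m b) \<longleftrightarrow> (\<forall>v\<in>carrier_vec (n + m).
      (\<forall>u\<in>vec_even n m. b (?X *\<^sub>v u) v + b u (?X *\<^sub>v v) = 0) \<and>
      (\<forall>u\<in>vec_odd n m. b (?X *\<^sub>v u) v - b u (?X *\<^sub>v v) = 0))"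
    using X(1) by (simp add: osp_super_def)
  also have "\<dots> \<longleftrightarrow> (\<forall>v\<in>carrier_vec (n + m).
      (\<forall>u\<in>vec_even n m. u \<bullet> (?S *\<^sub>v v) = 0) \<and> (\<forall>u\<in>vec_odd n m. u \<bullet> (?D *\<^sub>v v) = 0))"
    using homogeneous_vec by (intro ball_cong refl conj_cong; subst bs) auto
  also have "\<dots> \<longleftrightarrow> (\<forall>u\<in>vec_even n m. \<forall>v\<in>carrier_vec (n + m). u \<bullet> (?S *\<^sub>v v) = 0) \<and>
      (\<forall>u\<in>vec_odd n m. \<forall>v\<in>carrier_vec (n + m). u \<bullet> (?D *\<^sub>v v) = 0)"
    by blast
  also have "\<dots> \<longleftrightarrow> R'\<^sup>T * G1 + G0 * R = 0\<^sub>m n m \<and> R\<^sup>T * G0 - G1 * R' = 0\<^sub>m m n" (is "?l \<longleftrightarrow> ?r1 \<and> ?r2")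
  proof -
    let ?Y = "R'\<^sup>T * G1 + G0 * R" and ?Y' = "R\<^sup>T * G0 - G1 * R'"
    have Y: "?Y \<in> carrier_mat n m" "?Y' \<in> carrier_mat m n"
      using R G0(1) G1(1) by (simp_all add: mults minus_carrier_mat)
    have "(\<forall>i<n. \<forall>j<n + m. odd_mat n m ?Y Z $$ (i, j) = 0) \<longleftrightarrow> ?Y = 0\<^sub>m n m" (is "?a \<longleftrightarrow> _")
      if "Z \<in> carrier_mat m n" for Z
    proof
      assume a: ?a
      show "?Y = 0\<^sub>m n m"
      proof (rule eq_matI)
        fix i j assume "i < dim_row (0\<^sub>m n m)" "j < dim_col (0\<^sub>m n m)"
        then show "?Y $$ (i, j) = 0\<^sub>m n m $$ (i, j)"
          using a[rule_format, of i "j + n"] that Y(1) by (simp add: odd_mat_def)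
      qed (use Y in auto)
    qed (use that in \<open>auto simp: odd_mat_def\<close>)
    moreover have "(\<forall>i. n \<le> i \<and> i < n + m \<longrightarrow> (\<forall>j<n + m. odd_mat n m Z ?Y' $$ (i, j) = 0)) \<longleftrightarrow> ?Y' = 0\<^sub>m m n"
      (is "?a \<longleftrightarrow> _") if "Z \<in> carrier_mat n m" for Z
    proof
      assume a: ?a
      show "?Y' = 0\<^sub>m m n"
      proof (rule eq_matI)
        fix i j assume "i < dim_row (0\<^sub>m m n)" "j < dim_col (0\<^sub>m m n)"
        then show "?Y' $$ (i, j) = 0\<^sub>m m n $$ (i, j)"
          using a[rule_format, of "i + n" j] that Y(2) by (simp add: odd_mat_def)
      qed (use Y in auto)
    qed (use that in \<open>auto simp: odd_mat_def\<close>)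
    ultimately show ?thesis
      unfolding rows_zero_iff[OF SD(1)] rows_zero_iff[OF SD(2)] unfolding S D
      using R G0(1) G1(1) by (simp add: mults minus_carrier_mat)
  qed
  also have "\<dots> \<longleftrightarrow> R' = C * R\<^sup>T * G0"
  proof
    assume "?r1 \<and> ?r2"
    then have r2: "R\<^sup>T * G0 - G1 * R' = 0\<^sub>m m n" by simp
    have "R\<^sup>T * G0 = (R\<^sup>T * G0 - G1 * R') + G1 * R'"
      using R G0(1) G1(1) by (intro eq_matI) (auto simp del: index_mult_mat(1))
    then have "G1 * R' = R\<^sup>T * G0" using r2 R G1(1) by (simp add: mults)
    then show "R' = C * R\<^sup>T * G0" using adjoint_iff[OF R] by simp
  next
    assume "R' = C * R\<^sup>T * G0"
    then have *: "G1 * R' = R\<^sup>T * G0" using adjoint_iff[OF R] by simp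
    have "?r1" unfolding adjoint_transpose[OF R *]
      using R G0(1) by (intro eq_matI) (auto simp del: index_mult_mat(1))
    moreover have "?r2" unfolding * using R G0(1) by (intro eq_matI) (auto simp del: index_mult_mat(1))
    ultimately show "?r1 \<and> ?r2" by blast
  qed
  finally show ?thesis .
qed

lemma b_sum:
  assumes "u \<in> carrier_vec (n + m)" "v \<in> carrier_vec (n + m)"
  shows "b u v = (\<Sum>i<n + m. \<Sum>j<n + m. u $ i * G $$ (i, j) * v $ j)"
  using assms G_carrier
  by (simp add: b_def scalar_prod_def atLeast0LessThan sum_distrib_left mult.assoc)

lemma G_entries:
  assumes "i < n + m" "j < n + m"
  shows "(i < n) \<noteq> (j < n) \<Longrightarrow> G $$ (i, j) = 0"
    "i < n \<Longrightarrow> j < n \<Longrightarrow> G $$ (j, i) = G $$ (i, j)"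
    "\<not> i < n \<Longrightarrow> \<not> j < n \<Longrightarrow> G $$ (j, i) = - G $$ (i, j)"
proof -
  have 0: "G0 $$ (j, i) = G0 $$ (i, j)" if "i < n" "j < n" for i j
    using arg_cong[OF G0(2), of "\<lambda>Z. Z $$ (i, j)"] G0(1) that by simp
  have 1: "G1 $$ (j, i) = - G1 $$ (i, j)" if "i < m" "j < m" for i j
    using arg_cong[OF G1(2), of "\<lambda>Z. Z $$ (i, j)"] G1(1) that by simp
  show "(i < n) \<noteq> (j < n) \<Longrightarrow> G $$ (i, j) = 0"
    "i < n \<Longrightarrow> j < n \<Longrightarrow> G $$ (j, i) = G $$ (i, j)"
    "\<not> i < n \<Longrightarrow> \<not> j < n \<Longrightarrow> G $$ (j, i) = - G $$ (i, j)"
    using assms G0(1) G1(1) 0[of i j] 1[of "i - n" "j - n"] by (auto simp: G_def even_mat_def)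
qed

lemma supersymmetric_b: "supersymmetric_form n m b"
proof -
  have mixed: "b u v = 0 \<and> b v u = 0" if "u \<in> vec_even n m" "v \<in> vec_odd n m" for u v
  proof -
    have "u $ i * G $$ (i, j) * v $ j = 0" "v $ i * G $$ (i, j) * u $ j = 0"
      if "i < n + m" "j < n + m" for i j
      using that \<open>u \<in> vec_even n m\<close> \<open>v \<in> vec_odd n m\<close> G_entries(1)[of i j]
      by (cases "i < n"; cases "j < n"; auto simp: vec_even_def vec_odd_def)+
    moreover have c: "u \<in> carrier_vec (n + m)" "v \<in> carrier_vec (n + m)"
      using that homogeneous_vec by auto
    ultimately show ?thesis
      unfolding b_sum[OF c] b_sum[OF c(2,1)] by (intro conjI sum.neutral ballI) auto
  qed
  have swap: "b v u = (\<Sum>i<n + m. \<Sum>j<n + m. u $ i * G $$ (j, i) * v $ j)"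
    if "u \<in> carrier_vec (n + m)" "v \<in> carrier_vec (n + m)" for u v
    unfolding b_sum[OF that(2,1)] by (subst sum.swap) (simp add: ac_simps)
  have even: "b u v = b v u" if "u \<in> vec_even n m" "v \<in> vec_even n m" for u v
  proof -
    have c: "u \<in> carrier_vec (n + m)" "v \<in> carrier_vec (n + m)" using that homogeneous_vec by auto
    have "u $ i * G $$ (i, j) * v $ j = u $ i * G $$ (j, i) * v $ j" if "i < n + m" "j < n + m" for i j
      using that \<open>u \<in> vec_even n m\<close> \<open>v \<in> vec_even n m\<close> G_entries(2)[of i j]
      by (cases "i < n"; cases "j < n"; auto simp: vec_even_def)
    then show ?thesis unfolding b_sum[OF c] swap[OF c] by (intro sum.cong refl) auto
  qed
  have odd: "b u v = - b v u" if "u \<in> vec_odd n m" "v \<in> vec_odd n m" for u v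
  proof -
    have c: "u \<in> carrier_vec (n + m)" "v \<in> carrier_vec (n + m)" using that homogeneous_vec by auto
    have "u $ i * G $$ (i, j) * v $ j = - (u $ i * G $$ (j, i) * v $ j)" if "i < n + m" "j < n + m" for i j
      using that \<open>u \<in> vec_odd n m\<close> \<open>v \<in> vec_odd n m\<close> G_entries(3)[of i j]
      by (cases "i < n"; cases "j < n"; auto simp: vec_odd_def)
    then show ?thesis unfolding b_sum[OF c] swap[OF c] sum_negf[symmetric]
      by (intro sum.cong refl) auto
  qed
  have linear: "b (u + v) w = b u w + b v w \<and> b w (u + v) = b w u + b w v"
    "b (c \<cdot>\<^sub>v u) v = c * b u v \<and> b u (c \<cdot>\<^sub>v v) = c * b u v"
    if "u \<in> carrier_vec (n + m)" "v \<in> carrier_vec (n + m)" "w \<in> carrier_vec (n + m)" for u v w c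
    using that G_carrier
    by (simp_all add: b_def add_scalar_prod_distrib[of _ "n + m"] scalar_prod_add_distrib[of _ "n + m"]
        mult_add_distrib_mat_vec[of _ "n + m" "n + m"] mult_mat_vec[of _ "n + m" "n + m"])
  show ?thesis
    unfolding supersymmetric_form_def by (meson linear mixed even odd)
qed

lemma nondegenerate_b: "nondegenerate_super_form n m b"
  unfolding nondegenerate_super_form_def
proof (intro ballI impI)
  let ?H = "even_mat n m H0 C"
  fix u assume u: "u \<in> carrier_vec (n + m)" "\<forall>v\<in>carrier_vec (n + m). b u v = 0"
  have H: "?H \<in> carrier_mat (n + m) (n + m)"
    using even_mat_in_gl[OF H0(1) C(1)] by (simp add: gl_even_iff)
  have "even_mat n m (1\<^sub>m n) (1\<^sub>m m) = (1\<^sub>m (n + m) :: 'f mat)"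
    by (intro eq_matI) (auto simp: even_mat_def)
  then have GH: "G * ?H = 1\<^sub>m (n + m)"
    using G0(1) G1(1) H0 C by (simp add: G_def even_mat_mult)
  have "u \<bullet> v = 0" if v: "v \<in> carrier_vec (n + m)" for v
  proof -
    have "u \<bullet> ((G * ?H) *\<^sub>v v) = b u (?H *\<^sub>v v)"
      using G_carrier H v by (simp add: b_def assoc_mult_mat_vec[of _ "n + m" "n + m" _ "n + m"])
    then show ?thesis using u(2) H v by (simp add: GH)
  qed
  then have "u $ i = 0" if "i < n + m" for i
    using that u(1) scalar_prod_right_unit[OF that, of u] by (metis unit_vec_carrier)
  then show "u = 0\<^sub>v (n + m)" using u(1) by (intro eq_vecI) auto
qed

text \<open>For \<open>A\<close> skew with respect to \<open>G0\<close> the matrix \<open>A G0\<^sup>-\<^sup>1\<close> is skew-symmetric, and for \<open>B\<close> skew with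
  respect to \<open>G1\<close> the matrix \<open>G1 B\<close> is symmetric; up to a factor
  \<open>2\<close> they are sums of skew-symmetrised and symmetrised matrices of rank one.\<close>

lemma E_spanned:
  assumes zero: "0\<^sub>m (n + m) (n + m) \<in> K"
    and add: "\<And>X Y. X \<in> K \<Longrightarrow> Y \<in> K \<Longrightarrow> X + Y \<in> K"
    and scale: "\<And>c X. X \<in> K \<Longrightarrow> c \<cdot>\<^sub>m X \<in> K"
    and anti: "\<And>x y. \<phi> x * \<phi> y + \<phi> y * \<phi> x \<in> K"
  shows "E \<subseteq> K"
proof
  note spans = blocks_in_span[OF zero add scale anti]
  fix X assume X: "X \<in> E"
  then have "X \<in> sa_even (gl_super n m)" by (simp add: E_iff_transpose)
  then obtain A B where AB: "A \<in> carrier_mat n n" "B \<in> carrier_mat m m" "X = even_mat n m A B"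
    by (rule gl_even_cases)
  have A: "A\<^sup>T * G0 + G0 * A = 0\<^sub>m n n" and B: "B\<^sup>T * G1 + G1 * B = 0\<^sub>m m m"
    using X AB by (simp_all add: even_mat_in_E_iff)
  have "even_mat n m A (0\<^sub>m m m) \<in> K"
  proof -
    let ?A = "A * H0"
    have cA: "?A \<in> carrier_mat n n" using AB H0 by simp
    have AG: "?A * G0 = A" using AB H0 G0(1) by (simp add: assoc_mult_mat[of _ n n _ n _ n])
    have "?A\<^sup>T + ?A = H0 * (A\<^sup>T * G0 + G0 * A) * H0"
    proof -
      have "H0 * (A\<^sup>T * G0 + G0 * A) * H0 = H0 * (A\<^sup>T * (G0 * H0)) + (H0 * G0) * (A * H0)"
        using AB(1) H0(1) G0(1)
        by (simp add: mult_add_distrib_mat[of _ n n _ n] add_mult_distrib_mat[of _ n n _ _ n]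
            assoc_mult_mat[of _ n n _ n _ n])
      also have "\<dots> = H0 * A\<^sup>T + A * H0" using AB(1) H0 by simp
      also have "H0 * A\<^sup>T = ?A\<^sup>T" using transpose_mult[OF AB(1) H0(1)] H0_sym by simp
      finally show ?thesis by simp
    qed
    then have 0: "?A\<^sup>T + ?A = 0\<^sub>m n n" using A H0 by simp
    have "2 \<cdot>\<^sub>m ?A \<in> {Z \<in> carrier_mat n n. even_mat n m (Z * G0) (0\<^sub>m m m) \<in> K}"
    proof (rule sum_of_symmetrized_rank1[OF cA, where \<eta> = "- 1"])
      fix i j assume "i < n" "j < n"
      then have "?A $$ (j, i) + ?A $$ (i, j) = 0"
        using arg_cong[OF 0, of "\<lambda>Z. Z $$ (i, j)"] AB(1) H0(1) by (simp del: index_mult_mat(1))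
      then show "?A $$ (j, i) = - 1 * ?A $$ (i, j)"
        by (simp add: eq_neg_iff_add_eq_0 del: index_mult_mat(1))
    next
      show "X + Y \<in> {Z \<in> carrier_mat n n. even_mat n m (Z * G0) (0\<^sub>m m m) \<in> K}"
        if "X \<in> {Z \<in> carrier_mat n n. even_mat n m (Z * G0) (0\<^sub>m m m) \<in> K}"
          "Y \<in> {Z \<in> carrier_mat n n. even_mat n m (Z * G0) (0\<^sub>m m m) \<in> K}" for X Y
        using that add[of "even_mat n m (X * G0) (0\<^sub>m m m)" "even_mat n m (Y * G0) (0\<^sub>m m m)"] G0(1)
        by (simp add: even_mat_add add_mult_distrib_mat[of _ n n _ _ n] mult_carrier_mat[of _ n n _ n])
    qed (use zero spans(2) G0(1) in \<open>auto simp: even_mat_0\<close>)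
    then have "(1 / 2) \<cdot>\<^sub>m even_mat n m ((2 \<cdot>\<^sub>m ?A) * G0) (0\<^sub>m m m) \<in> K" using scale by blast
    also have "(2 \<cdot>\<^sub>m ?A) * G0 = 2 \<cdot>\<^sub>m A"
      using AG mult_smult_assoc_mat[OF cA G0(1)] by simp
    also have "(1 / 2) \<cdot>\<^sub>m even_mat n m (2 \<cdot>\<^sub>m A) (0\<^sub>m m m) = even_mat n m A (0\<^sub>m m m)"
      using AB(1) char_not_2 by (intro eq_matI) (auto simp: even_mat_def)
    finally show ?thesis .
  qed
  moreover have "even_mat n m (0\<^sub>m n n) B \<in> K"
  proof -
    let ?B = "G1 * B"
    have cB: "?B \<in> carrier_mat m m" using AB G1 by simp
    have CB: "C * ?B = B"
      using AB(2) C G1(1) assoc_mult_mat[of C m m G1 m B m] by simp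
    have "?B\<^sup>T = B\<^sup>T * - G1" using transpose_mult[OF G1(1) AB(2)] G1(2) by simp
    also have "\<dots> = - (B\<^sup>T * G1)" using AB(2) G1(1) by simp
    finally have BT: "?B\<^sup>T = - (B\<^sup>T * G1)" .
    have "2 \<cdot>\<^sub>m ?B \<in> {Z \<in> carrier_mat m m. even_mat n m (0\<^sub>m n n) (C * Z) \<in> K}"
    proof (rule sum_of_symmetrized_rank1[OF cB, where \<eta> = 1])
      fix i j assume ij: "i < m" "j < m"
      then have "(B\<^sup>T * G1) $$ (i, j) + ?B $$ (i, j) = 0"
        using arg_cong[OF B, of "\<lambda>Z. Z $$ (i, j)"] AB(2) G1(1) by (simp del: index_mult_mat(1))
      moreover have "?B $$ (j, i) = - (B\<^sup>T * G1) $$ (i, j)"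
        using arg_cong[OF BT, of "\<lambda>Z. Z $$ (i, j)"] AB(2) G1(1) ij by (simp del: index_mult_mat(1))
      ultimately show "?B $$ (j, i) = 1 * ?B $$ (i, j)"
        by (simp add: add_eq_0_iff del: index_mult_mat(1))
    next
      show "X + Y \<in> {Z \<in> carrier_mat m m. even_mat n m (0\<^sub>m n n) (C * Z) \<in> K}"
        if "X \<in> {Z \<in> carrier_mat m m. even_mat n m (0\<^sub>m n n) (C * Z) \<in> K}"
          "Y \<in> {Z \<in> carrier_mat m m. even_mat n m (0\<^sub>m n n) (C * Z) \<in> K}" for X Y
        using that add[of "even_mat n m (0\<^sub>m n n) (C * X)" "even_mat n m (0\<^sub>m n n) (C * Y)"] C(1)
        by (simp add: even_mat_add mult_add_distrib_mat[of _ m m _ m] mult_carrier_mat[of _ m m _ m])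
    qed (use zero spans(1) C(1) in \<open>auto simp: even_mat_0\<close>)
    then have "(1 / 2) \<cdot>\<^sub>m even_mat n m (0\<^sub>m n n) (C * (2 \<cdot>\<^sub>m ?B)) \<in> K" using scale by blast
    also have "C * (2 \<cdot>\<^sub>m ?B) = 2 \<cdot>\<^sub>m B"
      using CB mult_smult_distrib[OF C(1) cB] by simp
    also have "(1 / 2) \<cdot>\<^sub>m even_mat n m (0\<^sub>m n n) (2 \<cdot>\<^sub>m B) = even_mat n m (0\<^sub>m n n) B"
      using AB(2) char_not_2 by (intro eq_matI) (auto simp: even_mat_def)
    finally show ?thesis .
  qed
  ultimately have "even_mat n m A (0\<^sub>m m m) + even_mat n m (0\<^sub>m n n) B \<in> K" by (rule add)
  then show "X \<in> K" using AB by (simp add: even_mat_add)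
qed

lemma range_\<phi>: "range \<phi> = sa_odd (osp_super n m b)"
proof (intro subset_antisym subsetI)
  fix X :: "'f mat" assume X: "X \<in> sa_odd (osp_super n m b)"
  then have "X \<in> sa_odd (gl_super n m)" by (simp add: osp_super_def)
  then obtain R R' where R: "R \<in> carrier_mat n m" "R' \<in> carrier_mat m n" "X = odd_mat n m R R'"
    by (rule gl_odd_cases)
  then have R': "R' = C * R\<^sup>T * G0" using X by (simp add: odd_mat_in_osp_iff)
  obtain t where "P t = R" using P_bij R(1) by (metis bij_betw_def imageE)
  then have "\<phi> t = X" using R(3) R' Q_eq by (simp add: \<phi>_def)
  then show "X \<in> range \<phi>" by blast
next
  fix X assume "X \<in> range \<phi>"
  then show "X \<in> sa_odd (osp_super n m b)"
    using odd_mat_in_osp_iff[OF PQ_carrier] by (auto simp: \<phi>_def Q_eq)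
qed

sublocale matrix_model scale p n m \<phi> E
proof
  show "E \<subseteq> sa_even (gl_super n m)" by (auto simp: E_iff_transpose)
  have cases: "\<exists>A B. A \<in> carrier_mat n n \<and> B \<in> carrier_mat m m \<and> X = even_mat n m A B" if "X \<in> E" for X
  proof -
    have "X \<in> sa_even (gl_super n m)" using that by (simp add: E_iff_transpose)
    then show ?thesis by (rule gl_even_cases) blast
  qed
  note distribs = transpose_add[of _ "n + m" "n + m"] add_mult_distrib_mat[of _ "n + m" "n + m" _ _ "n + m"]
    mult_add_distrib_mat[of _ "n + m" "n + m" _ "n + m"]
  show "0\<^sub>m (n + m) (n + m) \<in> E"
    using G_carrier by (simp add: E_iff_transpose gl_even_iff zero_transpose_mat)
  show "X + Y \<in> E" if "X \<in> E" "Y \<in> E" for X Y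
  proof -
    have XY: "X \<in> carrier_mat (n + m) (n + m)" "Y \<in> carrier_mat (n + m) (n + m)"
      using that by (auto simp: E_iff_transpose gl_even_iff)
    have "(X + Y)\<^sup>T * G + G * (X + Y) = (X\<^sup>T * G + G * X) + (Y\<^sup>T * G + G * Y)"
      using XY G_carrier by (simp add: distribs) (intro eq_matI; simp del: index_mult_mat(1))
    then show ?thesis using that by (auto simp: E_iff_transpose gl_even_iff)
  qed
  show "c \<cdot>\<^sub>m X \<in> E" if "X \<in> E" for c X
  proof -
    have X: "X \<in> carrier_mat (n + m) (n + m)"
      using that by (auto simp: E_iff_transpose gl_even_iff)
    have "(c \<cdot>\<^sub>m X)\<^sup>T = c \<cdot>\<^sub>m X\<^sup>T" by (intro eq_matI) auto
    then have "(c \<cdot>\<^sub>m X)\<^sup>T * G + G * (c \<cdot>\<^sub>m X) = c \<cdot>\<^sub>m (X\<^sup>T * G + G * X)"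
      using X G_carrier
      by (simp add: mult_smult_assoc_mat[of _ "n + m" "n + m" _ "n + m"]
          mult_smult_distrib[of _ "n + m" "n + m" _ "n + m"])
        (intro eq_matI; simp add: algebra_simps del: index_mult_mat(1))
    then show ?thesis using that by (auto simp: E_iff_transpose gl_even_iff)
  qed
  show "inj \<phi>"
  proof (rule injI)
    fix s t assume "\<phi> s = \<phi> t"
    then have "P s = P t" by (simp add: \<phi>_def odd_mat_eq_iff)
    then show "s = t" using P_bij by (simp add: bij_betw_def inj_eq)
  qed
  show "\<phi> x * \<phi> y + \<phi> y * \<phi> x \<in> E" for x y
  proof -
    have "(P s * Q t)\<^sup>T * G0 = - (G0 * (P t * Q s))" for s t
    proof -
      have "(P s * Q t)\<^sup>T * G0 = (Q t)\<^sup>T * ((P s)\<^sup>T * G0)"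
        using G0(1) transpose_mult[OF PQ_carrier] by (simp add: assoc_mult_mat[of _ n m _ n _ n])
      also have "\<dots> = ((Q t)\<^sup>T * G1) * Q s"
        unfolding PQ_adjoint(1) using G1(1) by (simp add: assoc_mult_mat[of _ n m _ m _ n])
      also have "\<dots> = - (G0 * P t * Q s)"
        unfolding PQ_adjoint(2) using G0(1) by simp
      finally show ?thesis using G0(1) by (simp add: assoc_mult_mat[of _ n n _ m _ n])
    qed
    moreover have "(Q s * P t)\<^sup>T * G1 = - (G1 * (Q t * P s))" for s t
    proof -
      have "(Q s * P t)\<^sup>T * G1 = (P t)\<^sup>T * ((Q s)\<^sup>T * G1)"
        using G1(1) transpose_mult[OF PQ_carrier(2,1)] by (simp add: assoc_mult_mat[of _ m n _ m _ m])
      also have "\<dots> = - ((P t)\<^sup>T * G0 * P s)"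
        unfolding PQ_adjoint(2) using G0(1)
        by (simp add: assoc_mult_mat[of _ m n _ n _ m] mult_carrier_mat[of _ n n _ m])
      also have "\<dots> = - (G1 * Q t * P s)"
        unfolding PQ_adjoint(1) by simp
      finally show ?thesis using G1(1) by (simp add: assoc_mult_mat[of _ m m _ n _ m])
    qed
    ultimately show ?thesis
      unfolding \<phi>_anticommutator_eq using G0(1) G1(1)
      by (simp add: even_mat_in_E_iff transpose_add[of _ n n] transpose_add[of _ m m]
          add_mult_distrib_mat[of _ n n _ _ n] add_mult_distrib_mat[of _ m m _ _ m]
          mult_add_distrib_mat[of _ n n _ n] mult_add_distrib_mat[of _ m m _ m]
          del: transpose_mult)
        (intro conjI eq_matI; simp del: index_mult_mat(1))
  qed
  show "X * \<phi> t - \<phi> t * X \<in> range \<phi>" if "X \<in> E" for X t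
  proof -
    obtain A B where AB: "A \<in> carrier_mat n n" "B \<in> carrier_mat m m" "X = even_mat n m A B"
      using cases[OF \<open>X \<in> E\<close>] by blast
    note mults = mult_carrier_mat[of _ n n _ m] mult_carrier_mat[of _ m m _ n]
      mult_carrier_mat[of _ n m _ m] mult_carrier_mat[of _ m n _ n]
    let ?R = "A * P t - P t * B" and ?R' = "B * Q t - Q t * A"
    have R: "?R \<in> carrier_mat n m" "?R' \<in> carrier_mat m n"
      using AB(1,2) by (simp_all add: minus_carrier_mat mults)
    have 0: "A\<^sup>T * G0 + G0 * A = 0\<^sub>m n n" "B\<^sup>T * G1 + G1 * B = 0\<^sub>m m m"
      using \<open>X \<in> E\<close> AB by (simp_all add: even_mat_in_E_iff)
    have neg: "Y = - Z" if "Y + Z = 0\<^sub>m k k" "Y \<in> carrier_mat k k" "Z \<in> carrier_mat k k" for Y Z :: "'f mat" and k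
    proof (rule eq_matI)
      fix i j assume "i < dim_row (- Z)" "j < dim_col (- Z)"
      then show "Y $$ (i, j) = (- Z) $$ (i, j)"
        using arg_cong[OF that(1), of "\<lambda>Z. Z $$ (i, j)"] that(2,3) by (simp add: eq_neg_iff_add_eq_0)
    qed (use that in auto)
    have A: "A\<^sup>T * G0 = - (G0 * A)" and B: "B\<^sup>T * G1 = - (G1 * B)"
      using neg[OF 0(1)] neg[OF 0(2)] AB G0(1) G1(1) by auto
    have "?R\<^sup>T * G0 = (P t)\<^sup>T * (A\<^sup>T * G0) - B\<^sup>T * ((P t)\<^sup>T * G0)"
    proof -
      have "?R\<^sup>T = (A * P t)\<^sup>T - (P t * B)\<^sup>T"
        using AB(1,2) by (intro transpose_minus[of _ n m]) (simp_all add: mults)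
      also have "\<dots> = (P t)\<^sup>T * A\<^sup>T - B\<^sup>T * (P t)\<^sup>T"
        using transpose_mult[OF AB(1) PQ_carrier(1)] transpose_mult[OF PQ_carrier(1) AB(2)] by simp
      finally show ?thesis
        using AB(1,2) G0(1) by (simp add: minus_mult_distrib_mat[of _ m n _ _ n] mults
            assoc_mult_mat[of _ m n _ n _ n] assoc_mult_mat[of _ m m _ n _ n])
    qed
    also have "(P t)\<^sup>T * (A\<^sup>T * G0) = - (G1 * Q t * A)"
      unfolding A PQ_adjoint(1)[symmetric] using AB(1) G0(1)
      by (simp add: assoc_mult_mat[of _ m n _ n _ n])
    also have "B\<^sup>T * ((P t)\<^sup>T * G0) = B\<^sup>T * G1 * Q t"
      unfolding PQ_adjoint(1) using AB(2) G1(1) by (simp add: assoc_mult_mat[of _ m m _ m _ n])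
    also have "\<dots> = - (G1 * B * Q t)"
      unfolding B using AB(2) G1(1) by simp
    finally have "?R\<^sup>T * G0 = G1 * B * Q t - G1 * Q t * A"
      using AB(1,2) G1(1) by (intro eq_matI) (auto simp del: index_mult_mat(1))
    also have "\<dots> = G1 * ?R'"
      using AB(1,2) G1(1) by (simp add: mult_minus_distrib_mat[of _ m m _ n] mults
          assoc_mult_mat[of _ m m _ m _ n] assoc_mult_mat[of _ m m _ n _ n])
    finally have "?R' = C * ?R\<^sup>T * G0" using adjoint_iff[OF R] by simp
    then show ?thesis
      unfolding range_\<phi> AB(3) commutator_\<phi>[OF AB(1,2)] odd_mat_in_osp_iff[OF R] .
  qed
  show "\<phi> t \<in> sa_odd (gl_super n m)" for t by (rule \<phi>_props)
  show "\<phi> (s + t) = \<phi> s + \<phi> t" for s t by (rule \<phi>_props)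
  show "\<phi> (scale c t) = c \<cdot>\<^sub>m \<phi> t" for c t by (rule \<phi>_props)
  show "\<phi> (S_op p x y z) = (\<phi> x * \<phi> y + \<phi> y * \<phi> x) * \<phi> z - \<phi> z * (\<phi> x * \<phi> y + \<phi> y * \<phi> x)" for x y z
    by (rule \<phi>_props)
qed (rule E_spanned)

text \<open>The action on the odd part is faithful: an even matrix in the kernel is scalar, and a scalar that is skew with
  respect to \<open>G0\<close> is zero.\<close>

theorem Lss_isomorphic_osp: "superalgebra_isomorphic L (osp_super n m b)"
proof -
  have "osp_super n m b = M"
    unfolding M_def range_\<phi> unfolding E_def osp_super_def by simp
  moreover have "superalgebra_isomorphic L M"
  proof (rule Lss_isomorphic_if_faithful)
    fix X :: "'f mat" assume X: "X \<in> E" "\<And>t. X * \<phi> t = \<phi> t * X"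
    then have "X \<in> sa_even (gl_super n m)" by (simp add: E_iff_transpose)
    then obtain c where c: "X = c \<cdot>\<^sub>m 1\<^sub>m (n + m)"
      using commuting_even_scalar[OF _ X(2)] P_bij by (metis bij_betw_def)
    then have "even_mat n m (c \<cdot>\<^sub>m 1\<^sub>m n) (c \<cdot>\<^sub>m 1\<^sub>m m) \<in> E" using X(1) by (simp add: even_mat_scalar)
    then have "(c \<cdot>\<^sub>m 1\<^sub>m n)\<^sup>T * G0 + G0 * (c \<cdot>\<^sub>m 1\<^sub>m n) = 0\<^sub>m n n"
      by (simp add: even_mat_in_E_iff)
    moreover have "(c \<cdot>\<^sub>m 1\<^sub>m n)\<^sup>T = c \<cdot>\<^sub>m 1\<^sub>m n" by (intro eq_matI) auto
    ultimately have "c \<cdot>\<^sub>m G0 + c \<cdot>\<^sub>m G0 = 0\<^sub>m n n"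
      using G0(1) by (simp add: mult_smult_distrib[of _ n n _ n] mult_smult_assoc_mat[of _ n n _ n])
    then have "(c \<cdot>\<^sub>m G0 + c \<cdot>\<^sub>m G0) * H0 = 0\<^sub>m n n" using H0 by simp
    then have "c \<cdot>\<^sub>m 1\<^sub>m n + c \<cdot>\<^sub>m 1\<^sub>m n = (0\<^sub>m n n :: 'f mat)"
      using G0(1) H0 by (simp add: add_mult_distrib_mat[of _ n n _ _ n] mult_smult_assoc_mat[of _ n n _ n])
    from arg_cong[OF this, of "\<lambda>Z. Z $$ (0, 0)"] have "2 * c = 0" using nm_pos by simp
    then have "c = 0" using char_not_2 by simp
    then show "X = 0\<^sub>m (n + m) (n + m)" unfolding c by (intro eq_matI) auto
  qed
  ultimately show ?thesis by simp
qed

end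

section \<open>Passing to coordinates\<close>

text \<open>Linearity is only asked for on a subspace, since \<open>eA\<close> and \<open>eT\<close> are not types of their own.\<close>

definition linear_on :: "('f \<Rightarrow> 'v \<Rightarrow> 'v) \<Rightarrow> ('f \<Rightarrow> 'w \<Rightarrow> 'w) \<Rightarrow> 'v::ab_group_add set \<Rightarrow> ('v \<Rightarrow> 'w::ab_group_add) \<Rightarrow> bool" where
  "linear_on s s' V f \<longleftrightarrow> (\<forall>u\<in>V. \<forall>v\<in>V. f (u + v) = f u + f v) \<and> (\<forall>c. \<forall>v\<in>V. f (s c v) = s' c (f v))"

lemma linear_onD:
  assumes "linear_on s s' V f"
  shows "u \<in> V \<Longrightarrow> v \<in> V \<Longrightarrow> f (u + v) = f u + f v" "v \<in> V \<Longrightarrow> f (s c v) = s' c (f v)"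
  using assms by (auto simp: linear_on_def)

text \<open>A basis \<open>e\<close> of \<open>V\<close> together with its coordinate functionals \<open>c\<close>.\<close>

locale coordinates = vector_space s
  for s :: "'f::field \<Rightarrow> 'v::ab_group_add \<Rightarrow> 'v" +
  fixes V :: "'v set" and k :: nat and e :: "nat \<Rightarrow> 'v" and c :: "nat \<Rightarrow> 'v \<Rightarrow> 'f"
  assumes V: "subspace V"
    and e_in: "i < k \<Longrightarrow> e i \<in> V"
    and c_linear: "i < k \<Longrightarrow> linear_on s (*) V (c i)"
    and c_e: "i < k \<Longrightarrow> j < k \<Longrightarrow> c i (e j) = (if i = j then 1 else 0)"
    and expand: "v \<in> V \<Longrightarrow> v = (\<Sum>i<k. s (c i v) (e i))"
begin

lemma sum_in: fixes r :: nat shows "(\<And>i. i < r \<Longrightarrow> w i \<in> V) \<Longrightarrow> (\<Sum>i<r. s (a i) (w i)) \<in> V"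
  using V by (intro subspace_sum) (auto intro: subspace_scale)

lemma linear_on_sum:
  fixes r :: nat
  assumes f: "linear_on s s' V f" and s': "vector_space s'" and w: "\<And>i. i < r \<Longrightarrow> w i \<in> V"
  shows "f (\<Sum>i<r. s (a i) (w i)) = (\<Sum>i<r. s' (a i) (f (w i)))"
  using w
proof (induction r)
  case 0
  interpret s': vector_space s' by fact
  have "f (s 0 0) = s' 0 (f 0)" using linear_onD(2)[OF f] subspace_0[OF V] by blast
  then show ?case by simp
next
  case (Suc r)
  have "(\<Sum>i<r. s (a i) (w i)) \<in> V" using Suc.prems by (intro sum_in) auto
  moreover have "s (a r) (w r) \<in> V" using Suc.prems V by (simp add: subspace_scale)
  ultimately show ?case using Suc linear_onD[OF f] by simp
qed

lemma functional_expand: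
  assumes "linear_on s (*) V F" "v \<in> V"
  shows "F v = (\<Sum>i<k. c i v * F (e i))"
proof -
  have "vector_space ((*) :: 'f \<Rightarrow> 'f \<Rightarrow> 'f)" by unfold_locales (auto simp: algebra_simps)
  from linear_on_sum[OF assms(1) this, where r = k and w = e and a = "\<lambda>i. c i v", OF e_in] show ?thesis
    using expand[OF assms(2)] by simp
qed

text \<open>With \<open>F i\<close> the \<open>i\<close>-th coordinate of an outer map and \<open>w j\<close> the image of the \<open>j\<close>-th basis vector under
  an inner map, the right-hand side is the matrix of their composition.\<close>

lemma mat_mult_composition:
  assumes F: "\<And>i. i < a \<Longrightarrow> linear_on s (*) V (F i)" and w: "\<And>j. j < r \<Longrightarrow> w j \<in> V"
  shows "mat a k (\<lambda>(i, l). F i (e l)) * mat k r (\<lambda>(l, j). c l (w j)) = mat a r (\<lambda>(i, j). F i (w j))"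
  by (intro eq_matI)
    (auto simp: scalar_prod_def atLeast0LessThan functional_expand[OF F w] mult.commute)

lemma coordinates_eq: "u \<in> V \<Longrightarrow> v \<in> V \<Longrightarrow> (\<And>i. i < k \<Longrightarrow> c i u = c i v) \<Longrightarrow> u = v"
  using expand[of u] expand[of v] by simp

lemma c_sum: "i < k \<Longrightarrow> c i (\<Sum>j<k. s (a j) (e j)) = a i"
proof -
  assume i: "i < k"
  have "vector_space ((*) :: 'f \<Rightarrow> 'f \<Rightarrow> 'f)" by unfold_locales (auto simp: algebra_simps)
  from linear_on_sum[OF c_linear[OF i] this, where r = k and w = e and a = a, OF e_in]
  have "c i (\<Sum>j<k. s (a j) (e j)) = (\<Sum>j<k. a j * c i (e j))" by simp
  also have "\<dots> = (\<Sum>j<k. if j = i then a j else 0)" using i by (intro sum.cong) (auto simp: c_e)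
  finally show ?thesis using i by simp
qed

text \<open>A vector in the kernel of the Gram matrix consists of the coordinates of a vector in the radical of the
  form.\<close>

lemma gram_invertible:
  assumes lin: "\<And>u. u \<in> V \<Longrightarrow> linear_on s (*) V (\<beta> u)"
    and sym: "\<And>u v. u \<in> V \<Longrightarrow> v \<in> V \<Longrightarrow> \<beta> u v = \<eta> * \<beta> v u"
    and nondeg: "\<And>u. u \<in> V \<Longrightarrow> (\<And>v. v \<in> V \<Longrightarrow> \<beta> u v = 0) \<Longrightarrow> u = 0"
  obtains H where "H \<in> carrier_mat k k" "mat k k (\<lambda>(i, j). \<beta> (e i) (e j)) * H = 1\<^sub>m k"
    "H * mat k k (\<lambda>(i, j). \<beta> (e i) (e j)) = 1\<^sub>m k"
proof -
  let ?G = "mat k k (\<lambda>(i, j). \<beta> (e i) (e j))"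
  have G: "?G \<in> carrier_mat k k" by simp
  have "det ?G \<noteq> 0"
  proof
    assume "det ?G = 0"
    then obtain a where a: "a \<in> carrier_vec k" "a \<noteq> 0\<^sub>v k" "?G *\<^sub>v a = 0\<^sub>v k"
      using det_0_iff_vec_prod_zero_field[OF G] by blast
    define w where "w = (\<Sum>j<k. s (a $ j) (e j))"
    have w: "w \<in> V" unfolding w_def by (intro sum_in e_in)
    have ca: "c j w = a $ j" if "j < k" for j unfolding w_def using that by (rule c_sum)
    have "\<beta> (e i) w = 0" if i: "i < k" for i
    proof -
      have "\<beta> (e i) w = (\<Sum>j<k. \<beta> (e i) (e j) * a $ j)"
        using functional_expand[OF lin[OF e_in[OF i]] w] ca by (simp add: mult.commute)
      also have "\<dots> = (?G *\<^sub>v a) $ i" using i a(1) by (simp add: scalar_prod_def atLeast0LessThan)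
      finally show ?thesis using a(3) i by simp
    qed
    then have "\<beta> w (e i) = 0" if "i < k" for i using sym[OF w e_in[OF that]] that by simp
    then have "\<beta> w v = 0" if "v \<in> V" for v using functional_expand[OF lin[OF w] that] by simp
    then have "w = 0" using nondeg[OF w] by blast
    moreover have "c j 0 = 0" if "j < k" for j
      using linear_onD(2)[OF c_linear[OF that], of 0 0] subspace_0[OF V] by simp
    ultimately have "a = 0\<^sub>v k" using ca a(1) by (intro eq_vecI) auto
    then show False using a(2) by simp
  qed
  then have "?G \<in> Units (ring_mat TYPE('f) k ())" by (rule det_non_zero_imp_unit[OF G])
  then show ?thesis using that by (auto simp: Units_def ring_mat_def)
qed

end

lemma coordinates_exist:
  assumes "finite_dim s" "module.subspace s V"
  obtains k e c where "coordinates s V k e c"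
proof -
  obtain B0 where "finite_dimensional_vector_space s B0" using assms(1) by (auto simp: finite_dim_def)
  then interpret finite_dimensional_vector_space s B0 .
  obtain B where B: "B \<subseteq> V" "independent B" "V \<subseteq> span B" "card B = dim V"
    by (rule basis_exists)
  have VB: "V = span B" using B(3) span_minimal[OF B(1) assms(2)] by (rule equalityI)
  have "finite B" using B(2) by (rule finiteI_independent)
  then obtain e where e: "bij_betw e {..<card B} B"
    using ex_bij_betw_nat_finite[of B] atLeast0LessThan by metis
  have "coordinates s V (card B) e (\<lambda>i v. representation B v (e i))"
  proof
    show "subspace V" by fact
    show "e i \<in> V" if "i < card B" for i
      using bij_betwE[OF e] that B(1) by blast
    show "linear_on s (*) V (\<lambda>v. representation B v (e i))" if "i < card B" for i
      unfolding linear_on_def VB using representation_add[OF B(2)] representation_scale[OF B(2)] by simp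
    show "representation B (e j) (e i) = (if i = j then 1 else 0)" if "i < card B" "j < card B" for i j
    proof -
      have "e j \<in> B" using bij_betwE[OF e] that by blast
      moreover have "e i = e j \<longleftrightarrow> i = j"
        using inj_on_eq_iff[OF bij_betw_imp_inj_on[OF e]] that by simp
      ultimately show ?thesis by (simp add: representation_basis[OF B(2)])
    qed
    show "v = (\<Sum>i<card B. s (representation B v (e i)) (e i))" if "v \<in> V" for v
    proof -
      have "v = (\<Sum>b\<in>B. s (representation B v b) b)"
        using sum_representation_eq[OF B(2) _ \<open>finite B\<close> order_refl, of v] that VB by simp
      also have "\<dots> = (\<Sum>i<card B. s (representation B v (e i)) (e i))"
        using sum.reindex_bij_betw[OF e, of "\<lambda>b. s (representation B v b) b"] by simp
      finally show ?thesis .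
    qed
  qed
  then show ?thesis by (rule that)
qed

text \<open>An action of \<open>T\<close> by odd operators on the superspace with parts \<open>X\<close> and \<open>Y\<close>, such that
  triple supercommutators of these operators give back the operators \<open>S(x,y)\<close>.\<close>

locale odd_action = J_ternary scale p
  + X: coordinates sx X n ex cx + Y: coordinates sy Y m ey cy
  for scale :: "'f::field \<Rightarrow> 't::ab_group_add \<Rightarrow> 't" and p :: "'t \<Rightarrow> 't \<Rightarrow> 't \<Rightarrow> 't"
    and sx :: "'f \<Rightarrow> 'x::ab_group_add \<Rightarrow> 'x" and X n ex cx
    and sy :: "'f \<Rightarrow> 'y::ab_group_add \<Rightarrow> 'y" and Y m ey cy +
  fixes f :: "'t \<Rightarrow> 'y \<Rightarrow> 'x" and g :: "'t \<Rightarrow> 'x \<Rightarrow> 'y"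
  assumes nonzero: "\<exists>u\<in>X. u \<noteq> 0" "\<exists>v\<in>Y. v \<noteq> 0"
    and f_in: "v \<in> Y \<Longrightarrow> f t v \<in> X" and g_in: "u \<in> X \<Longrightarrow> g t u \<in> Y"
    and f_linear: "linear_on sy sx Y (f t)" and g_linear: "linear_on sx sy X (g t)"
    and f_linear': "v \<in> Y \<Longrightarrow> linear_on scale sx UNIV (\<lambda>t. f t v)"
    and g_linear': "u \<in> X \<Longrightarrow> linear_on scale sy UNIV (\<lambda>t. g t u)"
    and f_S: "v \<in> Y \<Longrightarrow> f (S_op p x y z) v
      = f x (g y (f z v)) + f y (g x (f z v)) - f z (g x (f y v)) - f z (g y (f x v))"
    and g_S: "u \<in> X \<Longrightarrow> g (S_op p x y z) u
      = g x (f y (g z u)) + g y (f x (g z u)) - g z (f x (g y u)) - g z (f y (g x u))"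
    and faithful: "(\<And>v. v \<in> Y \<Longrightarrow> f t v = 0) \<Longrightarrow> (\<And>u. u \<in> X \<Longrightarrow> g t u = 0) \<Longrightarrow> t = 0"
begin

definition P :: "'t \<Rightarrow> 'f mat" where "P t = mat n m (\<lambda>(i, j). cx i (f t (ey j)))"
definition Q :: "'t \<Rightarrow> 'f mat" where "Q t = mat m n (\<lambda>(i, j). cy i (g t (ex j)))"

lemma c_diff: "u \<in> X \<Longrightarrow> u' \<in> X \<Longrightarrow> i < n \<Longrightarrow> cx i (u - u') = cx i u - cx i u'"
  "v \<in> Y \<Longrightarrow> v' \<in> Y \<Longrightarrow> j < m \<Longrightarrow> cy j (v - v') = cy j v - cy j v'"
proof -
  assume "u \<in> X" "u' \<in> X" "i < n"
  then show "cx i (u - u') = cx i u - cx i u'"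
    using linear_onD(1)[OF X.c_linear, of i "u - u'" u'] X.subspace_diff[OF X.V] by simp
next
  assume "v \<in> Y" "v' \<in> Y" "j < m"
  then show "cy j (v - v') = cy j v - cy j v'"
    using linear_onD(1)[OF Y.c_linear, of j "v - v'" v'] Y.subspace_diff[OF Y.V] by simp
qed

lemma c_f_linear: "i < n \<Longrightarrow> linear_on sy (*) Y (\<lambda>v. cx i (f t v))"
  using X.c_linear[of i] f_linear[of t] f_in by (simp add: linear_on_def)

lemma c_g_linear: "i < m \<Longrightarrow> linear_on sx (*) X (\<lambda>u. cy i (g t u))"
  using Y.c_linear[of i] g_linear[of t] g_in by (simp add: linear_on_def)

lemma PQ_products:
  "P x * Q y = mat n n (\<lambda>(i, j). cx i (f x (g y (ex j))))"
  "Q x * P y = mat m m (\<lambda>(i, j). cy i (g x (f y (ey j))))"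
  unfolding P_def Q_def
  by (rule Y.mat_mult_composition X.mat_mult_composition;
      simp add: c_f_linear c_g_linear f_in g_in X.e_in Y.e_in)+

lemma PQP_products:
  "P x * Q y * P z = mat n m (\<lambda>(i, j). cx i (f x (g y (f z (ey j)))))"
  "P x * (Q y * P z) = mat n m (\<lambda>(i, j). cx i (f x (g y (f z (ey j)))))"
  "Q x * P y * Q z = mat m n (\<lambda>(i, j). cy i (g x (f y (g z (ex j)))))"
  "Q x * (P y * Q z) = mat m n (\<lambda>(i, j). cy i (g x (f y (g z (ex j)))))"
proof -
  have fg: "i < n \<Longrightarrow> linear_on sx (*) X (\<lambda>u. cx i (f x (g y u)))"
    "i < m \<Longrightarrow> linear_on sy (*) Y (\<lambda>v. cy i (g x (f y v)))" for i x y
    using X.c_linear[of i] Y.c_linear[of i] f_linear g_linear f_in g_in by (simp_all add: linear_on_def)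
  show "P x * Q y * P z = mat n m (\<lambda>(i, j). cx i (f x (g y (f z (ey j)))))"
    unfolding PQ_products P_def[of z]
    by (rule X.mat_mult_composition) (simp_all add: fg f_in Y.e_in)
  show "Q x * P y * Q z = mat m n (\<lambda>(i, j). cy i (g x (f y (g z (ex j)))))"
    unfolding PQ_products Q_def[of z]
    by (rule Y.mat_mult_composition) (simp_all add: fg g_in X.e_in)
  show "P x * (Q y * P z) = mat n m (\<lambda>(i, j). cx i (f x (g y (f z (ey j)))))"
    unfolding PQ_products P_def[of x]
    by (rule Y.mat_mult_composition) (simp_all add: c_f_linear f_in g_in Y.e_in)
  show "Q x * (P y * Q z) = mat m n (\<lambda>(i, j). cy i (g x (f y (g z (ex j)))))"
    unfolding PQ_products Q_def[of x]
    by (rule X.mat_mult_composition) (simp_all add: c_g_linear f_in g_in X.e_in)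
qed

sublocale block_model scale p n m P Q
proof
  show "n > 0"
  proof (rule ccontr)
    assume "\<not> n > 0"
    then have "v = 0" if "v \<in> X" for v using X.expand[OF that] by simp
    then show False using nonzero(1) by blast
  qed
  show "m > 0"
  proof (rule ccontr)
    assume "\<not> m > 0"
    then have "v = 0" if "v \<in> Y" for v using Y.expand[OF that] by simp
    then show False using nonzero(2) by blast
  qed
  show "P t \<in> carrier_mat n m" "Q t \<in> carrier_mat m n" for t by (simp_all add: P_def Q_def)
  have fa: "f (s + t) (ey j) = f s (ey j) + f t (ey j)" "f (scale c t) (ey j) = sx c (f t (ey j))" if "j < m" for s t c j
    using linear_onD[OF f_linear'[OF Y.e_in[OF that]]] by simp_all
  have ga: "g (s + t) (ex j) = g s (ex j) + g t (ex j)" "g (scale c t) (ex j) = sy c (g t (ex j))" if "j < n" for s t c j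
    using linear_onD[OF g_linear'[OF X.e_in[OF that]]] by simp_all
  have fX: "f t (ey j) \<in> X" if "j < m" for t j using f_in Y.e_in that by simp
  have gY: "g t (ex j) \<in> Y" if "j < n" for t j using g_in X.e_in that by simp
  show "P (s + t) = P s + P t" "P (scale c t) = c \<cdot>\<^sub>m P t" for s t c
    by (intro eq_matI; auto simp: P_def fa fX linear_onD[OF X.c_linear])+
  show "Q (s + t) = Q s + Q t" "Q (scale c t) = c \<cdot>\<^sub>m Q t" for s t c
    by (intro eq_matI; auto simp: Q_def ga gY linear_onD[OF Y.c_linear])+
  show "P (S_op p x y z) = (P x * Q y + P y * Q x) * P z - P z * (Q x * P y + Q y * P x)" for x y z
  proof -
    have [simp]: "P x \<in> carrier_mat n m" "Q x \<in> carrier_mat m n" for x by (simp_all add: P_def Q_def)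
    have "(P x * Q y + P y * Q x) * P z - P z * (Q x * P y + Q y * P x)
      = P x * Q y * P z + P y * Q x * P z - (P z * (Q x * P y) + P z * (Q y * P x))"
      by (simp add: add_mult_distrib_mat[of _ n n _ _ m] mult_add_distrib_mat[of _ n m _ m]
          mult_carrier_mat[of _ n m _ n] mult_carrier_mat[of _ m n _ m])
    also have "\<dots> = P (S_op p x y z)"
      unfolding PQP_products
      by (intro eq_matI) (auto simp: P_def f_S c_diff f_in g_in Y.e_in linear_onD(1)[OF X.c_linear]
        X.subspace_add[OF X.V] X.subspace_diff[OF X.V])
    finally show ?thesis by simp
  qed
  show "Q (S_op p x y z) = (Q x * P y + Q y * P x) * Q z - Q z * (P x * Q y + P y * Q x)" for x y z
  proof -
    have [simp]: "P x \<in> carrier_mat n m" "Q x \<in> carrier_mat m n" for x by (simp_all add: P_def Q_def)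
    have "(Q x * P y + Q y * P x) * Q z - Q z * (P x * Q y + P y * Q x)
      = Q x * P y * Q z + Q y * P x * Q z - (Q z * (P x * Q y) + Q z * (P y * Q x))"
      by (simp add: add_mult_distrib_mat[of _ m m _ _ n] mult_add_distrib_mat[of _ m n _ n]
          mult_carrier_mat[of _ n m _ n] mult_carrier_mat[of _ m n _ m])
    also have "\<dots> = Q (S_op p x y z)"
      unfolding PQP_products
      by (intro eq_matI) (auto simp: Q_def g_S c_diff f_in g_in X.e_in linear_onD(1)[OF Y.c_linear]
        Y.subspace_add[OF Y.V] Y.subspace_diff[OF Y.V])
    finally show ?thesis by simp
  qed
qed

lemma f_eqI:
  assumes "linear_on sy sx Y f'" "\<And>j. j < m \<Longrightarrow> f t (ey j) = f' (ey j)" "v \<in> Y"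
  shows "f t v = f' v"
proof -
  have *: "F v = (\<Sum>j<m. sx (cy j v) (F (ey j)))" if "linear_on sy sx Y F" for F
    using Y.linear_on_sum[OF that X.vector_space_axioms, where r = m and w = ey and a = "\<lambda>i. cy i v", OF Y.e_in]
      Y.expand[OF assms(3)] by simp
  show ?thesis using *[OF assms(1)] *[OF f_linear, of t] assms(2) by simp
qed

lemma g_eqI:
  assumes "linear_on sx sy X g'" "\<And>j. j < n \<Longrightarrow> g t (ex j) = g' (ex j)" "u \<in> X"
  shows "g t u = g' u"
proof -
  have *: "F u = (\<Sum>j<n. sy (cx j u) (F (ex j)))" if "linear_on sx sy X F" for F
    using X.linear_on_sum[OF that Y.vector_space_axioms, where r = n and w = ex and a = "\<lambda>i. cx i u", OF X.e_in]
      X.expand[OF assms(3)] by simp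
  show ?thesis using *[OF assms(1)] *[OF g_linear, of t] assms(2) by simp
qed

lemma PQ_inj:
  assumes P: "P s = P t" and Q: "Q s = Q t"
  shows "s = t"
proof -
  have "f s (ey j) = f t (ey j)" if "j < m" for j
  proof (rule X.coordinates_eq)
    fix i assume "i < n"
    then show "cx i (f s (ey j)) = cx i (f t (ey j))"
      using arg_cong[OF P, of "\<lambda>Z. Z $$ (i, j)"] that by (simp add: P_def)
  qed (use that f_in Y.e_in in auto)
  then have fs: "f s v = f t v" if "v \<in> Y" for v using f_eqI[OF f_linear _ that] by blast
  have "g s (ex j) = g t (ex j)" if "j < n" for j
  proof (rule Y.coordinates_eq)
    fix i assume "i < m"
    then show "cy i (g s (ex j)) = cy i (g t (ex j))"
      using arg_cong[OF Q, of "\<lambda>Z. Z $$ (i, j)"] that by (simp add: Q_def)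
  qed (use that g_in X.e_in in auto)
  then have gs: "g s u = g t u" if "u \<in> X" for u using g_eqI[OF g_linear _ that] by blast
  have "f (s - t) v = 0" if "v \<in> Y" for v
    using linear_onD(1)[OF f_linear'[OF that], of "s - t" t] fs[OF that] by simp
  moreover have "g (s - t) u = 0" if "u \<in> X" for u
    using linear_onD(1)[OF g_linear'[OF that], of "s - t" t] gs[OF that] by simp
  ultimately have "s - t = 0" by (intro faithful)
  then show ?thesis by simp
qed

text \<open>The linear maps with prescribed matrices.\<close>

definition map_YX :: "'f mat \<Rightarrow> 'y \<Rightarrow> 'x" where
  "map_YX A v = (\<Sum>i<n. sx (\<Sum>j<m. A $$ (i, j) * cy j v) (ex i))"

definition map_XY :: "'f mat \<Rightarrow> 'x \<Rightarrow> 'y" where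
  "map_XY B u = (\<Sum>i<m. sy (\<Sum>j<n. B $$ (i, j) * cx j u) (ey i))"

lemma map_YX: "v \<in> Y \<Longrightarrow> map_YX A v \<in> X" "linear_on sy sx Y (map_YX A)"
  "i < n \<Longrightarrow> j < m \<Longrightarrow> cx i (map_YX A (ey j)) = A $$ (i, j)"
proof -
  show "map_YX A v \<in> X" unfolding map_YX_def by (intro X.sum_in X.e_in)
  have "(\<Sum>j<m. A $$ (i, j) * cy j (u + v)) = (\<Sum>j<m. A $$ (i, j) * cy j u) + (\<Sum>j<m. A $$ (i, j) * cy j v)"
    if "u \<in> Y" "v \<in> Y" for u v i
    using that by (simp add: linear_onD(1)[OF Y.c_linear] ring_distribs sum.distrib)
  moreover have "(\<Sum>j<m. A $$ (i, j) * cy j (sy c v)) = c * (\<Sum>j<m. A $$ (i, j) * cy j v)"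
    if "v \<in> Y" for c v i
    using that by (simp add: linear_onD(2)[OF Y.c_linear] sum_distrib_left mult.left_commute)
  ultimately show "linear_on sy sx Y (map_YX A)"
    by (simp add: linear_on_def map_YX_def X.scale_left_distrib sum.distrib X.scale_sum_right)
  assume ij: "i < n" "j < m"
  have "(\<Sum>l<m. A $$ (i, l) * cy l (ey j)) = (\<Sum>l<m. if l = j then A $$ (i, l) else 0)"
    using ij by (intro sum.cong) (auto simp: Y.c_e)
  then show "cx i (map_YX A (ey j)) = A $$ (i, j)"
    using ij unfolding map_YX_def by (simp add: X.c_sum)
qed

lemma map_XY: "u \<in> X \<Longrightarrow> map_XY B u \<in> Y" "linear_on sx sy X (map_XY B)"
  "i < m \<Longrightarrow> j < n \<Longrightarrow> cy i (map_XY B (ex j)) = B $$ (i, j)"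
proof -
  show "map_XY B u \<in> Y" unfolding map_XY_def by (intro Y.sum_in Y.e_in)
  have "(\<Sum>j<n. B $$ (i, j) * cx j (u + v)) = (\<Sum>j<n. B $$ (i, j) * cx j u) + (\<Sum>j<n. B $$ (i, j) * cx j v)"
    if "u \<in> X" "v \<in> X" for u v i
    using that by (simp add: linear_onD(1)[OF X.c_linear] ring_distribs sum.distrib)
  moreover have "(\<Sum>j<n. B $$ (i, j) * cx j (sx c v)) = c * (\<Sum>j<n. B $$ (i, j) * cx j v)"
    if "v \<in> X" for c v i
    using that by (simp add: linear_onD(2)[OF X.c_linear] sum_distrib_left mult.left_commute)
  ultimately show "linear_on sx sy X (map_XY B)"
    by (simp add: linear_on_def map_XY_def Y.scale_left_distrib sum.distrib Y.scale_sum_right)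
  assume ij: "i < m" "j < n"
  have "(\<Sum>l<n. B $$ (i, l) * cx l (ex j)) = (\<Sum>l<n. if l = j then B $$ (i, l) else 0)"
    using ij by (intro sum.cong) (auto simp: X.c_e)
  then show "cy i (map_XY B (ex j)) = B $$ (i, j)"
    using ij unfolding map_XY_def by (simp add: Y.c_sum)
qed

lemma P_eqI: "A \<in> carrier_mat n m \<Longrightarrow> (\<And>v. v \<in> Y \<Longrightarrow> f t v = map_YX A v) \<Longrightarrow> P t = A"
  by (intro eq_matI) (auto simp: P_def map_YX(3) Y.e_in)

lemma Q_eqI: "B \<in> carrier_mat m n \<Longrightarrow> (\<And>u. u \<in> X \<Longrightarrow> g t u = map_XY B u) \<Longrightarrow> Q t = B"
  by (intro eq_matI) (auto simp: Q_def map_XY(3) X.e_in)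

theorem Lss_isomorphic_psl_if_full:
  assumes full: "\<And>f' g'. linear_on sy sx Y f' \<Longrightarrow> f' ` Y \<subseteq> X \<Longrightarrow> linear_on sx sy X g' \<Longrightarrow> g' ` X \<subseteq> Y \<Longrightarrow>
    \<exists>t. (\<forall>v\<in>Y. f t v = f' v) \<and> (\<forall>u\<in>X. g t u = g' u)"
  shows "superalgebra_isomorphic L (psl_super n m)"
proof -
  interpret sl_model scale p n m P Q
  proof
    show "\<exists>t. P t = A \<and> Q t = B" if AB: "A \<in> carrier_mat n m" "B \<in> carrier_mat m n" for A B
    proof -
      obtain t where "\<forall>v\<in>Y. f t v = map_YX A v" "\<forall>u\<in>X. g t u = map_XY B u"
        using full[of "map_YX A" "map_XY B"] map_YX map_XY by blast
      then show ?thesis using P_eqI[OF AB(1)] Q_eqI[OF AB(2)] by blast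
    qed
  qed (rule PQ_inj)
  show ?thesis by (rule Lss_isomorphic_psl)
qed

text \<open>With invariant forms on both parts each of the two off-diagonal blocks determines the other one,
  so it suffices that one of them is arbitrary.\<close>

theorem Lss_isomorphic_osp_if_full:
  fixes \<beta>X :: "'x \<Rightarrow> 'x \<Rightarrow> 'f" and \<beta>Y :: "'y \<Rightarrow> 'y \<Rightarrow> 'f"
  assumes char: "(2::'f) \<noteq> 0"
    and linX: "\<And>u. u \<in> X \<Longrightarrow> linear_on sx (*) X (\<beta>X u)" and linY: "\<And>v. v \<in> Y \<Longrightarrow> linear_on sy (*) Y (\<beta>Y v)"
    and sym: "\<And>u u'. u \<in> X \<Longrightarrow> u' \<in> X \<Longrightarrow> \<beta>X u u' = \<beta>X u' u"
    and skew: "\<And>v v'. v \<in> Y \<Longrightarrow> v' \<in> Y \<Longrightarrow> \<beta>Y v v' = - \<beta>Y v' v"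
    and nondegX: "\<And>u. u \<in> X \<Longrightarrow> (\<And>u'. u' \<in> X \<Longrightarrow> \<beta>X u u' = 0) \<Longrightarrow> u = 0"
    and nondegY: "\<And>v. v \<in> Y \<Longrightarrow> (\<And>v'. v' \<in> Y \<Longrightarrow> \<beta>Y v v' = 0) \<Longrightarrow> v = 0"
    and adjoint: "\<And>t u v. u \<in> X \<Longrightarrow> v \<in> Y \<Longrightarrow> \<beta>Y (g t u) v + \<beta>X u (f t v) = 0"
    and full: "(\<forall>f'. linear_on sy sx Y f' \<longrightarrow> f' ` Y \<subseteq> X \<longrightarrow> (\<exists>t. \<forall>v\<in>Y. f t v = f' v)) \<or>
      (\<forall>g'. linear_on sx sy X g' \<longrightarrow> g' ` X \<subseteq> Y \<longrightarrow> (\<exists>t. \<forall>u\<in>X. g t u = g' u))"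
  shows "\<exists>b. even m \<and> supersymmetric_form n m b \<and> nondegenerate_super_form n m b \<and>
    superalgebra_isomorphic L (osp_super n m b)"
proof -
  let ?G0 = "mat n n (\<lambda>(i, j). \<beta>X (ex i) (ex j))" and ?G1 = "mat m m (\<lambda>(i, j). \<beta>Y (ey i) (ey j))"
  obtain H0 where H0: "H0 \<in> carrier_mat n n" "?G0 * H0 = 1\<^sub>m n" "H0 * ?G0 = 1\<^sub>m n"
    by (rule X.gram_invertible[where \<beta> = \<beta>X and \<eta> = 1]) (use linX sym nondegX in auto)
  obtain C where C: "C \<in> carrier_mat m m" "?G1 * C = 1\<^sub>m m" "C * ?G1 = 1\<^sub>m m"
  proof (rule Y.gram_invertible[where \<beta> = \<beta>Y and \<eta> = "- 1"])
    show "\<beta>Y u v = - 1 * \<beta>Y v u" if "u \<in> Y" "v \<in> Y" for u v using skew[OF that] by simp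
  qed (use linY nondegY in auto)
  have G0T: "?G0\<^sup>T = ?G0"
    by (intro eq_matI) (auto simp: sym X.e_in)
  have G1T: "?G1\<^sup>T = - ?G1"
  proof (rule eq_matI)
    fix i j assume "i < dim_row (- ?G1)" "j < dim_col (- ?G1)"
    then show "?G1\<^sup>T $$ (i, j) = (- ?G1) $$ (i, j)"
      using skew[of "ey j" "ey i"] by (simp add: Y.e_in)
  qed auto
  have adj: "?G1 * Q t = (P t)\<^sup>T * ?G0" for t
  proof (rule eq_matI)
    fix j i assume "j < dim_row ((P t)\<^sup>T * ?G0)" "i < dim_col ((P t)\<^sup>T * ?G0)"
    then have ij: "i < n" "j < m" by simp_all
    have gi: "g t (ex i) \<in> Y" and fj: "f t (ey j) \<in> X" using ij g_in f_in X.e_in Y.e_in by auto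
    have "(?G1 * Q t) $$ (j, i) = (\<Sum>k<m. cy k (g t (ex i)) * \<beta>Y (ey j) (ey k))"
      using ij by (simp add: Q_def scalar_prod_def atLeast0LessThan mult.commute)
    also have "\<dots> = \<beta>Y (ey j) (g t (ex i))"
      using Y.functional_expand[OF linY[OF Y.e_in[OF ij(2)]] gi] by simp
    also have "\<dots> = - \<beta>Y (g t (ex i)) (ey j)"
      by (rule skew[OF Y.e_in[OF ij(2)] gi])
    also have "\<dots> = \<beta>X (ex i) (f t (ey j))"
      using adjoint[OF X.e_in[OF ij(1)] Y.e_in[OF ij(2)], of t] by (simp add: minus_unique)
    also have "\<dots> = (\<Sum>k<n. cx k (f t (ey j)) * \<beta>X (ex i) (ex k))"
      using X.functional_expand[OF linX[OF X.e_in[OF ij(1)]] fj] by simp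
    also have "\<dots> = (\<Sum>k<n. cx k (f t (ey j)) * \<beta>X (ex k) (ex i))"
      using ij by (intro sum.cong refl) (simp add: sym[of "ex i"] X.e_in)
    also have "\<dots> = ((P t)\<^sup>T * ?G0) $$ (j, i)"
      using ij by (simp add: P_def scalar_prod_def atLeast0LessThan)
    finally show "(?G1 * Q t) $$ (j, i) = ((P t)\<^sup>T * ?G0) $$ (j, i)" .
  qed simp_all
  have Q_eq: "Q t = C * (P t)\<^sup>T * ?G0" for t
  proof -
    have "C * (P t)\<^sup>T * ?G0 = C * (?G1 * Q t)"
      unfolding adj using C(1) by (simp add: assoc_mult_mat[of _ m m _ n _ n])
    also have "\<dots> = (C * ?G1) * Q t"
      using C(1) by (simp add: assoc_mult_mat[of _ m m _ m _ n])
    finally show ?thesis using C(3) by simp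
  qed
  have onto: "\<exists>t. P t = R" if R: "R \<in> carrier_mat n m" for R
    using full
  proof
    assume "\<forall>f'. linear_on sy sx Y f' \<longrightarrow> f' ` Y \<subseteq> X \<longrightarrow> (\<exists>t. \<forall>v\<in>Y. f t v = f' v)"
    then obtain t where "\<forall>v\<in>Y. f t v = map_YX R v" using map_YX by blast
    then show ?thesis using P_eqI[OF R] by blast
  next
    let ?R = "C * R\<^sup>T * ?G0"
    have cR: "?R \<in> carrier_mat m n"
      using C(1) R by (simp add: mult_carrier_mat[of _ m m _ n] mult_carrier_mat[of _ m n _ n])
    assume "\<forall>g'. linear_on sx sy X g' \<longrightarrow> g' ` X \<subseteq> Y \<longrightarrow> (\<exists>t. \<forall>u\<in>X. g t u = g' u)"
    then obtain t where "\<forall>u\<in>X. g t u = map_XY ?R u" using map_XY by blast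
    then have "Q t = ?R" using Q_eqI[OF cR] by blast
    then have "?G1 * ?R * H0 = (P t)\<^sup>T * ?G0 * H0" using adj[of t] by simp
    moreover have "(P t)\<^sup>T * ?G0 * H0 = (P t)\<^sup>T"
      using H0 by (simp add: assoc_mult_mat[of _ m n _ n _ n])
    moreover have "?G1 * ?R * H0 = (?G1 * C) * R\<^sup>T * (?G0 * H0)"
      using C(1) H0(1) R
      by (simp add: assoc_mult_mat[of _ m m _ m _ n] assoc_mult_mat[of _ m m _ n _ n]
          assoc_mult_mat[of _ m n _ n _ n] mult_carrier_mat[of _ m n _ n] mult_carrier_mat[of _ m m _ n]
          mult_carrier_mat[of _ n n _ n])
    ultimately have "R\<^sup>T = (P t)\<^sup>T" using C H0 R by simp
    then have "P t = R" by (metis transpose_transpose)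
    then show ?thesis by blast
  qed
  interpret osp_model scale p n m P Q ?G0 H0 ?G1 C
  proof
    have "inj P" by (rule injI, rule PQ_inj) (simp_all add: Q_eq)
    moreover have "range P = carrier_mat n m" using onto by auto
    ultimately show "bij_betw P UNIV (carrier_mat n m)" by (simp add: bij_betw_def)
  qed (use char H0 C G0T G1T Q_eq in simp_all)
  show ?thesis using even_m supersymmetric_b nondegenerate_b Lss_isomorphic_osp by blast
qed

lemma swap: "odd_action scale p sy Y m ey cy sx X n ex cx g f"
  by (unfold_locales; (rule nonzero f_in g_in f_linear g_linear f_linear' g_linear' f_S g_S faithful; assumption)?)

end

section \<open>Idempotents of rank one\<close>

context assoc_algebra
begin

lemma scale_eq_mult: "scale c x = scale c 1 * x" "scale c x = x * scale c 1"
  by (simp_all flip: scale_mult_left scale_mult_right)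

text \<open>The unit of the corner \<open>e A e\<close> is \<open>e\<close>, so the constant \<open>c\<close> is evaluated to \<open>c e\<close>.\<close>

definition corner_eval :: "'a \<Rightarrow> 'a \<Rightarrow> 'f poly \<Rightarrow> 'a" where
  "corner_eval e x q = fold_coeffs (\<lambda>c y. scale c e + x * y) q 0"

lemma corner_eval_0: "corner_eval e x 0 = 0"
  by (simp add: corner_eval_def)

lemma corner_eval_pCons: "corner_eval e x (pCons c q) = scale c e + x * corner_eval e x q"
proof (cases "q = 0")
  case True
  then show ?thesis
    by (cases "c = 0") (simp_all add: corner_eval_def fold_coeffs_pCons_coeff_not_0_eq)
next
  case False
  then show ?thesis by (simp add: corner_eval_def fold_coeffs_pCons_not_0_0_eq)
qed

lemma corner_eval_add: "corner_eval e x (q + r) = corner_eval e x q + corner_eval e x r"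
  by (induction q r rule: poly_induct2)
    (simp_all add: corner_eval_0 corner_eval_pCons scale_left_distrib algebra_simps)

lemma corner_eval_smult: "corner_eval e x (smult c q) = scale c (corner_eval e x q)"
  by (induction q)
    (simp_all add: corner_eval_0 corner_eval_pCons scale_right_distrib scale_mult_right)

lemma corner_eval_diff: "corner_eval e x (q - r) = corner_eval e x q - corner_eval e x r"
  using corner_eval_add[of e x q "smult (- 1) r"] by (simp only: corner_eval_smult) simp

lemma corner_eval_sum: "corner_eval e x (\<Sum>i\<in>I. q i) = (\<Sum>i\<in>I. corner_eval e x (q i))"
  by (induction I rule: infinite_finite_induct) (simp_all add: corner_eval_0 corner_eval_add)

lemma corner_eval_monom: "corner_eval e x (monom c i) = scale c (x ^ i * e)"
  by (induction i)
    (simp_all add: corner_eval_0 corner_eval_pCons monom_0 monom_Suc mult.assoc flip: scale_mult_right)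

text \<open>The powers of \<open>x\<close> either repeat or are linearly dependent.\<close>

lemma annihilating_polynomial:
  assumes "finite_dim scale"
  obtains q where "q \<noteq> 0" "corner_eval e x q = 0"
proof -
  obtain Ba where "finite_dimensional_vector_space scale Ba" using assms by (auto simp: finite_dim_def)
  then interpret fd: finite_dimensional_vector_space scale Ba .
  let ?w = "\<lambda>i. x ^ i * e"
  show ?thesis
  proof (cases "inj ?w")
    case False
    then obtain i j where ij: "?w i = ?w j" "i \<noteq> j" by (auto simp: inj_def)
    let ?q = "monom 1 i + monom (- 1) j :: 'f poly"
    have "coeff ?q i \<noteq> 0" using ij(2) by simp
    then have "?q \<noteq> 0" by (metis coeff_0)
    moreover have "corner_eval e x ?q = 0" using ij(1) by (simp add: corner_eval_add corner_eval_monom)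
    ultimately show ?thesis by (rule that)
  next
    case True
    let ?W = "?w ` {..fd.dimension}"
    have "card ?W = Suc fd.dimension"
      using True by (simp add: card_image inj_on_subset)
    then have "dependent ?W"
      using fd.independent_card_le_dim[of ?W UNIV] by (auto simp: fd.dimension_def)
    then obtain u where u: "\<exists>v\<in>?W. u v \<noteq> 0" "(\<Sum>v\<in>?W. scale (u v) v) = 0"
      using dependent_finite[of ?W] by auto
    let ?q = "\<Sum>i\<le>fd.dimension. monom (u (?w i)) i"
    obtain i where i: "i \<le> fd.dimension" "u (?w i) \<noteq> 0" using u(1) by auto
    have "coeff ?q i = (\<Sum>j\<le>fd.dimension. if j = i then u (?w j) else 0)"
      by (simp add: coeff_sum)
    also have "\<dots> = u (?w i)" using i(1) by simp
    finally have "?q \<noteq> 0" using i(2) by (metis coeff_0)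
    moreover have "corner_eval e x ?q = 0"
      using u(2) True by (simp add: corner_eval_sum corner_eval_monom sum.reindex inj_on_subset)
    ultimately show ?thesis by (rule that)
  qed
qed

definition left_ideal :: "'a set \<Rightarrow> bool" where
  "left_ideal K \<longleftrightarrow> 0 \<in> K \<and> (\<forall>x\<in>K. \<forall>y\<in>K. x + y \<in> K) \<and> (\<forall>a. \<forall>x\<in>K. a * x \<in> K)"

lemma left_ideal_subspace: "left_ideal K \<Longrightarrow> subspace K"
  by (intro subspaceI) (auto simp: left_ideal_def, metis scale_eq_mult(1))

lemma two_sided_imp_left_ideal: "two_sided_ideal K \<Longrightarrow> left_ideal K"
  by (auto simp: left_ideal_def two_sided_ideal_def)

text \<open>Left ideals are subspaces, so a member of least dimension is minimal.\<close>

lemma minimal_member: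
  assumes "finite_dim scale" "\<And>K. K \<in> F \<Longrightarrow> left_ideal K" "K0 \<in> F"
  obtains K where "K \<in> F" "\<And>K'. K' \<in> F \<Longrightarrow> K' \<subseteq> K \<Longrightarrow> K' = K"
proof -
  obtain Ba where "finite_dimensional_vector_space scale Ba" using assms by (auto simp: finite_dim_def)
  then interpret fd: finite_dimensional_vector_space scale Ba .
  obtain K where K: "K \<in> F" "\<And>K'. K' \<in> F \<Longrightarrow> dim K \<le> dim K'"
    using ex_has_least_nat[of "\<lambda>K. K \<in> F" K0 dim] assms(3) by blast
  have "K' = K" if "K' \<in> F" "K' \<subseteq> K" for K'
    using fd.subspace_dim_equal[of K' K] K that assms(2) left_ideal_subspace by blast
  then show ?thesis using that K(1) by blast
qed

end

text \<open>Take a root \<open>c\<close> of an annihilating polynomial of least degree; if \<open>x - c e\<close> were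
  invertible, it could be cancelled.\<close>

lemma division_corner_scalar:
  fixes scale :: "'f::alg_closed_field \<Rightarrow> 'a::ring_1 \<Rightarrow> 'a"
  assumes "assoc_algebra scale" "finite_dim scale"
    and e: "e * e = e" "e \<noteq> 0" and x: "e * x = x" "x * e = x"
    and div: "\<And>y. e * y = y \<Longrightarrow> y * e = y \<Longrightarrow> y \<noteq> 0 \<Longrightarrow> \<exists>z. z * y = e"
  shows "\<exists>c. x = scale c e"
proof -
  interpret assoc_algebra scale by fact
  obtain q0 where q0: "q0 \<noteq> 0" "corner_eval e x q0 = 0"
    using annihilating_polynomial[OF assms(2)] by blast
  obtain q where q: "q \<noteq> 0" "corner_eval e x q = 0"
    and least: "\<And>r. r \<noteq> 0 \<Longrightarrow> corner_eval e x r = 0 \<Longrightarrow> degree q \<le> degree r"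
    using ex_has_least_nat[of "\<lambda>q. q \<noteq> 0 \<and> corner_eval e x q = 0" q0 degree] q0 by blast
  have "degree q > 0"
  proof (rule ccontr)
    assume "\<not> degree q > 0"
    then obtain c where c: "q = [:c:]" by (metis degree_eq_zeroE gr0I)
    then have "scale c e = 0" using q(2) by (simp add: corner_eval_pCons corner_eval_0)
    then show False using q(1) c e(2) by simp
  qed
  then obtain c where "poly q c = 0" using alg_closed_imp_poly_has_root by blast
  then obtain r where r: "q = [:- c, 1:] * r" by (metis dvdE poly_eq_0_iff_dvd)
  then have r0: "r \<noteq> 0" using q(1) by auto
  have deg: "degree q = Suc (degree r)" unfolding r using r0 by (subst degree_mult_eq) auto
  have ex: "e * corner_eval e x r = corner_eval e x r"
    by (induction r) (simp_all add: corner_eval_0 corner_eval_pCons distrib_left e(1) x(1)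
        flip: scale_mult_right mult.assoc)
  have ev: "corner_eval e x q = (x - scale c e) * corner_eval e x r"
    unfolding r by (simp add: corner_eval_diff corner_eval_smult corner_eval_pCons left_diff_distrib ex
        flip: scale_mult_left)
  have "x - scale c e = 0"
  proof (rule ccontr)
    assume "x - scale c e \<noteq> 0"
    moreover have "e * (x - scale c e) = x - scale c e" "(x - scale c e) * e = x - scale c e"
      using e(1) x by (simp_all add: right_diff_distrib left_diff_distrib flip: scale_mult_left scale_mult_right)
    ultimately obtain z where "z * (x - scale c e) = e" using div by blast
    then have "e * corner_eval e x r = z * corner_eval e x q" unfolding ev by (simp flip: mult.assoc)
    then have "corner_eval e x r = 0" using ex q(2) by simp
    then show False using least[OF r0] deg by simp
  qed
  then show ?thesis by auto
qed

text \<open>Brauer's lemma in a minimal two-sided ideal \<open>B\<close> with unit \<open>u\<close>. A minimal left ideal \<open>K\<close> in \<open>B\<close>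
  is not square-zero, because the annihilator of \<open>K\<close> is a two-sided ideal that does not contain \<open>u\<close>.
  Then \<open>K = K x\<close> for some \<open>x\<close> in \<open>K\<close>, and \<open>e\<close> is the solution of \<open>e x = x\<close>.\<close>

theorem rank_one_idempotent:
  fixes scale :: "'f::alg_closed_field \<Rightarrow> 'a::ring_1 \<Rightarrow> 'a"
  assumes alg: "assoc_algebra scale" and fin: "finite_dim scale"
    and B: "two_sided_ideal B" "u \<in> B" "u \<noteq> 0" "\<And>x. x \<in> B \<Longrightarrow> u * x = x"
    and minimal: "\<And>J. two_sided_ideal J \<Longrightarrow> J \<subseteq> B \<Longrightarrow> J = {0} \<or> J = B"
  obtains e where "e \<in> B" "e \<noteq> 0" "e * e = e" "\<And>a. \<exists>c. e * a * e = scale c e"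
proof -
  interpret assoc_algebra scale by fact
  let ?F = "{K. left_ideal K \<and> K \<subseteq> B \<and> K \<noteq> {0}}"
  have "B \<in> ?F" using B two_sided_imp_left_ideal by auto
  then obtain K where "K \<in> ?F" and min: "\<And>K'. K' \<in> ?F \<Longrightarrow> K' \<subseteq> K \<Longrightarrow> K' = K"
    using minimal_member[OF fin, of ?F B] by blast
  then have K: "left_ideal K" "K \<subseteq> B" "K \<noteq> {0}" by auto
  then have K_closed: "0 \<in> K" "\<And>x y. x \<in> K \<Longrightarrow> y \<in> K \<Longrightarrow> x + y \<in> K" "\<And>a x. x \<in> K \<Longrightarrow> a * x \<in> K"
    by (auto simp: left_ideal_def)
  have K_minus: "x - y \<in> K" if "x \<in> K" "y \<in> K" for x y
    using K_closed(2)[OF that(1) K_closed(3)[OF that(2), of "- 1"]] by simp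
  have min': "K' = K" if "left_ideal K'" "K' \<subseteq> K" "K' \<noteq> {0}" for K'
    using min[of K'] that K(2) by blast
  have "\<exists>x\<in>K. \<exists>y\<in>K. y * x \<noteq> 0"
  proof (rule ccontr)
    assume "\<not> ?thesis"
    then have KK: "y * x = 0" if "x \<in> K" "y \<in> K" for x y using that by blast
    let ?N = "{a \<in> B. \<forall>l\<in>K. a * l = 0}"
    have "two_sided_ideal ?N"
      using B(1) K_closed(3) by (auto simp: two_sided_ideal_def distrib_right mult.assoc)
    moreover have "K \<subseteq> ?N" using K(2) KK by blast
    moreover obtain k where "k \<in> K" "k \<noteq> 0" using K(3) K_closed(1) by blast
    ultimately have "?N = B" using minimal[of ?N] by blast
    then have "u * k = 0" using B(2) \<open>k \<in> K\<close> by blast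
    then show False using B(4)[of k] K(2) \<open>k \<in> K\<close> \<open>k \<noteq> 0\<close> by auto
  qed
  then obtain x y where xy: "x \<in> K" "y \<in> K" "y * x \<noteq> 0" by blast
  have "left_ideal ((\<lambda>l. l * x) ` K)"
    unfolding left_ideal_def
  proof (intro conjI ballI allI)
    show "0 \<in> (\<lambda>l. l * x) ` K" using K_closed(1) by force
    show "v + w \<in> (\<lambda>l. l * x) ` K" if "v \<in> (\<lambda>l. l * x) ` K" "w \<in> (\<lambda>l. l * x) ` K" for v w
      using that K_closed(2) by (force simp: distrib_right[symmetric])
    show "a * v \<in> (\<lambda>l. l * x) ` K" if "v \<in> (\<lambda>l. l * x) ` K" for a v
      using that K_closed(3) by (force simp: mult.assoc[symmetric])
  qed
  moreover have "(\<lambda>l. l * x) ` K \<subseteq> K" using K_closed(3) xy(1) by blast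
  moreover have "(\<lambda>l. l * x) ` K \<noteq> {0}" using xy by blast
  ultimately have "(\<lambda>l. l * x) ` K = K" by (rule min')
  then obtain e where e: "e \<in> K" "e * x = x" using xy(1) by (metis imageE)
  have "{l \<in> K. l * x = 0} = {0}"
  proof (rule ccontr)
    assume "{l \<in> K. l * x = 0} \<noteq> {0}"
    moreover have "left_ideal {l \<in> K. l * x = 0}"
      using K_closed by (auto simp: left_ideal_def distrib_right mult.assoc)
    ultimately have "{l \<in> K. l * x = 0} = K" using min'[of "{l \<in> K. l * x = 0}"] by blast
    then show False using xy by blast
  qed
  moreover have "e * e - e \<in> K" using K_minus K_closed(3) e(1) by blast
  moreover have "(e * e - e) * x = 0" using e(2) by (simp add: left_diff_distrib mult.assoc)
  ultimately have "e * e - e = 0" by blast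
  then have ee: "e * e = e" by simp
  have e0: "e \<noteq> 0" using e(2) xy(3) by auto
  have div: "\<exists>z. z * y = e" if y: "e * y = y" "y * e = y" "y \<noteq> 0" for y
  proof -
    have "y \<in> K" using K_closed(3)[OF e(1), of y] y(2) by simp
    have "left_ideal (range (\<lambda>a. a * y))"
      unfolding left_ideal_def
    proof (intro conjI ballI allI)
      show "0 \<in> range (\<lambda>a. a * y)" by (metis mult_zero_left rangeI)
      show "v + w \<in> range (\<lambda>a. a * y)" if "v \<in> range (\<lambda>a. a * y)" "w \<in> range (\<lambda>a. a * y)" for v w
        using that by (force simp: distrib_right[symmetric])
      show "a * v \<in> range (\<lambda>a. a * y)" if "v \<in> range (\<lambda>a. a * y)" for a v
        using that by (force simp: mult.assoc[symmetric])
    qed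
    moreover have "range (\<lambda>a. a * y) \<subseteq> K" using K_closed(3) \<open>y \<in> K\<close> by blast
    moreover have "range (\<lambda>a. a * y) \<noteq> {0}" using y(3) by (metis mult_1_left rangeI singletonD)
    ultimately have "range (\<lambda>a. a * y) = K" by (rule min')
    then show ?thesis using e(1) by (metis rangeE)
  qed
  have "\<exists>c. e * a * e = scale c e" for a
  proof (rule division_corner_scalar[OF alg fin ee e0])
    show "e * (e * a * e) = e * a * e" by (simp add: ee flip: mult.assoc)
    show "e * a * e * e = e * a * e" by (simp add: ee mult.assoc)
  qed (use div in blast)
  then show ?thesis using that e(1) K(2) e0 ee by blast
qed

text \<open>Since \<open>A e A\<close> is a nonzero ideal in \<open>B\<close>, it contains the unit of \<open>B\<close>.\<close>

lemma unit_in_generated_ideal: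
  fixes e :: "'a::ring_1"
  assumes B: "two_sided_ideal B" "u \<in> B" and e: "e \<in> B" "e \<noteq> 0"
    and minimal: "\<And>J. two_sided_ideal J \<Longrightarrow> J \<subseteq> B \<Longrightarrow> J = {0} \<or> J = B"
  obtains r :: nat and v w where "u = (\<Sum>i<r. v i * e * w i)"
proof -
  define J where "J = {x. \<exists>xs. x = sum_list (map (\<lambda>(v, w). v * e * w) xs)}"
  have J: "two_sided_ideal J"
    unfolding two_sided_ideal_def
  proof (intro conjI ballI allI)
    show "0 \<in> J" unfolding J_def by (auto intro: exI[of _ "[]"])
    show "x + y \<in> J" if xy: "x \<in> J" "y \<in> J" for x y
    proof -
      obtain xs ys where "x = sum_list (map (\<lambda>(v, w). v * e * w) xs)" "y = sum_list (map (\<lambda>(v, w). v * e * w) ys)"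
        using xy by (auto simp: J_def)
      then have "x + y = sum_list (map (\<lambda>(v, w). v * e * w) (xs @ ys))" by simp
      then show ?thesis unfolding J_def by blast
    qed
    fix x a assume "x \<in> J"
    then obtain xs where xs: "x = sum_list (map (\<lambda>(v, w). v * e * w) xs)" by (auto simp: J_def)
    have "a * x = sum_list (map (\<lambda>(v, w). v * e * w) (map (\<lambda>(v, w). (a * v, w)) xs))"
      unfolding xs by (induction xs) (auto simp: distrib_left mult.assoc)
    then show "a * x \<in> J" unfolding J_def by blast
    have "x * a = sum_list (map (\<lambda>(v, w). v * e * w) (map (\<lambda>(v, w). (v, w * a)) xs))"
      unfolding xs by (induction xs) (auto simp: distrib_right mult.assoc)
    then show "x * a \<in> J" unfolding J_def by blast
  qed
  have "e = sum_list (map (\<lambda>(v, w). v * e * w) [(1, 1)])" by simp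
  then have "e \<in> J" unfolding J_def by blast
  moreover have "J \<subseteq> B"
  proof
    fix x assume "x \<in> J"
    then obtain xs where xs: "x = sum_list (map (\<lambda>(v, w). v * e * w) xs)" by (auto simp: J_def)
    show "x \<in> B" unfolding xs by (induction xs) (use B(1) e(1) in \<open>auto simp: two_sided_ideal_def\<close>)
  qed
  ultimately have "J = B" using minimal[OF J] e(2) by blast
  then obtain xs where "u = sum_list (map (\<lambda>(v, w). v * e * w) xs)" using B(2) by (auto simp: J_def)
  also have "\<dots> = (\<Sum>i<length xs. fst (xs ! i) * e * snd (xs ! i))"
    by (simp add: sum_list_sum_nth atLeast0LessThan case_prod_unfold)
  finally show ?thesis by (rule that)
qed

section \<open>The odd action on \<open>e (A \<oplus> T)\<close>\<close>

text \<open>The two cases of the theorem in one setting: \<open>u\<close> is the unit of a minimal two-sided ideal, so it is either \<open>1\<close> or a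
  central idempotent with \<open>u\<^sup>* = 1 - u\<close>. The last assumption holds in both cases and makes
  \<open>(1 - u)T\<close> totally isotropic.\<close>

locale rank_one_module = skew_hermitian_module scaleA star scaleT act h
  for scaleA :: "'f::field \<Rightarrow> 'a::ring_1 \<Rightarrow> 'a" and star and scaleT :: "'f \<Rightarrow> 't::ab_group_add \<Rightarrow> 't"
    and act h +
  fixes u e :: 'a and r :: nat and v w :: "nat \<Rightarrow> 'a"
  assumes char3: "CHAR('f) = 3"
    and finite_dim: "finite_dim scaleA" "finite_dim scaleT"
    and nonzero: "\<exists>x::'t. x \<noteq> 0"
    and e: "e * e = e" "e \<noteq> 0" and rank_one: "\<exists>c. e * a * e = scaleA c e"
    and u_central: "u * a = a * u" and ue: "u * e = e"
    and u_sum: "u = (\<Sum>i<r. v i * e * w i)"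
    and isotropic: "(1 - u) * a * star (1 - u) = 0"
begin

definition V :: "'a set" where "V = {a. e * a = a}"
definition W :: "'t set" where "W = {x. act e x = x}"

lemma V_subspace: "subspace V"
  by (intro subspaceI) (auto simp: V_def distrib_left simp flip: scale_mult_right)

lemma W_subspace: "T.subspace W"
  by (intro T.subspaceI) (auto simp: W_def act_0 act_add act_scale)

lemma V_closed: "a \<in> V \<Longrightarrow> a * b \<in> V" "e * a \<in> V" "e \<in> V" "a \<in> V \<Longrightarrow> - a \<in> V"
  by (simp_all add: V_def e(1) flip: mult.assoc)

lemma W_closed: "act e x \<in> W" "a \<in> V \<Longrightarrow> act a x \<in> W"
  by (simp_all add: W_def V_def e(1) flip: act_mult)

lemma h_in_V: "x \<in> W \<Longrightarrow> h x y \<in> V"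
  by (simp add: W_def V_def flip: h_act(1))

lemma u_V: "a \<in> V \<Longrightarrow> u * a = a" "a \<in> V \<Longrightarrow> a * u = a"
proof -
  assume "a \<in> V"
  then show *: "u * a = a" using ue by (metis (mono_tags) V_def mem_Collect_eq mult.assoc)
  then show "a * u = a" using u_central by simp
qed

lemma u_W: "x \<in> W \<Longrightarrow> act u x = x"
  unfolding W_def by (metis (mono_tags) act_mult mem_Collect_eq ue)

lemma h_isotropic: "h (act (1 - u) x) (act (1 - u) y) = 0"
  using isotropic[of "h x y"] by (simp add: h_act mult.assoc)

lemma e_generates: "(\<And>b. act (e * b) x = 0) \<Longrightarrow> act u x = 0"
  by (simp add: u_sum act_sum act_mult act_0 mult.assoc)

text \<open>If \<open>eA\<close> kills \<open>x\<close>, then so does \<open>u\<close>, and \<open>x\<close> lies in the isotropic part \<open>(1 - u)T\<close>; if moreover \<open>h(eT, x) = 0\<close>,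
  then \<open>x\<close> is also orthogonal to \<open>uT\<close>.\<close>

lemma faithful_action:
  assumes "\<And>a. a \<in> V \<Longrightarrow> act a x = 0" "\<And>y. y \<in> W \<Longrightarrow> h y x = 0"
  shows "x = 0"
proof (rule h_nondegenerate(2))
  fix y
  have "act u x = 0" using assms(1) V_closed(2) e_generates by blast
  then have x: "x = act (1 - u) x" by (simp add: act_diff act_one)
  have "h (act u y) x = (\<Sum>i<r. v i * h (act (e * w i) y) x)"
    by (simp add: u_sum act_sum h_sum h_act mult.assoc)
  also have "\<dots> = 0" using assms(2)[OF W_closed(2)[OF V_closed(2)]] by simp
  finally have "h (act u y) x = 0" .
  moreover have "h (act (1 - u) y) x = 0" by (subst x) (rule h_isotropic)
  moreover have "y = act u y + act (1 - u) y" by (simp add: act_diff act_one)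
  ultimately show "h y x = 0" by (metis add.right_neutral h_add(1))
qed

lemma W_nonzero: "\<exists>x\<in>W. x \<noteq> 0"
proof (rule ccontr)
  assume "\<not> ?thesis"
  then have "act a x = 0" if "a \<in> V" for a x using W_closed(2)[OF that] by blast
  then have "act u x = 0" for x using V_closed(2) e_generates by blast
  then have x: "x = act (1 - u) x" for x by (simp add: act_diff act_one)
  have "h x y = 0" for x y using h_isotropic[of x y] x by metis
  then show False using nonzero h_nondegenerate(1) by blast
qed

text \<open>The operators \<open>\<phi>\<^sub>t(a, x) = (-h(x,t), a t)\<close> commute with left multiplications by \<open>A\<close>, hence preserve \<open>eA \<oplus> eT\<close>.
  Expanding their triple supercommutators gives the formula of \<open>S_hermitian\<close>.\<close>

lemma odd_action_VW:
  assumes "coordinates scaleA V n ex cx" "coordinates scaleT W m ey cy"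
  shows "odd_action scaleT p scaleA V n ex cx scaleT W m ey cy (\<lambda>t x. - h x t) (\<lambda>t a. act a t)"
proof -
  interpret X: coordinates scaleA V n ex cx by fact
  interpret Y: coordinates scaleT W m ey cy by fact
  show ?thesis
  proof
    show "\<exists>a\<in>V. a \<noteq> 0" using V_closed(3) e(2) by blast
    show "\<exists>x\<in>W. x \<noteq> 0" by (rule W_nonzero)
    show "- h x t \<in> V" if "x \<in> W" for x t using h_in_V[OF that] V_closed(4) by blast
    show "act a t \<in> W" if "a \<in> V" for a t using W_closed(2)[OF that] .
    show "linear_on scaleT scaleA W (\<lambda>x. - h x t)" "linear_on scaleA scaleT V (\<lambda>a. act a t)"
      "linear_on scaleT scaleA UNIV (\<lambda>t. - h x t)" "linear_on scaleT scaleT UNIV (\<lambda>t. act a t)" for a x t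
      by (simp_all add: linear_on_def h_add h_scale act_add act_scale)
    show "- h q (J.S x y z) = - h (act (- h q z) y) x + - h (act (- h q z) x) y - - h (act (- h q y) x) z
      - - h (act (- h q x) y) z" for q x y z
      by (simp add: S_hermitian[OF char3] h_diff h_act h_add h_minus act_minus star_add star_h algebra_simps)
    show "act a (J.S x y z) = act (- h (act a z) y) x + act (- h (act a z) x) y - act (- h (act a y) x) z
      - act (- h (act a x) y) z" for a x y z
      by (simp add: S_hermitian[OF char3] act_diff act_add act_minus h_act act_mult)
    show "t = 0" if "\<And>x. x \<in> W \<Longrightarrow> - h x t = 0" "\<And>a. a \<in> V \<Longrightarrow> act a t = 0" for t
      by (rule faithful_action) (use that in auto)
  qed
qed

text \<open>Take \<open>t = \<Sum> v\<^sub>i g(e w\<^sub>i)\<close> where \<open>u = \<Sum> v\<^sub>i e w\<^sub>i\<close>. For \<open>a\<close> in \<open>eA\<close> the element \<open>a v\<^sub>i e\<close> is a multiple of \<open>e\<close>,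
  so it passes through the linear map \<open>g\<close>, and \<open>a t = g(a u) = g(a)\<close>.\<close>

lemma action_full:
  assumes g: "linear_on scaleA scaleT V g" "g ` V \<subseteq> W"
  shows "\<exists>t. \<forall>a\<in>V. act a t = g a"
proof (intro exI ballI)
  fix a assume a: "a \<in> V"
  have "act (a * v i) (g (e * w i)) = g (a * v i * e * w i)" for i
  proof -
    obtain c where c: "e * (a * v i) * e = scaleA c e" using rank_one by blast
    then have c': "a * v i * e = scaleA c e" using a by (simp add: V_def flip: mult.assoc)
    have "act (a * v i) (g (e * w i)) = act (a * v i * e) (g (e * w i))"
      using g(2) V_closed(2)[of "w i"] by (auto simp: act_mult W_def)
    also have "\<dots> = scaleT c (g (e * w i))"
      using g(2) V_closed(2)[of "w i"] by (auto simp: c' act_scale W_def)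
    also have "\<dots> = g (scaleA c (e * w i))"
      using linear_onD(2)[OF g(1) V_closed(2)] by simp
    finally show ?thesis by (simp add: c' scale_mult_left)
  qed
  then have "act a (\<Sum>i<r. act (v i) (g (e * w i))) = (\<Sum>i<r. g (a * v i * e * w i))"
    by (simp add: act_sum flip: act_mult)
  also have "\<dots> = g (\<Sum>i<r. a * v i * e * w i)"
  proof -
    have "g (\<Sum>i<k. a * v i * e * w i) = (\<Sum>i<k. g (a * v i * e * w i))" for k
    proof (induction k)
      case 0
      then show ?case using linear_onD(2)[OF g(1) V_closed(3), of 0] by simp
    next
      case (Suc k)
      have "(\<Sum>i<k. a * v i * e * w i) \<in> V"
        using V_subspace by (intro subspace_sum) (auto simp: mult.assoc intro: V_closed(1)[OF a])
      moreover have "a * v k * e * w k \<in> V" by (simp add: mult.assoc V_closed(1)[OF a])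
      ultimately show ?case using Suc linear_onD(1)[OF g(1)] by simp
    qed
    then show ?thesis by simp
  qed
  also have "(\<Sum>i<r. a * v i * e * w i) = a * u"
    by (simp add: u_sum sum_distrib_left mult.assoc)
  finally show "act a (\<Sum>i<r. act (v i) (g (e * w i))) = g a" using u_V(2)[OF a] by simp
qed

definition \<kappa> :: "'a \<Rightarrow> 'f" where "\<kappa> a = (SOME c. e * a * e = scaleA c e)"

lemma \<kappa>: "e * a * e = scaleA (\<kappa> a) e"
  unfolding \<kappa>_def using rank_one by (rule someI_ex)

lemma \<kappa>_eqI: "e * a * e = scaleA c e \<Longrightarrow> \<kappa> a = c"
  using \<kappa>[of a] e(2) by simp

lemma \<kappa>_linear: "\<kappa> (a + b) = \<kappa> a + \<kappa> b" "\<kappa> (scaleA c a) = c * \<kappa> a"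
  by (rule \<kappa>_eqI, simp add: \<kappa> distrib_left distrib_right scale_left_distrib
    flip: scale_mult_left scale_mult_right)+

text \<open>The functionals on \<open>eT\<close> that come from \<open>x \<mapsto> h(x,y) e\<close> separate points once the radical of that
  pairing vanishes, and in finite dimension they then exhaust the dual space. The proof
  extends a given functional along the injection of \<open>eT\<close> into the functions on \<open>T\<close>.\<close>

lemma functional_represented:
  assumes nondeg: "\<And>x. x \<in> W \<Longrightarrow> (\<And>y. \<kappa> (h x y) = 0) \<Longrightarrow> x = 0"
    and l: "linear_on scaleT (*) W l"
  shows "\<exists>y. \<forall>x\<in>W. l x = \<kappa> (h x y)"
proof -
  let ?s = "\<lambda>c (F :: 't \<Rightarrow> 'f) y. c * F y"
  interpret Fun: vector_space ?s by unfold_locales (auto simp: fun_eq_iff algebra_simps)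
  interpret pair: vector_space_pair scaleT ?s by unfold_locales
  let ?j = "\<lambda>x y. \<kappa> (h x y)"
  have j: "Vector_Spaces.linear scaleT ?s ?j"
    unfolding Vector_Spaces.linear_iff using T.vector_space_axioms Fun.vector_space_axioms
    by (simp add: fun_eq_iff h_add h_scale \<kappa>_linear)
  have inj: "inj_on ?j W"
  proof (rule inj_onI)
    fix x x' assume x: "x \<in> W" "x' \<in> W" "?j x = ?j x'"
    have "x - x' \<in> W" using W_subspace x by (simp add: T.subspace_diff)
    moreover have "\<kappa> (h (x - x') y) = 0" for y
      using fun_cong[OF x(3), of y] \<kappa>_linear(1)[of "h (x - x') y" "h x' y"] by (simp add: h_diff)
    ultimately show "x = x'" using nondeg by force
  qed
  obtain g where g: "g ` UNIV \<subseteq> W" "Vector_Spaces.linear ?s scaleT g" "\<forall>x\<in>W. g (?j x) = x"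
    using pair.linear_exists_left_inverse_on[OF j W_subspace inj] by blast
  have lg: "linear_on ?s (*) UNIV (\<lambda>F. l (g F))"
    using g(1,2) linear_onD[OF l] unfolding linear_on_def Vector_Spaces.linear_iff by (simp add: image_subset_iff)
  obtain N t c where "coordinates scaleT UNIV N t c"
    using coordinates_exist[OF finite_dim(2) T.subspace_UNIV] by blast
  then interpret C: coordinates scaleT UNIV N t c .
  have "l x = \<kappa> (h x (\<Sum>i<N. scaleT (l (g (c i))) (t i)))" if x: "x \<in> W" for x
  proof -
    have "?j x y = (\<Sum>i<N. \<kappa> (h x (t i)) * c i y)" for y
    proof -
      have "linear_on scaleT (*) UNIV (\<lambda>y. \<kappa> (h x y))"
        by (simp add: linear_on_def h_add h_scale \<kappa>_linear)
      from C.functional_expand[OF this UNIV_I, of y] show ?thesis by (simp add: mult.commute)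
    qed
    then have jx: "?j x = (\<lambda>y. \<Sum>i<N. \<kappa> (h x (t i)) * c i y)" by (rule ext)
    have expand: "l (g (\<lambda>y. \<Sum>i<k. a i * c i y)) = (\<Sum>i<k. a i * l (g (c i)))" for a :: "nat \<Rightarrow> 'f" and k :: nat
    proof (induction k)
      case 0
      have "l (g (\<lambda>y. 0 * 0)) = 0 * l (g (\<lambda>y. 0))" using linear_onD(2)[OF lg UNIV_I, of 0 "\<lambda>y. 0"] by simp
      then show ?case by simp
    next
      case (Suc k)
      have "(\<lambda>y. \<Sum>i<Suc k. a i * c i y) = (\<lambda>y. \<Sum>i<k. a i * c i y) + ?s (a k) (c k)"
        by (simp add: fun_eq_iff)
      then show ?case using Suc linear_onD[OF lg UNIV_I] by simp
    qed
    have "l x = l (g (?j x))" using g(3) x by simp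
    also have "\<dots> = (\<Sum>i<N. \<kappa> (h x (t i)) * l (g (c i)))" unfolding jx by (rule expand)
    also have "\<dots> = \<kappa> (h x (\<Sum>i<N. scaleT (l (g (c i))) (t i)))"
    proof -
      have "linear_on scaleT (*) UNIV (\<lambda>y. \<kappa> (h x y))"
        by (simp add: linear_on_def h_add h_scale \<kappa>_linear)
      moreover have "vector_space ((*) :: 'f \<Rightarrow> 'f \<Rightarrow> 'f)" by unfold_locales (auto simp: algebra_simps)
      ultimately show ?thesis
        using C.linear_on_sum[of "(*)" "\<lambda>y. \<kappa> (h x y)" N t "\<lambda>i. l (g (c i))"] by (simp add: mult.commute)
    qed
    finally show ?thesis .
  qed
  then show ?thesis by blast
qed

text \<open>The exchange case \<open>A = uA \<oplus> u\<^sup>*A\<close>. Here \<open>T = uT \<oplus> u\<^sup>*T\<close> with both summands isotropic, and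
  the two halves of \<open>t\<close> control the two maps \<open>a \<mapsto> a t\<close> and \<open>x \<mapsto> h(x,t)\<close> independently.\<close>

lemma exchange_full:
  assumes star_u: "star u = 1 - u" and uu: "u * u = u"
    and g: "linear_on scaleA scaleT V g" "g ` V \<subseteq> W"
    and f: "linear_on scaleT scaleA W f" "f ` W \<subseteq> V"
  shows "\<exists>t. (\<forall>x\<in>W. - h x t = f x) \<and> (\<forall>a\<in>V. act a t = g a)"
proof -
  have star_u': "star (1 - u) = u" by (simp add: star_diff star_1 star_u)
  obtain t0 where t0: "\<forall>a\<in>V. act a t0 = g a" using action_full[OF g] by blast
  have nondeg: "x = 0" if x: "x \<in> W" and "\<And>y. \<kappa> (h x y) = 0" for x
  proof (rule h_nondegenerate(1))
    fix y
    have hV: "h x y \<in> V" for y using h_in_V[OF x] .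
    have he: "h x y * e = 0" for y
      using \<kappa>[of "h x y"] that(2)[of y] hV[of y] by (simp add: V_def)
    have "h x y * a * e = 0" for a
      using he[of "act (star a) y"] by (simp add: h_act star_star)
    then have "h x y * u = 0" by (simp add: u_sum sum_distrib_left flip: mult.assoc)
    then show "h x y = 0" using u_V(2)[OF hV] by simp
  qed
  have "\<exists>y. \<forall>x\<in>W. \<kappa> (f x * v i) = \<kappa> (h x y)" for i
    by (rule functional_represented[OF nondeg])
      (auto simp: linear_on_def linear_onD[OF f(1)] \<kappa>_linear distrib_right simp flip: scale_mult_left)
  then obtain y where y: "\<And>i x. x \<in> W \<Longrightarrow> \<kappa> (f x * v i) = \<kappa> (h x (y i))" by metis
  define t1 where "t1 = (\<Sum>i<r. act (star (e * w i)) (y i))"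
  have t1: "h x t1 = f x" if x: "x \<in> W" for x
  proof -
    have fx: "f x \<in> V" using f(2) x by blast
    have "f x = f x * u" using u_V(2)[OF fx] by simp
    also have "\<dots> = (\<Sum>i<r. (e * (f x * v i) * e) * w i)"
      using fx by (simp add: u_sum sum_distrib_left V_def flip: mult.assoc)
    also have "\<dots> = (\<Sum>i<r. (e * h x (y i) * e) * w i)"
      by (simp only: \<kappa> y[OF x])
    also have "\<dots> = (\<Sum>i<r. h x (y i) * (e * w i))"
      using h_in_V[OF x] by (simp add: V_def mult.assoc[symmetric])
    also have "\<dots> = h x t1" by (simp add: t1_def h_sum h_act star_star)
    finally show ?thesis by simp
  qed
  let ?t = "act u t0 - act (1 - u) t1"
  have "- h x ?t = f x" if x: "x \<in> W" for x
  proof -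
    have "f x \<in> V" using f(2) x by blast
    have "h x (act u t0) = u * h x t0 * (1 - u)"
      using u_W[OF x] by (metis h_act(1) h_act(2) star_u)
    also have "\<dots> = h x t0 * (u * (1 - u))" using u_central[of "h x t0"] by (simp add: mult.assoc)
    also have "\<dots> = 0" by (simp add: right_diff_distrib uu)
    finally have "h x (act u t0) = 0" .
    moreover have "h x (act (1 - u) t1) = f x"
      using t1[OF x] u_V(2)[OF \<open>f x \<in> V\<close>] by (simp add: h_act star_u')
    ultimately show ?thesis by (simp add: h_diff)
  qed
  moreover have "act a ?t = g a" if a: "a \<in> V" for a
  proof -
    have "a * (1 - u) = 0" using u_V(2)[OF a] by (simp add: right_diff_distrib)
    then have "act a (act (1 - u) t1) = 0" by (metis act_0(1) act_mult)
    moreover have "act a (act u t0) = g a" using u_V(2)[OF a] t0 a by (simp flip: act_mult)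
    ultimately show ?thesis by (simp add: act_diff)
  qed
  ultimately show ?thesis by blast
qed

theorem exchange_psl:
  assumes "star u = 1 - u" "u * u = u"
  shows "\<exists>n m. n > 0 \<and> m > 0 \<and> superalgebra_isomorphic J.L (psl_super n m)"
proof -
  obtain n ex cx where X: "coordinates scaleA V n ex cx"
    using coordinates_exist[OF finite_dim(1) V_subspace] .
  obtain m ey cy where Y: "coordinates scaleT W m ey cy"
    using coordinates_exist[OF finite_dim(2) W_subspace] .
  interpret odd_action scaleT p scaleA V n ex cx scaleT W m ey cy "\<lambda>t x. - h x t" "\<lambda>t a. act a t"
    by (rule odd_action_VW[OF X Y])
  have "superalgebra_isomorphic J.L (psl_super n m)"
    by (rule Lss_isomorphic_psl_if_full) (rule exchange_full[OF assms])
  then show ?thesis using nm_pos by blast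
qed

text \<open>When \<open>A\<close> is simple, \<open>e A e\<^sup>*\<close> is spanned by one element \<open>z\<close>, since \<open>a \<mapsto> a y\<close> maps it
  injectively into \<open>e A e\<close> for a suitable \<open>y\<close>. The involution acts on it by a sign, which
  decides which of \<open>eA\<close> and \<open>eT\<close> carries the symmetric form.\<close>

lemma twisted_corner:
  assumes "u = 1"
  obtains z l \<epsilon> where "z \<noteq> 0" "\<And>a. e * a * star e = scaleA (l a) z" "star z = scaleA \<epsilon> z" "\<epsilon> = 1 \<or> \<epsilon> = -1"
proof -
  have one: "1 = (\<Sum>i<r. v i * e * w i)" using u_sum assms by simp
  have one': "1 = (\<Sum>i<r. star (w i) * star e * star (v i))"
  proof -
    have "star (\<Sum>i<k. v i * e * w i) = (\<Sum>i<k. star (w i) * star e * star (v i))" for k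
      by (induction k) (simp_all add: star_0 star_add star_mult mult.assoc)
    then have "star 1 = (\<Sum>i<r. star (w i) * star e * star (v i))" by (simp only: one)
    then show ?thesis by (simp only: star_1)
  qed
  have "\<exists>a. e * a * star e \<noteq> 0"
  proof (rule ccontr)
    assume "\<not> ?thesis"
    then have 0: "e * a * star e = 0" for a by blast
    have "star e = (\<Sum>i<r. v i * (e * w i * star e))"
      using arg_cong[OF one, of "\<lambda>x. x * star e"] by (simp add: sum_distrib_right mult.assoc)
    then have "star e = 0" by (simp only: 0 mult_zero_right sum.neutral_const)
    then show False using e(2) by (simp add: star_eq_0_iff)
  qed
  then obtain a0 where a0: "e * a0 * star e \<noteq> 0" by blast
  define z where "z = e * a0 * star e"
  have ez: "e * z = z" "z * star e = z"
  proof -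
    show "e * z = z" by (simp add: z_def e(1) flip: mult.assoc)
    have "star e * star e = star e" by (simp add: e(1) flip: star_mult)
    then show "z * star e = z" by (simp add: z_def mult.assoc)
  qed
  have "\<exists>i<r. star e * star (v i) * z \<noteq> 0"
  proof (rule ccontr)
    assume "\<not> ?thesis"
    then have 0: "star e * star (v i) * z = 0" if "i < r" for i using that by blast
    have "z = (\<Sum>i<r. star (w i) * (star e * star (v i) * z))"
      using arg_cong[OF one', of "\<lambda>x. x * z"] by (simp add: sum_distrib_right mult.assoc)
    also have "\<dots> = 0" using 0 by (intro sum.neutral) simp
    finally have "z = 0" .
    then show False using a0 by (simp add: z_def)
  qed
  then obtain i where i: "star e * star (v i) * z \<noteq> 0" by blast
  obtain c where c: "e * (star a0 * star e * v i) * e = scaleA c e" using rank_one by blast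
  have "star e * star (v i) * z = star (star z * v i * e)" by (simp add: star_mult star_star mult.assoc)
  also have "star z * v i * e = e * (star a0 * star e * v i) * e"
    by (simp add: z_def star_mult star_star mult.assoc)
  also have "\<dots> = scaleA c e" by (rule c)
  finally have yz: "star e * star (v i) * z = scaleA c (star e)" by (simp add: star_scale)
  have "c \<noteq> 0" using i yz by auto
  define y where "y = scaleA (inverse c) (star e * star (v i))"
  have yz': "y * z = star e"
    using yz \<open>c \<noteq> 0\<close> by (simp add: y_def flip: scale_mult_left)
  have l: "e * a * star e = scaleA (\<kappa> (a * y)) z" for a
  proof -
    have "e * a * star e = e * (a * y) * (e * z)" by (simp add: ez yz' mult.assoc)
    also have "\<dots> = (e * (a * y) * e) * z" by (simp add: mult.assoc)
    also have "\<dots> = scaleA (\<kappa> (a * y)) (e * z)" by (simp only: \<kappa> scale_mult_left)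
    finally show ?thesis by (simp only: ez)
  qed
  have sz: "star z = e * star a0 * star e" by (simp add: z_def star_mult star_star mult.assoc)
  define \<epsilon> where "\<epsilon> = \<kappa> (star a0 * y)"
  have \<epsilon>: "star z = scaleA \<epsilon> z" using l[of "star a0"] by (simp add: sz \<epsilon>_def)
  have z0: "z \<noteq> 0" using a0 by (simp add: z_def)
  have "star (star z) = scaleA \<epsilon> (scaleA \<epsilon> z)" by (simp only: \<epsilon> star_scale)
  then have "scaleA (\<epsilon> * \<epsilon>) z = scaleA 1 z" by (simp only: star_star scale_scale scale_one)
  then have "scaleA (\<epsilon> * \<epsilon> - 1) z = 0" by (simp only: scale_left_diff_distrib right_minus_eq)
  then have "\<epsilon> * \<epsilon> - 1 = 0" using scale_eq_0_iff[of "\<epsilon> * \<epsilon> - 1" z] z0 by blast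
  moreover have "(\<epsilon> - 1) * (\<epsilon> + 1) = \<epsilon> * \<epsilon> - 1" by (simp add: algebra_simps)
  ultimately have "\<epsilon> - 1 = 0 \<or> \<epsilon> + 1 = 0" by (metis mult_eq_0_iff)
  then have "\<epsilon> = 1 \<or> \<epsilon> = -1" by (simp add: eq_neg_iff_add_eq_0)
  with z0 l \<epsilon> show ?thesis by (rule that)
qed

text \<open>Let \<open>l\<close> be the coordinate on \<open>e A e\<^sup>*\<close>. The forms are \<open>l(a b\<^sup>*)\<close> on \<open>eA\<close> and \<open>-\<epsilon> l(h(x,y))\<close> on \<open>eT\<close>; the sign
  \<open>-\<epsilon>\<close> is the one for which the odd operators are skew. If \<open>\<epsilon> = 1\<close>, the form on \<open>eA\<close> is symmetric, so \<open>eA\<close> is the even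
  part; if \<open>\<epsilon> = -1\<close>, the roles of \<open>eA\<close> and \<open>eT\<close> are exchanged.\<close>

theorem simple_osp:
  assumes u1: "u = 1"
  shows "\<exists>n m (b :: 'f vec \<Rightarrow> 'f vec \<Rightarrow> 'f). n > 0 \<and> m > 0 \<and> even m \<and> supersymmetric_form n m b \<and>
    nondegenerate_super_form n m b \<and> superalgebra_isomorphic J.L (osp_super n m b)"
proof -
  obtain z l \<epsilon> where z: "z \<noteq> 0" "star z = scaleA \<epsilon> z" and l: "\<And>a. e * a * star e = scaleA (l a) z"
    and \<epsilon>: "\<epsilon> = 1 \<or> \<epsilon> = - 1"
    using twisted_corner[OF u1] by metis
  have l_eqI: "l a = c" if "e * a * star e = scaleA c z" for a c
    using l[of a] z(1) that by simp
  have l_add: "l (a + b) = l a + l b" for a b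
    by (rule l_eqI) (simp add: l distrib_left distrib_right scale_left_distrib)
  have l_scale: "l (scaleA c a) = c * l a" for c a
    by (rule l_eqI) (simp add: l flip: scale_mult_left scale_mult_right)
  have l_minus: "l (- a) = - l a" for a
    using l_scale[of "- 1" a] by simp
  have l_star: "l (star a) = \<epsilon> * l a" for a
  proof (rule l_eqI)
    have "e * star a * star e = star (e * a * star e)" by (simp add: star_mult star_star mult.assoc)
    also have "\<dots> = scaleA (\<epsilon> * l a) z" by (simp add: l star_scale z(2) mult.commute)
    finally show "e * star a * star e = scaleA (\<epsilon> * l a) z" .
  qed
  have l_0: "e * a * star e = 0" if "l a = 0" for a using l[of a] that by simp
  have one': "1 = (\<Sum>i<r. star (w i) * star e * star (v i))"
  proof -
    have "star (\<Sum>i<k. v i * e * w i) = (\<Sum>i<k. star (w i) * star e * star (v i))" for k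
      by (induction k) (simp_all add: star_0 star_add star_mult mult.assoc)
    then have "star u = (\<Sum>i<r. star (w i) * star e * star (v i))" by (simp only: u_sum)
    then show ?thesis by (simp only: star_1 u1)
  qed
  have zero: "a = 0" if "\<And>b. a * b * star e = 0" for a
  proof -
    have "a = (\<Sum>i<r. (a * star (w i) * star e) * star (v i))"
      using arg_cong[OF one', of "\<lambda>x. a * x"] by (simp add: sum_distrib_left mult.assoc)
    then show ?thesis by (simp only: that mult_zero_left sum.neutral_const)
  qed
  have nondegV: "a = 0" if a: "a \<in> V" and 0: "\<And>b. b \<in> V \<Longrightarrow> l (a * star b) = 0" for a
  proof (rule zero)
    fix b
    have "e * (a * star (e * star b)) * star e = 0"
      by (rule l_0) (rule 0[OF V_closed(2)])
    moreover have "e * (a * star (e * star b)) * star e = (e * a) * b * (star e * star e)"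
      by (simp add: star_mult star_star mult.assoc)
    ultimately show "a * b * star e = 0"
      using a by (simp add: V_def e(1) flip: star_mult)
  qed
  have nondegW: "x = 0" if x: "x \<in> W" and 0: "\<And>y. y \<in> W \<Longrightarrow> l (h x y) = 0" for x
  proof (rule h_nondegenerate(1), rule zero)
    fix y b
    have "e * h x (act e (act (star b) y)) * star e = 0"
      by (rule l_0) (rule 0[OF W_closed(1)])
    moreover have "e * h x (act e (act (star b) y)) * star e = (e * h x y) * b * (star e * star e)"
      by (simp add: h_act star_mult star_star mult.assoc)
    ultimately show "h x y * b * star e = 0"
      using h_in_V[OF x, of y] by (simp add: V_def e(1) flip: star_mult)
  qed
  have char2: "(2::'f) \<noteq> 0"
  proof
    assume "(2::'f) = 0"
    have "(of_nat 3 :: 'f) = 0" using of_nat_CHAR[where 'a = 'f] by (simp only: char3)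
    then have "(3::'f) - 2 = 0" using \<open>(2::'f) = 0\<close> by simp
    then show False by simp
  qed
  obtain n ex cx where X: "coordinates scaleA V n ex cx"
    using coordinates_exist[OF finite_dim(1) V_subspace] .
  obtain m ey cy where Y: "coordinates scaleT W m ey cy"
    using coordinates_exist[OF finite_dim(2) W_subspace] .
  interpret VW: odd_action scaleT p scaleA V n ex cx scaleT W m ey cy "\<lambda>t x. - h x t" "\<lambda>t a. act a t"
    by (rule odd_action_VW[OF X Y])
  show ?thesis
    using \<epsilon>
  proof
    assume \<epsilon>: "\<epsilon> = 1"
    have "\<exists>b. even m \<and> supersymmetric_form n m b \<and> nondegenerate_super_form n m b \<and>
      superalgebra_isomorphic J.L (osp_super n m b)"
    proof (rule VW.Lss_isomorphic_osp_if_full[where \<beta>X = "\<lambda>a b. l (a * star b)" and \<beta>Y = "\<lambda>x y. - l (h x y)"])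
      show "linear_on scaleA (*) V (\<lambda>b. l (a * star b))" for a
        by (simp add: linear_on_def star_add star_scale distrib_left l_add l_scale flip: scale_mult_right)
      show "linear_on scaleT (*) W (\<lambda>y. - l (h x y))" for x
        by (simp add: linear_on_def h_add h_scale l_add l_scale)
      show "l (a * star b) = l (b * star a)" for a b
        using l_star[of "b * star a"] by (simp add: \<epsilon> star_mult star_star)
      show "- l (h x y) = - (- l (h y x))" for x y
        using l_star[of "h y x"] by (simp add: \<epsilon> star_h l_minus)
      show "- l (h (act a t) x) + l (a * star (- h x t)) = 0" for a t x
        by (simp add: h_act star_minus star_h)
    qed (use char2 nondegV nondegW action_full in \<open>auto\<close>)
    then show ?thesis using VW.nm_pos by blast
  next
    assume \<epsilon>: "\<epsilon> = - 1"
    interpret WV: odd_action scaleT p scaleT W m ey cy scaleA V n ex cx "\<lambda>t a. act a t" "\<lambda>t x. - h x t"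
      by (rule VW.swap)
    have "\<exists>b. even n \<and> supersymmetric_form m n b \<and> nondegenerate_super_form m n b \<and>
      superalgebra_isomorphic J.L (osp_super m n b)"
    proof (rule WV.Lss_isomorphic_osp_if_full[where \<beta>Y = "\<lambda>a b. l (a * star b)" and \<beta>X = "\<lambda>x y. l (h x y)"])
      show "linear_on scaleA (*) V (\<lambda>b. l (a * star b))" for a
        by (simp add: linear_on_def star_add star_scale distrib_left l_add l_scale flip: scale_mult_right)
      show "linear_on scaleT (*) W (\<lambda>y. l (h x y))" for x
        by (simp add: linear_on_def h_add h_scale l_add l_scale)
      show "l (a * star b) = - l (b * star a)" for a b
        using l_star[of "b * star a"] by (simp add: \<epsilon> star_mult star_star)
      show "l (h x y) = l (h y x)" for x y
        using l_star[of "h y x"] by (simp add: \<epsilon> star_h l_minus)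
      show "l (- h x t * star a) + l (h x (act a t)) = 0" for a t x
        by (simp add: h_act l_minus)
    qed (use char2 nondegV nondegW action_full in \<open>auto\<close>)
    then show ?thesis using WV.nm_pos by blast
  qed
qed

end

section \<open>Simple algebras with involution\<close>

lemma two_sided_ideal_closed:
  assumes "two_sided_ideal J"
  shows "0 \<in> J" "x \<in> J \<Longrightarrow> y \<in> J \<Longrightarrow> x + y \<in> J" "x \<in> J \<Longrightarrow> a * x \<in> J" "x \<in> J \<Longrightarrow> x * a \<in> J"
    "x \<in> J \<Longrightarrow> y \<in> J \<Longrightarrow> x - y \<in> J"
proof -
  show c: "0 \<in> J" "x \<in> J \<Longrightarrow> y \<in> J \<Longrightarrow> x + y \<in> J" "x \<in> J \<Longrightarrow> a * x \<in> J" "x \<in> J \<Longrightarrow> x * a \<in> J" for x y a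
    using assms by (simp_all add: two_sided_ideal_def)
  show "x \<in> J \<Longrightarrow> y \<in> J \<Longrightarrow> x - y \<in> J"
    using c(2)[of x "(- 1) * y"] c(3)[of y "- 1"] by simp
qed

context algebra_with_involution
begin

lemma star_ideal: "two_sided_ideal J \<Longrightarrow> two_sided_ideal (star ` J)"
  unfolding two_sided_ideal_def[of "star ` J"]
proof (intro conjI ballI allI)
  assume J: "two_sided_ideal J"
  note c = two_sided_ideal_closed[OF J]
  show "0 \<in> star ` J" using c(1) star_0 by force
  show "x + y \<in> star ` J" if "x \<in> star ` J" "y \<in> star ` J" for x y
    using that c(2) star_add by (metis (no_types, lifting) imageE imageI)
  show "a * x \<in> star ` J" "x * a \<in> star ` J" if "x \<in> star ` J" for x a
  proof -
    obtain y where "y \<in> J" "x = star y" using \<open>x \<in> star ` J\<close> by blast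
    then have "a * x = star (y * star a)" "x * a = star (star a * y)" by (simp_all add: star_mult star_star)
    then show "a * x \<in> star ` J" "x * a \<in> star ` J" using c(3,4)[OF \<open>y \<in> J\<close>] by auto
  qed
qed

text \<open>A minimal ideal \<open>B\<close> that is not all of \<open>A\<close> meets its image \<open>B\<^sup>*\<close> trivially and the two add up to \<open>A\<close>,
  because the intersection and the sum are stable under the involution. The component \<open>u\<close> of \<open>1\<close> in \<open>B\<close> is
  then a central idempotent with \<open>u\<^sup>* = 1 - u\<close>.\<close>

lemma proper_minimal_ideal_unit:
  assumes simple: "simple_with_involution star"
    and B: "two_sided_ideal B" "B \<noteq> {0}" "B \<noteq> UNIV"
  obtains u where "u \<in> B" "u \<noteq> 0" "star u = 1 - u" "u * u = u" "\<And>a. u * a = a * u" "\<And>x. x \<in> B \<Longrightarrow> u * x = x"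
proof -
  note c = two_sided_ideal_closed[OF B(1)] and c' = two_sided_ideal_closed[OF star_ideal[OF B(1)]]
  have "two_sided_ideal (B \<inter> star ` B)"
    unfolding two_sided_ideal_def using c c' by auto
  moreover have "star ` (B \<inter> star ` B) \<subseteq> B \<inter> star ` B" by (auto simp: star_star)
  ultimately have "B \<inter> star ` B = {0} \<or> B \<inter> star ` B = UNIV"
    using simple unfolding simple_with_involution_def by blast
  then have meet: "B \<inter> star ` B = {0}" using B(3) by blast
  let ?J = "{x + y | x y. x \<in> B \<and> y \<in> star ` B}"
  have J: "two_sided_ideal ?J"
    unfolding two_sided_ideal_def
  proof (intro conjI ballI allI)
    show "0 \<in> ?J" using c(1) c'(1) by force
    show "x + y \<in> ?J" if "x \<in> ?J" "y \<in> ?J" for x y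
    proof -
      obtain a b a' b' where *: "x = a + b" "y = a' + b'" "a \<in> B" "a' \<in> B" "b \<in> star ` B" "b' \<in> star ` B"
        using \<open>x \<in> ?J\<close> \<open>y \<in> ?J\<close> by blast
      then have "x + y = (a + a') + (b + b')" by (simp add: algebra_simps)
      then show ?thesis using c(2)[OF *(3,4)] c'(2)[OF *(5,6)] by blast
    qed
    show "a * x \<in> ?J" "x * a \<in> ?J" if "x \<in> ?J" for x a
    proof -
      obtain b b' where *: "x = b + b'" "b \<in> B" "b' \<in> star ` B" using \<open>x \<in> ?J\<close> by blast
      have "a * x = a * b + a * b'" "x * a = b * a + b' * a" by (simp_all add: *(1) distrib_left distrib_right)
      then show "a * x \<in> ?J" "x * a \<in> ?J" using c(3,4)[OF *(2)] c'(3,4)[OF *(3)] by blast+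
    qed
  qed
  have J': "star ` ?J \<subseteq> ?J"
  proof
    fix s assume "s \<in> star ` ?J"
    then obtain x y where "x \<in> B" "y \<in> B" "s = star (x + star y)" by blast
    then have "s = y + star x" "y \<in> B" "star x \<in> star ` B" by (simp_all add: star_add star_star add.commute)
    then show "s \<in> ?J" by blast
  qed
  obtain x where x: "x \<in> B" "x \<noteq> 0" using B(2) c(1) by blast
  have "x + 0 \<in> ?J" using x(1) c'(1) by blast
  then have "?J \<noteq> {0}" using x(2) by (metis add.right_neutral singletonD)
  moreover have "?J = {0} \<or> ?J = UNIV"
    using simple[unfolded simple_with_involution_def, rule_format, of ?J] J J' by blast
  ultimately have J_UNIV: "?J = UNIV" by (simp only: simp_thms)
  have "1 \<in> ?J" unfolding J_UNIV by (rule UNIV_I)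
  then obtain u u' where u: "1 = u + u'" "u \<in> B" "u' \<in> star ` B" by blast
  have mixed: "x * y = 0" "y * x = 0" if "x \<in> B" "y \<in> star ` B" for x y
    using meet c(3)[OF that(1), of y] c(4)[OF that(1), of y] c'(3)[OF that(2), of x] c'(4)[OF that(2), of x]
    by blast+
  have unit: "u * x = x" "x * u = x" if x: "x \<in> B" for x
    using arg_cong[OF u(1), of "\<lambda>y. y * x"] arg_cong[OF u(1), of "\<lambda>y. x * y"] mixed[OF x u(3)]
    by (simp_all add: distrib_left distrib_right)
  have central: "u * a = a * u" for a
  proof -
    have "u * a = u * a * u" "a * u = u * (a * u)"
      using unit c(3)[OF u(2), of a] c(4)[OF u(2), of a] by simp_all
    then show ?thesis by (simp add: mult.assoc)
  qed
  have "star u = 1 - u"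
  proof -
    have u': "u' = 1 - u" using u(1) by (simp add: eq_diff_eq add.commute)
    obtain y where y: "y \<in> B" "u' = star y" using u(3) by blast
    have "1 = star u + y"
      using arg_cong[OF u(1), of star] by (simp add: star_1 star_add y(2) star_star)
    then have "star u + y = u + u'" using u(1) by simp
    then have "u' - star u = y - u" by (simp add: algebra_simps)
    also have "y - u \<in> B" using c(5) y(1) u(2) by blast
    finally have "u' - star u \<in> B" .
    moreover have "u' - star u \<in> star ` B" using c'(5) u(2,3) by blast
    ultimately have "u' - star u = 0" using meet by blast
    then show ?thesis using u' by simp
  qed
  moreover have "u \<noteq> 0" using unit(1)[OF x(1)] x(2) by auto
  ultimately show ?thesis using u(2) unit(1) unit(1)[OF u(2)] central by (intro that)
qed

end

section \<open>The superalgebra of a skew-hermitian form\<close>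

theorem theorem5p1:
  fixes scaleA :: "'f::alg_closed_field \<Rightarrow> 'a::ring_1 \<Rightarrow> 'a"
    and star :: "'a \<Rightarrow> 'a"
    and scaleT :: "'f \<Rightarrow> 't::ab_group_add \<Rightarrow> 't"
    and act :: "'a \<Rightarrow> 't \<Rightarrow> 't"
    and h :: "'t \<Rightarrow> 't \<Rightarrow> 'a"
  assumes "CHAR('f) = 3"
    and "algebra_with_involution scaleA star"
    and "finite_dim scaleA"
    and "simple_with_involution star"
    and "left_module scaleA scaleT act"
    and "finite_dim scaleT"
    and "\<exists>x::'t. x \<noteq> 0"
    and "skew_hermitian scaleA scaleT star act h"
    and "nondegenerate_form h"
  shows "J_ternary_algebra scaleT (hermitian_triple act h) \<and>
    lie_superalgebra (Lss scaleT (hermitian_triple act h)) \<and>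
    (first_kind star \<longrightarrow>
       (\<exists>n m (b :: 'f vec \<Rightarrow> 'f vec \<Rightarrow> 'f). n > 0 \<and> m > 0 \<and> even m \<and>
          supersymmetric_form n m b \<and> nondegenerate_super_form n m b \<and>
          superalgebra_isomorphic (Lss scaleT (hermitian_triple act h)) (osp_super n m b))) \<and>
    (second_kind star \<longrightarrow>
       (\<exists>n m. n > 0 \<and> m > 0 \<and>
          superalgebra_isomorphic (Lss scaleT (hermitian_triple act h))
            (psl_super n m :: ('f, 'f mat set) superalgebra)))"
proof -
  interpret skew_hermitian_module scaleA star scaleT act h
    using assms by (intro skew_hermitian_module.intro skew_hermitian_module_axioms.intro)
  \<comment> \<open>A minimal two-sided ideal exists by dimension; whether it is all of \<open>A\<close> decides the kind of the involution.\<close>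
  obtain B :: "'a set" where B: "two_sided_ideal B" "B \<noteq> {0}"
    and minimal: "\<And>J. two_sided_ideal J \<Longrightarrow> J \<subseteq> B \<Longrightarrow> J = {0} \<or> J = B"
  proof -
    let ?F = "{J :: 'a set. two_sided_ideal J \<and> J \<noteq> {0}}"
    have UNIV: "UNIV \<in> ?F"
      by (auto simp: two_sided_ideal_def dest: arg_cong[of _ _ "\<lambda>J. 1 \<in> J"])
    have left: "left_ideal J" if "J \<in> ?F" for J using that two_sided_imp_left_ideal by blast
    show ?thesis
    proof (rule minimal_member[OF assms(3) left UNIV])
      fix B assume B: "B \<in> ?F" and min: "\<And>J. J \<in> ?F \<Longrightarrow> J \<subseteq> B \<Longrightarrow> J = B"
      have "J = {0} \<or> J = B" if "two_sided_ideal J" "J \<subseteq> B" for J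
      proof (cases "J = {0}")
        case False
        then have "J \<in> ?F" using that(1) by simp
        then have "J = B" using that(2) by (rule min)
        then show ?thesis ..
      qed simp
      with B show ?thesis by (intro that[of B]) simp_all
    qed
  qed
  have main: "(first_kind star \<longrightarrow>
       (\<exists>n m (b :: 'f vec \<Rightarrow> 'f vec \<Rightarrow> 'f). n > 0 \<and> m > 0 \<and> even m \<and>
          supersymmetric_form n m b \<and> nondegenerate_super_form n m b \<and>
          superalgebra_isomorphic J.L (osp_super n m b))) \<and>
    (second_kind star \<longrightarrow>
       (\<exists>n m. n > 0 \<and> m > 0 \<and> superalgebra_isomorphic J.L (psl_super n m :: ('f, 'f mat set) superalgebra)))"
  proof (cases "B = UNIV")
    case True
    obtain e :: 'a where idem: "e \<in> B" "e \<noteq> 0" "e * e = e" and rank_one: "\<And>a. \<exists>c. e * a * e = scaleA c e"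
      by (rule rank_one_idempotent[OF assoc_algebra_axioms assms(3) B(1), of 1])
        (use True minimal in auto)
    obtain r :: nat and v w :: "nat \<Rightarrow> 'a" where one: "1 = (\<Sum>i<r. v i * e * w i)"
      by (rule unit_in_generated_ideal[OF B(1) _ idem(1,2) minimal, of 1]) (use True in auto)
    interpret rank_one_module scaleA star scaleT act h 1 e r v w
    proof
      show "CHAR('f) = 3" "finite_dim scaleA" "finite_dim scaleT" "\<exists>x::'t. x \<noteq> 0" by (fact assms)+
    qed (simp_all add: idem rank_one flip: one)
    have "\<not> second_kind star"
    proof
      assume "second_kind star"
      then obtain z where z: "\<And>a. z * a = a * z" "star z \<noteq> z"
        by (auto simp: second_kind_def ring_center_def)
      obtain c where "e * z * e = scaleA c e" using rank_one by blast
      \<comment> \<open>A central element acts on \<open>e\<close> by a scalar, and then on \<open>A e A = A\<close> by the same scalar.\<close>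
      moreover have "z * e = e * z * e" using z(1)[of e] idem(3) by (metis mult.assoc)
      ultimately have ze: "z * e = scaleA c e" by simp
      have comm: "z * (v i * e * w i) = v i * (z * e) * w i" for i using z(1)[of "v i"] by (metis mult.assoc)
      have "z = z * (\<Sum>i<r. v i * e * w i)" by (simp flip: one)
      also have "\<dots> = (\<Sum>i<r. v i * (z * e) * w i)" by (simp only: sum_distrib_left comm)
      also have "\<dots> = scaleA c (\<Sum>i<r. v i * e * w i)"
        by (simp add: ze scale_sum_right flip: scale_mult_left scale_mult_right)
      finally have "z = scaleA c 1" by (simp only: one[symmetric])
      then have "star z = z" by (simp add: star_scale star_1)
      then show False using z(2) by simp
    qed
    then show ?thesis by (intro conjI impI simple_osp[OF refl]) simp
  next
    case False
    obtain u :: 'a where u: "u \<in> B" "u \<noteq> 0" "star u = 1 - u" "u * u = u" "\<And>a. u * a = a * u" "\<And>x. x \<in> B \<Longrightarrow> u * x = x"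
      by (rule proper_minimal_ideal_unit[OF assms(4) B False]) iprover
    obtain e :: 'a where idem: "e \<in> B" "e \<noteq> 0" "e * e = e" and rank_one: "\<And>a. \<exists>c. e * a * e = scaleA c e"
      by (rule rank_one_idempotent[OF assoc_algebra_axioms assms(3) B(1) u(1,2,6) minimal]) auto
    obtain r :: nat and v w :: "nat \<Rightarrow> 'a" where sum: "u = (\<Sum>i<r. v i * e * w i)"
      by (rule unit_in_generated_ideal[OF B(1) u(1) idem(1,2) minimal])
    have isotropic: "(1 - u) * a * star (1 - u) = 0" for a
      using u(5)[of "a * u"] u(5)[of a] by (simp add: star_diff star_1 u(3,4) left_diff_distrib mult.assoc)
    interpret rank_one_module scaleA star scaleT act h u e r v w
    proof
      show "CHAR('f) = 3" "finite_dim scaleA" "finite_dim scaleT" "\<exists>x::'t. x \<noteq> 0" by (fact assms)+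
      show "u * e = e" by (rule u(6)[OF idem(1)])
    qed (fact idem rank_one u(5) sum isotropic)+
    have "\<not> first_kind star"
    proof
      assume "first_kind star"
      moreover have "u \<in> ring_center" using u(5) by (simp add: ring_center_def)
      ultimately have "u = 1 - u" using u(3) by (simp add: first_kind_def)
      then have "u * u = u * (1 - u)" by simp
      then show False using u(2,4) by (simp add: right_diff_distrib)
    qed
    then show ?thesis by (intro conjI impI exchange_psl[OF u(3,4)]) simp
  qed
  then show ?thesis
    by (intro conjI[OF J_ternary_hermitian] conjI[OF lie_superalgebra_Lss_hermitian[OF assms(1)]])
qed

end
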